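(* There exist surjective maps $S_1^{\,i}$, $i\in\{0,1\}$, from the class $\mathcal I$ of $\infty$-homotopies for 2-term Leibniz infinity algebras to the class $\mathcal T$ of 2-term $\infty$-homotopies for 2-term Leibniz infinity algebras.
   Context: $\mathbb K$ is a field of characteristic $0$; everything is $\mathbb Z$-graded with homological degrees, and the Koszul sign rule is used throughout. **2-term Leibniz infinity algebra.** A graded vector space $V=V_0\oplus V_1$ with linear, bilinear, trilinear maps $l_1,l_2,l_3$ on $V$ of degrees $-1,0,1$ such that, for $w,x,y,z\in V_0$, $h,k\in V_1$: (a) $l_1l_2(x,h)=l_2(x,l_1h)$, $l_1l_2(h,x)=l_2(l_1h,x)$; (b) $l_2(l_1h,k)=l_2(h,l_1k)$; (c) $l_1l_3(x,y,z)=l_2(x,l_2(y,z))-l_2(y,l_2(x,z))-l_2(l_2(x,y),z)$; (d) $l_3(x,y,l_1h)=l_2(x,l_2(y,h))-l_2(y,l_2(x,h))-l_2(l_2(x,y),h)$, $l_3(x,l_1h,y)=l_2(x,l_2(h,y))-l_2(h,l_2(x,y))-l_2(l_2(x,h),y)$, $l_3(l_1h,x,y)=l_2(h,l_2(x,y))-l_2(x,l_2(h,y))-l_2(l_2(h,x),y)$; (e) $l_2(l_3(w,x,y),z)+l_2(w,l_3(x,y,z))-l_2(x,l_3(w,y,z))+l_2(y,l_3(w,x,z))-l_3(l_2(w,x),y,z)+l_3(w,l_2(x,y),z)-l_3(x,l_2(w,y),z)-l_3(w,x,l_2(y,z))+l_3(w,y,l_2(x,z))-l_3(x,y,l_2(w,z))=0$.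 **Infinity morphism** $f=(f_1,f_2):(V,l_i)\to(W,m_i)$ between 2-term Leibniz infinity algebras: a linear map $f_1$ from $V$ to $W$ of degree $0$ and a bilinear map $f_2$ from $V$ to $W$ of degree $1$ such that, for $x,y,z\in V_0$, $h\in V_1$: (a) $m_1f_1h=f_1l_1h$; (b) $m_2(f_1x,f_1y)+m_1f_2(x,y)=f_1l_2(x,y)$; (c) $m_2(f_1x,f_1h)=f_1l_2(x,h)-f_2(x,l_1h)$, $m_2(f_1h,f_1x)=f_1l_2(h,x)-f_2(l_1h,x)$; (d) $m_3(f_1x,f_1y,f_1z)-m_2(f_2(x,y),f_1z)+m_2(f_1x,f_2(y,z))-m_2(f_1y,f_2(x,z))=f_1l_3(x,y,z)+f_2(l_2(x,y),z)-f_2(x,l_2(y,z))+f_2(y,l_2(x,z))$. **2-term $\infty$-homotopy** between infinity morphisms $f=(f_1,f_2)$ and $g=(g_1,g_2)$ from $(V,l_i)$ to $(W,m_i)$: a linear map $\theta_1:V\to W$ of degree $1$ such that, for $x,y\in V_0$, $h\in V_1$: (a) $g_1x-f_1x=m_1\theta_1x$; (b) $g_1h-f_1h=\theta_1l_1h$; (c) $g_2(x,y)-f_2(x,y)=\theta_1l_2(x,y)-m_2(f_1x,\theta_1y)-m_2(\theta_1x,g_1y)$. $\mathcal T$ is the class of all of these. **Convolution Lie infinity algebra.** $s$ denotes suspension, $(sV)_k=V_{k-1}$. Let $\mathrm{Zin}^c(sV)=\bigoplus_{n\ge1}(sV)^{\otimes n}$ with comultiplication $\Delta(v_1\cdots v_p)=\sum_{k=1}^{p-1}\sum_{\sigma\in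 \mathrm{Sh}(k,p-k-1)}\varepsilon(\sigma)\,(v_{\sigma(1)}\cdots v_{\sigma(k)})\otimes(v_{\sigma(k+1)}\cdots v_{\sigma(p-1)}v_p)$, where $\mathrm{Sh}(k,p-k-1)$ is the set of $(k,p-k-1)$-shuffles and $\varepsilon(\sigma)$ the Koszul sign. Let $D$ be the unique degree $-1$ coderivation of $\mathrm{Zin}^c(sV)$ whose corestrictions $D_i:(sV)^{\otimes i}\to sV$ satisfy $l_i=s^{-1}D_i\,s^{\otimes i}$ ($D_i=0$ for $i>3$); then $D^2=0$. The graded space $L=L(V,W)=\mathrm{Hom}_{\mathbb K}(\mathrm{Zin}^c(sV),W)$ carries the Lie infinity structure $\mathcal L_1f=m_1\circ f+(-1)^{|f|}f\circ D$ and, for $p\ge2$, $\mathcal L_p(f_1,\dots,f_p)=m_p\circ\big(\sum_{\sigma\in S(p)}\varepsilon(\sigma)\,\mathrm{sign}(\sigma)\,f_{\sigma(1)}\otimes\cdots\otimes f_{\sigma(p)}\big)\circ\Delta^{p-1}$, where $S(p)$ is the symmetric group, $\Delta^{p-1}=(\Delta\otimes\mathrm{id}^{\otimes(p-2)})\cdots(\Delta\otimes\mathrm{id})\Delta$, and $m_p=0$ for $p>3$. An infinity morphism $f=(f_1,f_2):V\to W$ is identified with the degree $-1$ element $\alpha=\alpha^1+\alpha^2\in L$ given by $f_1=\alpha^1 s$, $f_2=\alpha^2 s^{\otimes2}$; these are exactly the Maurer–Cartan (MC) elements of $L$, i.e. the degree $-1$ solutions of $\sum_{p\ge1}\frac1{p!}(-1)^{p(p-1)/2}\mathcal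 L_p(\alpha,\dots,\alpha)=0$. **$\infty$-homotopy.** Let $\Omega_1^\star=\mathbb K[t]\oplus\mathbb K[t]\,dt$ be the polynomial de Rham algebra of the standard 1-simplex, $k$-forms being placed in degree $-k$, with differential $d$ and evaluations $\varepsilon_1^i:\Omega_1^\star\to\mathbb K$ at $t=i$, $i\in\{0,1\}$ (extended to $L\otimes\Omega_1^\star\to L$). $\bar L=L\otimes\Omega_1^\star$ carries the Lie infinity structure $\bar{\mathcal L}_1=\mathcal L_1\otimes\mathrm{id}+\mathrm{id}\otimes d$, with $(\mathrm{id}\otimes d)(\ell\otimes\omega)=(-1)^{|\ell|}\ell\otimes d\omega$, and $\bar{\mathcal L}_p(\ell_1\otimes\omega_1,\dots,\ell_p\otimes\omega_p)=\pm\mathcal L_p(\ell_1,\dots,\ell_p)\otimes\omega_1\cdots\omega_p$ ($p\ge2$, Koszul sign). An $\infty$-homotopy from $f$ to $g$ (infinity morphisms $V\to W$ between 2-term Leibniz infinity algebras) is an MC element $\bar\gamma$ of $\bar L$ (degree $-1$, same MC equation with $\bar{\mathcal L}_p$) such that $\varepsilon_1^0\bar\gamma=f$ and $\varepsilon_1^1\bar\gamma=g$. $\mathcal I$ is the class of all of these. *)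

theory Defs
  imports
    "HOL-Computational_Algebra.Polynomial"
    "HOL-Combinatorics.Permutations"
    "HOL-Library.Poly_Mapping"
begin

section \<open>2-term Leibniz infinity algebras\<close>

record ('k, 'v) leib2 =
  scl :: "'k \<Rightarrow> 'v \<Rightarrow> 'v"
  gr :: "int \<Rightarrow> 'v set"
  br1 :: "'v \<Rightarrow> 'v"
  br2 :: "'v \<Rightarrow> 'v \<Rightarrow> 'v"
  br3 :: "'v \<Rightarrow> 'v \<Rightarrow> 'v \<Rightarrow> 'v"

text \<open>The whole type \<open>'v\<close> is the vector space \<open>V\<close>; \<open>gr V i\<close> is its homogeneous part of
  degree \<open>i\<close>.\<close>

definition graded_2term :: "('k::field_char_0, 'v::ab_group_add) leib2 \<Rightarrow> bool" where
  "graded_2term V \<longleftrightarrow>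
     vector_space (scl V) \<and>
     (\<forall>i. module.subspace (scl V) (gr V i)) \<and>
     (\<forall>i. i \<notin> {0, 1} \<longrightarrow> gr V i = {0}) \<and>
     (\<forall>v. \<exists>!(x, h). x \<in> gr V 0 \<and> h \<in> gr V 1 \<and> v = x + h)"

definition bilinear_map ::
  "('k::field \<Rightarrow> 'v::ab_group_add \<Rightarrow> 'v) \<Rightarrow> ('k \<Rightarrow> 'w::ab_group_add \<Rightarrow> 'w) \<Rightarrow> ('v \<Rightarrow> 'v \<Rightarrow> 'w) \<Rightarrow> bool" where
  "bilinear_map s t b \<longleftrightarrow>
     (\<forall>u. Vector_Spaces.linear s t (\<lambda>v. b u v)) \<and> (\<forall>v. Vector_Spaces.linear s t (\<lambda>u. b u v))"

definition trilinear_map ::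
  "('k::field \<Rightarrow> 'v::ab_group_add \<Rightarrow> 'v) \<Rightarrow> ('k \<Rightarrow> 'w::ab_group_add \<Rightarrow> 'w) \<Rightarrow> ('v \<Rightarrow> 'v \<Rightarrow> 'v \<Rightarrow> 'w) \<Rightarrow> bool" where
  "trilinear_map s t b \<longleftrightarrow>
     (\<forall>u v. Vector_Spaces.linear s t (\<lambda>w. b u v w)) \<and>
     (\<forall>u w. Vector_Spaces.linear s t (\<lambda>v. b u v w)) \<and>
     (\<forall>v w. Vector_Spaces.linear s t (\<lambda>u. b u v w))"

definition leibniz_2term :: "('k::field_char_0, 'v::ab_group_add) leib2 \<Rightarrow> bool" where
  "leibniz_2term V \<longleftrightarrow>
     graded_2term V \<and>
     Vector_Spaces.linear (scl V) (scl V) (br1 V) \<and>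
     bilinear_map (scl V) (scl V) (br2 V) \<and>
     trilinear_map (scl V) (scl V) (br3 V) \<and>
     (\<forall>i. \<forall>u\<in>gr V i. br1 V u \<in> gr V (i - 1)) \<and>
     (\<forall>i j. \<forall>u\<in>gr V i. \<forall>v\<in>gr V j. br2 V u v \<in> gr V (i + j)) \<and>
     (\<forall>i j k. \<forall>u\<in>gr V i. \<forall>v\<in>gr V j. \<forall>w\<in>gr V k. br3 V u v w \<in> gr V (i + j + k + 1)) \<and>
     (let l1 = br1 V; l2 = br2 V; l3 = br3 V; V0 = gr V 0; V1 = gr V 1 in
       (\<forall>x\<in>V0. \<forall>h\<in>V1. l1 (l2 x h) = l2 x (l1 h) \<and> l1 (l2 h x) = l2 (l1 h) x) \<and>
       (\<forall>h\<in>V1. \<forall>k\<in>V1. l2 (l1 h) k = l2 h (l1 k)) \<and>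
       (\<forall>x\<in>V0. \<forall>y\<in>V0. \<forall>z\<in>V0.
          l1 (l3 x y z) = l2 x (l2 y z) - l2 y (l2 x z) - l2 (l2 x y) z) \<and>
       (\<forall>x\<in>V0. \<forall>y\<in>V0. \<forall>h\<in>V1.
          l3 x y (l1 h) = l2 x (l2 y h) - l2 y (l2 x h) - l2 (l2 x y) h \<and>
          l3 x (l1 h) y = l2 x (l2 h y) - l2 h (l2 x y) - l2 (l2 x h) y \<and>
          l3 (l1 h) x y = l2 h (l2 x y) - l2 x (l2 h y) - l2 (l2 h x) y) \<and>
       (\<forall>w\<in>V0. \<forall>x\<in>V0. \<forall>y\<in>V0. \<forall>z\<in>V0.
          l2 (l3 w x y) z + l2 w (l3 x y z) - l2 x (l3 w y z) + l2 y (l3 w x z)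
          - l3 (l2 w x) y z + l3 w (l2 x y) z - l3 x (l2 w y) z
          - l3 w x (l2 y z) + l3 w y (l2 x z) - l3 x y (l2 w z) = 0))"

type_synonym ('v, 'w) inf_mor = "('v \<Rightarrow> 'w) \<times> ('v \<Rightarrow> 'v \<Rightarrow> 'w)"

definition infinity_morphism ::
  "('k::field_char_0, 'v::ab_group_add) leib2 \<Rightarrow> ('k, 'w::ab_group_add) leib2 \<Rightarrow> ('v, 'w) inf_mor \<Rightarrow> bool" where
  "infinity_morphism V W f \<longleftrightarrow>
     (let f1 = fst f; f2 = snd f; V0 = gr V 0; V1 = gr V 1;
          l1 = br1 V; l2 = br2 V; l3 = br3 V; m1 = br1 W; m2 = br2 W; m3 = br3 W in
       Vector_Spaces.linear (scl V) (scl W) f1 \<and>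
       bilinear_map (scl V) (scl W) f2 \<and>
       (\<forall>i. \<forall>u\<in>gr V i. f1 u \<in> gr W i) \<and>
       (\<forall>i j. \<forall>u\<in>gr V i. \<forall>v\<in>gr V j. f2 u v \<in> gr W (i + j + 1)) \<and>
       (\<forall>h\<in>V1. m1 (f1 h) = f1 (l1 h)) \<and>
       (\<forall>x\<in>V0. \<forall>y\<in>V0. m2 (f1 x) (f1 y) + m1 (f2 x y) = f1 (l2 x y)) \<and>
       (\<forall>x\<in>V0. \<forall>h\<in>V1.
          m2 (f1 x) (f1 h) = f1 (l2 x h) - f2 x (l1 h) \<and>
          m2 (f1 h) (f1 x) = f1 (l2 h x) - f2 (l1 h) x) \<and>
       (\<forall>x\<in>V0. \<forall>y\<in>V0. \<forall>z\<in>V0.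
          m3 (f1 x) (f1 y) (f1 z) - m2 (f2 x y) (f1 z) + m2 (f1 x) (f2 y z) - m2 (f1 y) (f2 x z)
          = f1 (l3 x y z) + f2 (l2 x y) z - f2 x (l2 y z) + f2 y (l2 x z)))"

definition homotopy_2term ::
  "('k::field_char_0, 'v::ab_group_add) leib2 \<Rightarrow> ('k, 'w::ab_group_add) leib2 \<Rightarrow>
   ('v, 'w) inf_mor \<Rightarrow> ('v, 'w) inf_mor \<Rightarrow> ('v \<Rightarrow> 'w) \<Rightarrow> bool" where
  "homotopy_2term V W f g \<theta> \<longleftrightarrow>
     (let V0 = gr V 0; V1 = gr V 1; l1 = br1 V; l2 = br2 V; m1 = br1 W; m2 = br2 W in
       Vector_Spaces.linear (scl V) (scl W) \<theta> \<and>
       (\<forall>i. \<forall>u\<in>gr V i. \<theta> u \<in> gr W (i + 1)) \<and>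
       (\<forall>x\<in>V0. fst g x - fst f x = m1 (\<theta> x)) \<and>
       (\<forall>h\<in>V1. fst g h - fst f h = \<theta> (l1 h)) \<and>
       (\<forall>x\<in>V0. \<forall>y\<in>V0.
          snd g x y - snd f x y = \<theta> (l2 x y) - m2 (fst f x) (\<theta> y) - m2 (\<theta> x) (fst g y)))"

section \<open>The Zinbiel coalgebra of the suspension\<close>

text \<open>\<open>a \<Rightarrow>\<^sub>0 'k\<close> is the free vector space on \<open>'a\<close>. An element of \<open>Zin\<^sup>c(sV)\<close> is represented by a
  formal sum of nonempty words \<open>[v\<^sub>1, \<dots>, v\<^sub>p]\<close>, standing for \<open>sv\<^sub>1 \<otimes> \<dots> \<otimes> sv\<^sub>p\<close>, modulo the
  multilinearity relations; likewise for \<open>Zin\<^sup>c(sV) \<otimes> Zin\<^sup>c(sV)\<close> and pairs of words.\<close>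

definition fscale :: "'k::field \<Rightarrow> ('a \<Rightarrow>\<^sub>0 'k) \<Rightarrow> ('a \<Rightarrow>\<^sub>0 'k)" where
  "fscale c a = Poly_Mapping.map ((*) c) a"

text \<open>Linear extension of \<open>F\<close> from the basis \<open>'a\<close>.\<close>

definition fext :: "('k::field \<Rightarrow> 'w \<Rightarrow> 'w) \<Rightarrow> ('a \<Rightarrow> 'w::ab_group_add) \<Rightarrow> ('a \<Rightarrow>\<^sub>0 'k) \<Rightarrow> 'w" where
  "fext s F a = (\<Sum>x\<in>Poly_Mapping.keys a. s (Poly_Mapping.lookup a x) (F x))"

text \<open>Subspace of multilinearity relations; \<open>C\<close> is the set of all ways of filling one letter of a
  tensor, the other letters being held fixed.\<close>

definition tensor_rels ::
  "('k::field \<Rightarrow> 'v::ab_group_add \<Rightarrow> 'v) \<Rightarrow> ('v \<Rightarrow> 'a) set \<Rightarrow> ('a \<Rightarrow>\<^sub>0 'k) set" where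
  "tensor_rels s C = module.span fscale
     ({Poly_Mapping.single (c (u + v)) 1 - Poly_Mapping.single (c u) 1 - Poly_Mapping.single (c v) 1
        | c u v. c \<in> C} \<union>
      {Poly_Mapping.single (c (s a v)) 1 - Poly_Mapping.single (c v) a | c a v. c \<in> C})"

definition word_slots :: "('v \<Rightarrow> 'v list) set" where
  "word_slots = {\<lambda>v. us @ v # vs | us vs. True}"

definition pair_slots :: "('v \<Rightarrow> 'v list \<times> 'v list) set" where
  "pair_slots = {\<lambda>v. (us @ v # vs, w) | us vs w. True} \<union> {\<lambda>v. (w, us @ v # vs) | us vs w. True}"

text \<open>Words in homogeneous letters. They span, so linear maps and identities on \<open>Zin\<^sup>c(sV)\<close> are given
  on them. Their degrees are taken in \<open>sV\<close>; the letter \<open>0\<close> counts as an element of \<open>V\<^sub>0\<close>.\<close>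

definition hwords :: "('k, 'v) leib2 \<Rightarrow> 'v list set" where
  "hwords V = {w. w \<noteq> [] \<and> set w \<subseteq> gr V 0 \<union> gr V 1}"

definition ldeg :: "('k, 'v) leib2 \<Rightarrow> 'v \<Rightarrow> int" where
  "ldeg V v = (if v \<in> gr V 0 then 0 else 1)"

definition wdeg :: "('k, 'v) leib2 \<Rightarrow> 'v list \<Rightarrow> int" where
  "wdeg V w = (\<Sum>v\<leftarrow>w. ldeg V v + 1)"

definition psgn :: "int \<Rightarrow> 'k::field" where
  "psgn d = (if even d then 1 else - 1)"

text \<open>Koszul sign of \<open>x\<^sub>0 \<cdots> x\<^sub>n\<^sub>-\<^sub>1 \<mapsto> x\<^bsub>\<sigma> 0\<^esub> \<cdots> x\<^bsub>\<sigma>(n-1)\<^esub>\<close>, where \<open>x\<^sub>i\<close> has degree \<open>d i\<close>.\<close>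

definition koszul :: "nat \<Rightarrow> (nat \<Rightarrow> int) \<Rightarrow> (nat \<Rightarrow> nat) \<Rightarrow> 'k::field" where
  "koszul n d \<sigma> = (\<Prod>(i, j)\<in>{(i, j). i < j \<and> j < n \<and> \<sigma> j < \<sigma> i}. psgn (d (\<sigma> i) * d (\<sigma> j)))"

definition shuffle_perms :: "nat \<Rightarrow> nat \<Rightarrow> (nat \<Rightarrow> nat) set" where
  "shuffle_perms k m = {\<sigma>. \<sigma> permutes {..<k + m} \<and> strict_mono_on {..<k} \<sigma> \<and> strict_mono_on {k..<k + m} \<sigma>}"

text \<open>A \<open>(k, p - k - 1)\<close>-shuffle is the identity from position \<open>p - 1\<close> on, so the last letter stays.\<close>

definition zin_delta :: "('k::field, 'v) leib2 \<Rightarrow> 'v list \<Rightarrow> ('v list \<times> 'v list \<Rightarrow>\<^sub>0 'k)" where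
  "zin_delta V w = (let p = length w in
     \<Sum>k\<in>{1..<p}. \<Sum>\<sigma>\<in>shuffle_perms k (p - k - 1).
       let u = map (\<lambda>i. w ! \<sigma> i) [0..<p] in
       Poly_Mapping.single (take k u, drop k u) (koszul p (\<lambda>i. ldeg V (w ! i) + 1) \<sigma>))"

text \<open>The \<open>n\<close>-th iterate \<open>(\<Delta> \<otimes> id\<^bsup>n-1\<^esup>) \<cdots> (\<Delta> \<otimes> id) \<Delta>\<close>.\<close>

primrec zin_delta_iter :: "('k::field, 'v) leib2 \<Rightarrow> nat \<Rightarrow> 'v list \<Rightarrow> ('v list list \<Rightarrow>\<^sub>0 'k)" where
  "zin_delta_iter V 0 w = Poly_Mapping.single [w] 1"
| "zin_delta_iter V (Suc n) w =
     fext fscale (\<lambda>ws. fext fscale (\<lambda>(a, b). Poly_Mapping.single (a # b # tl ws) 1) (zin_delta V (hd ws)))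
       (zin_delta_iter V n w)"

text \<open>Degree \<open>-1\<close> coderivations, given by representatives of the images of the words.\<close>

definition coderivation ::
  "('k::field_char_0, 'v::ab_group_add) leib2 \<Rightarrow> ('v list \<Rightarrow> ('v list \<Rightarrow>\<^sub>0 'k)) \<Rightarrow> bool" where
  "coderivation V D \<longleftrightarrow>
     (\<forall>w\<in>hwords V. Poly_Mapping.keys (D w) \<subseteq> {u \<in> hwords V. wdeg V u = wdeg V w - 1}) \<and>
     (\<forall>us vs i u v. us @ u # vs \<in> hwords V \<and> i \<in> {0, 1} \<and> u \<in> gr V i \<and> v \<in> gr V i \<longrightarrow>
        D (us @ (u + v) # vs) - D (us @ u # vs) - D (us @ v # vs) \<in> tensor_rels (scl V) word_slots) \<and>
     (\<forall>us vs u c. us @ u # vs \<in> hwords V \<longrightarrow>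
        D (us @ scl V c u # vs) - fscale c (D (us @ u # vs)) \<in> tensor_rels (scl V) word_slots) \<and>
     (\<forall>w\<in>hwords V.
        fext fscale (zin_delta V) (D w)
        - fext fscale (\<lambda>(a, b).
            fext fscale (\<lambda>a'. Poly_Mapping.single (a', b) 1) (D a)
            + fscale (psgn (wdeg V a)) (fext fscale (\<lambda>b'. Poly_Mapping.single (a, b') 1) (D b)))
          (zin_delta V w)
        \<in> tensor_rels (scl V) pair_slots)"

fun bracket :: "('k, 'v::ab_group_add) leib2 \<Rightarrow> 'v list \<Rightarrow> 'v" where
  "bracket V [u] = br1 V u"
| "bracket V [u, v] = br2 V u v"
| "bracket V [u, v, w] = br3 V u v w"
| "bracket V _ = 0"

text \<open>Koszul sign of \<open>(g\<^sub>1 \<otimes> \<dots> \<otimes> g\<^sub>p)(x\<^sub>1 \<otimes> \<dots> \<otimes> x\<^sub>p)\<close> for \<open>g\<^sub>i\<close>, \<open>x\<^sub>j\<close> of degrees \<open>ds ! i\<close>, \<open>es ! j\<close>.\<close>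

definition tensor_sgn :: "int list \<Rightarrow> int list \<Rightarrow> 'k::field" where
  "tensor_sgn ds es = (\<Prod>(i, j)\<in>{(i, j). j < i \<and> i < length ds}. psgn (ds ! i * es ! j))"

text \<open>\<open>l\<^sub>i = s\<^sup>-\<^sup>1 D\<^sub>i s\<^bsup>\<otimes>i\<^esup>\<close>, where \<open>D\<^sub>i\<close> is the component of \<open>D\<close> from words of length \<open>i\<close> to words of
  length 1; the sign is that of \<open>s\<^bsup>\<otimes>i\<^esup>(v\<^sub>1 \<otimes> \<dots> \<otimes> v\<^sub>i)\<close>.\<close>

definition corestrictions ::
  "('k::field_char_0, 'v::ab_group_add) leib2 \<Rightarrow> ('v list \<Rightarrow> ('v list \<Rightarrow>\<^sub>0 'k)) \<Rightarrow> bool" where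
  "corestrictions V D \<longleftrightarrow>
     (\<forall>w\<in>hwords V.
        bracket V w =
        scl V (tensor_sgn (replicate (length w) 1) (map (ldeg V) w))
          (fext (scl V) (\<lambda>u. if length u = 1 then hd u else 0) (D w)))"

text \<open>Such a \<open>D\<close> exists (\<open>zin_D_ok\<close> below) and is unique modulo the multilinearity relations, which
  the multilinear functions composed with it do not see.\<close>

definition zin_D :: "('k::field_char_0, 'v::ab_group_add) leib2 \<Rightarrow> 'v list \<Rightarrow> ('v list \<Rightarrow>\<^sub>0 'k)" where
  "zin_D V = (SOME D. coderivation V D \<and> corestrictions V D)"

section \<open>The convolution Lie infinity algebra\<close>

text \<open>A linear map on \<open>Zin\<^sup>c(sV)\<close> is a multilinear function of words; the empty word is not part of
  \<open>Zin\<^sup>c(sV)\<close>.\<close>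

definition conv_hom ::
  "('k::field_char_0, 'v::ab_group_add) leib2 \<Rightarrow> ('k, 'w::ab_group_add) leib2 \<Rightarrow> int \<Rightarrow> ('v list \<Rightarrow> 'w) set" where
  "conv_hom V W d = {f.
     f [] = 0 \<and>
     (\<forall>us vs. Vector_Spaces.linear (scl V) (scl W) (\<lambda>v. f (us @ v # vs))) \<and>
     (\<forall>w\<in>hwords V. f w \<in> gr W (wdeg V w + d))}"

text \<open>\<open>\<L>\<^sub>p(f\<^sub>1, \<dots>, f\<^sub>p)\<close> on homogeneous words, \<open>f\<^sub>i = fs ! i\<close> being of degree \<open>ds ! i\<close>.\<close>

definition conv_bracket ::
  "('k::field_char_0, 'v::ab_group_add) leib2 \<Rightarrow> ('k, 'w::ab_group_add) leib2 \<Rightarrow>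
   int list \<Rightarrow> ('v list \<Rightarrow> 'w) list \<Rightarrow> 'v list \<Rightarrow> 'w" where
  "conv_bracket V W ds fs w = (let p = length fs in
     if p = 1 then br1 W (hd fs w) + scl W (psgn (hd ds)) (fext (scl W) (hd fs) (zin_D V w))
     else fext (scl W)
       (\<lambda>ws. \<Sum>\<sigma> | \<sigma> permutes {..<p}.
          scl W (koszul p (\<lambda>i. ds ! i) \<sigma> * of_int (sign \<sigma>)
                 * tensor_sgn (map (\<lambda>i. ds ! \<sigma> i) [0..<p]) (map (wdeg V) ws))
            (bracket W (map (\<lambda>i. (fs ! \<sigma> i) (ws ! i)) [0..<p])))
       (zin_delta_iter V (p - 1) w))"

text \<open>The element \<open>\<alpha> = \<alpha>\<^sup>1 + \<alpha>\<^sup>2\<close> with \<open>f\<^sub>1 = \<alpha>\<^sup>1 s\<close> and \<open>f\<^sub>2 = \<alpha>\<^sup>2 s\<^bsup>\<otimes>2\<^esup>\<close>. As \<open>f\<^sub>2\<close> vanishes outside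
  \<open>V\<^sub>0 \<otimes> V\<^sub>0\<close>, where \<open>s\<^bsup>\<otimes>2\<^esup>\<close> carries no sign, no sign appears.\<close>

fun mc_of :: "('v, 'w::ab_group_add) inf_mor \<Rightarrow> 'v list \<Rightarrow> 'w" where
  "mc_of f [u] = fst f u"
| "mc_of f [u, v] = snd f u v"
| "mc_of f _ = 0"

section \<open>Homotopies\<close>

text \<open>\<open>\<Omega>\<^sub>1\<close>: the pair \<open>(p, q)\<close> is the form \<open>p + q dt\<close>. Its basis consists of the monomials \<open>t\<^sup>n\<close>, encoded
  as \<open>(n, False)\<close>, and \<open>t\<^sup>n dt\<close>, encoded as \<open>(n, True)\<close>.\<close>

type_synonym 'k form = "'k poly \<times> 'k poly"
type_synonym mono = "nat \<times> bool"

definition form_mult :: "'k::field form \<Rightarrow> 'k form \<Rightarrow> 'k form" where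
  "form_mult \<omega> \<eta> = (fst \<omega> * fst \<eta>, fst \<omega> * snd \<eta> + snd \<omega> * fst \<eta>)"

definition form_d :: "'k::field_char_0 form \<Rightarrow> 'k form" where
  "form_d \<omega> = (0, pderiv (fst \<omega>))"

definition form_eval :: "'k::field \<Rightarrow> 'k form \<Rightarrow> 'k" where
  "form_eval c \<omega> = poly (fst \<omega>) c"

definition mono_form :: "mono \<Rightarrow> 'k::field form" where
  "mono_form e = (if snd e then (0, monom 1 (fst e)) else (monom 1 (fst e), 0))"

definition mono_coeff :: "'k::field form \<Rightarrow> mono \<Rightarrow> 'k" where
  "mono_coeff \<omega> e = coeff (if snd e then snd \<omega> else fst \<omega>) (fst e)"

definition mono_deg :: "mono \<Rightarrow> int" where
  "mono_deg e = (if snd e then - 1 else 0)"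

text \<open>An element of \<open>L \<otimes> \<Omega>\<^sub>1\<close> is uniquely a finite sum \<open>\<Sum>\<^sub>e \<gamma> e \<otimes> e\<close> over monomials \<open>e\<close>.\<close>

definition msupp :: "(mono \<Rightarrow> 'v list \<Rightarrow> 'w::zero) \<Rightarrow> mono set" where
  "msupp \<gamma> = {e. \<exists>w. \<gamma> e w \<noteq> 0}"

definition conv_forms ::
  "('k::field_char_0, 'v::ab_group_add) leib2 \<Rightarrow> ('k, 'w::ab_group_add) leib2 \<Rightarrow> int \<Rightarrow>
   (mono \<Rightarrow> 'v list \<Rightarrow> 'w) set" where
  "conv_forms V W d = {\<gamma>. finite (msupp \<gamma>) \<and> (\<forall>e. \<gamma> e \<in> conv_hom V W (d - mono_deg e))}"

text \<open>Coefficient at the monomial \<open>e\<close> of the bracket of \<open>\<gamma>s\<close> (of degrees \<open>ds\<close>), obtained by expanding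
  each argument into monomials \<open>es\<close>. The Koszul sign comes from
  \<open>\<ell>\<^sub>1 \<otimes> \<omega>\<^sub>1 \<otimes> \<dots> \<otimes> \<ell>\<^sub>p \<otimes> \<omega>\<^sub>p \<mapsto> \<ell>\<^sub>1 \<otimes> \<dots> \<otimes> \<ell>\<^sub>p \<otimes> \<omega>\<^sub>1 \<otimes> \<dots> \<otimes> \<omega>\<^sub>p\<close>.\<close>

definition forms_bracket ::
  "('k::field_char_0, 'v::ab_group_add) leib2 \<Rightarrow> ('k, 'w::ab_group_add) leib2 \<Rightarrow>
   int list \<Rightarrow> (mono \<Rightarrow> 'v list \<Rightarrow> 'w) list \<Rightarrow> mono \<Rightarrow> 'v list \<Rightarrow> 'w" where
  "forms_bracket V W ds \<gamma>s e w = (let p = length \<gamma>s in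
     if p = 1 then
       conv_bracket V W [hd ds - mono_deg e] [hd \<gamma>s e] w
       + (\<Sum>e'\<in>msupp (hd \<gamma>s).
            scl W (psgn (hd ds - mono_deg e') * mono_coeff (form_d (mono_form e')) e) (hd \<gamma>s e' w))
     else
       (\<Sum>es\<in>listset (map msupp \<gamma>s).
          let cs = map (\<lambda>i. ds ! i - mono_deg (es ! i)) [0..<p] in
          scl W ((\<Prod>(i, j)\<in>{(i, j). i < j \<and> j < p}. psgn (mono_deg (es ! i) * cs ! j))
                 * mono_coeff (foldr form_mult (map mono_form es) (1, 0)) e)
            (conv_bracket V W cs (map (\<lambda>i. (\<gamma>s ! i) (es ! i)) [0..<p]) w)))"

text \<open>The brackets with more than 3 arguments vanish.\<close>

definition mc_forms ::
  "('k::field_char_0, 'v::ab_group_add) leib2 \<Rightarrow> ('k, 'w::ab_group_add) leib2 \<Rightarrow>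
   (mono \<Rightarrow> 'v list \<Rightarrow> 'w) \<Rightarrow> bool" where
  "mc_forms V W \<gamma> \<longleftrightarrow>
     \<gamma> \<in> conv_forms V W (- 1) \<and>
     (\<forall>e. \<forall>w\<in>hwords V.
        (\<Sum>p = 1..3. scl W ((- 1) ^ (p * (p - 1) div 2) / fact p)
           (forms_bracket V W (replicate p (- 1)) (replicate p \<gamma>) e w)) = 0)"

definition conv_eval ::
  "('k::field_char_0, 'w::ab_group_add) leib2 \<Rightarrow> 'k \<Rightarrow> (mono \<Rightarrow> 'v list \<Rightarrow> 'w) \<Rightarrow> 'v list \<Rightarrow> 'w" where
  "conv_eval W c \<gamma> w = (\<Sum>e\<in>msupp \<gamma>. scl W (form_eval c (mono_form e)) (\<gamma> e w))"

definition infinity_homotopy ::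
  "('k::field_char_0, 'v::ab_group_add) leib2 \<Rightarrow> ('k, 'w::ab_group_add) leib2 \<Rightarrow>
   ('v, 'w) inf_mor \<Rightarrow> ('v, 'w) inf_mor \<Rightarrow> (mono \<Rightarrow> 'v list \<Rightarrow> 'w) \<Rightarrow> bool" where
  "infinity_homotopy V W f g \<gamma> \<longleftrightarrow>
     mc_forms V W \<gamma> \<and> conv_eval W 0 \<gamma> = mc_of f \<and> conv_eval W 1 \<gamma> = mc_of g"

text \<open>Homotopies come with their algebras, source and target.\<close>

type_synonym ('k, 'v, 'w, 'h) htpy =
  "('k, 'v) leib2 \<times> ('k, 'w) leib2 \<times> ('v, 'w) inf_mor \<times> ('v, 'w) inf_mor \<times> 'h"

definition class_I ::
  "('k::field_char_0, 'v::ab_group_add, 'w::ab_group_add, mono \<Rightarrow> 'v list \<Rightarrow> 'w) htpy set" where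
  "class_I = {(V, W, f, g, \<gamma>). leibniz_2term V \<and> leibniz_2term W \<and>
     infinity_morphism V W f \<and> infinity_morphism V W g \<and> infinity_homotopy V W f g \<gamma>}"

definition class_T ::
  "('k::field_char_0, 'v::ab_group_add, 'w::ab_group_add, 'v \<Rightarrow> 'w) htpy set" where
  "class_T = {(V, W, f, g, \<theta>). leibniz_2term V \<and> leibniz_2term W \<and>
     infinity_morphism V W f \<and> infinity_morphism V W g \<and> homotopy_2term V W f g \<theta>}"

section \<open>Existence of the coderivation\<close>

lemma lookup_fscale: "Poly_Mapping.lookup (fscale c a) x = c * Poly_Mapping.lookup a x"
  unfolding fscale_def by (simp add: Poly_Mapping.map.rep_eq when_def)

lemma vs_fscale: "vector_space (fscale :: 'k::field \<Rightarrow> ('a \<Rightarrow>\<^sub>0 'k) \<Rightarrow> _)"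
  by unfold_locales (auto intro!: poly_mapping_eqI simp: lookup_fscale lookup_add algebra_simps)

lemma fscale_simps [simp]:
  "fscale c (Poly_Mapping.single x e) = Poly_Mapping.single x (c * e)"
  "fscale 1 a = a" "fscale 0 a = 0" "fscale c 0 = 0"
  "fscale c (fscale e a) = fscale (c * e) a"
  "fscale (- 1) a = - a"
  by (auto intro!: poly_mapping_eqI simp: lookup_fscale lookup_single when_def algebra_simps)

lemma fscale_add: "fscale c (a + b) = fscale c a + fscale c b"
  by (auto intro!: poly_mapping_eqI simp: lookup_fscale lookup_add algebra_simps)

lemma fscale_diff: "fscale c (a - b) = fscale c a - fscale c b"
  by (auto intro!: poly_mapping_eqI simp: lookup_fscale lookup_minus right_diff_distrib)

context
  fixes s :: "'k::field \<Rightarrow> 'w::ab_group_add \<Rightarrow> 'w"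
  assumes s: "vector_space s"
begin

interpretation vector_space s by (rule s)

lemma fext_superset:
  assumes "finite S" "Poly_Mapping.keys a \<subseteq> S"
  shows "fext s F a = (\<Sum>x\<in>S. s (Poly_Mapping.lookup a x) (F x))"
  unfolding fext_def using assms
  by (intro sum.mono_neutral_left) (auto simp: in_keys_iff)

lemma fext_0: "fext s F 0 = 0"
  by (simp add: fext_def)

lemma fext_single: "fext s F (Poly_Mapping.single x c) = s c (F x)"
  by (simp add: fext_def)

lemma fext_add: "fext s F (a + b) = fext s F a + fext s F b"
proof -
  let ?S = "Poly_Mapping.keys a \<union> Poly_Mapping.keys b"
  have "Poly_Mapping.keys (a + b) \<subseteq> ?S" by (rule Poly_Mapping.keys_add)
  then show ?thesis
    by (subst (1 2 3) fext_superset[of ?S])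
       (auto simp: lookup_add scale_left_distrib sum.distrib)
qed

lemma fext_fscale: "fext s F (fscale c a) = s c (fext s F a)"
proof -
  have "Poly_Mapping.keys (fscale c a) \<subseteq> Poly_Mapping.keys a"
    by (auto simp: in_keys_iff lookup_fscale)
  then have "fext s F (fscale c a) = (\<Sum>x\<in>Poly_Mapping.keys a. s (c * Poly_Mapping.lookup a x) (F x))"
    by (subst fext_superset[of "Poly_Mapping.keys a"]) (auto simp: lookup_fscale)
  then show ?thesis by (simp add: fext_def scale_sum_right)
qed

lemma fext_uminus: "fext s F (- a) = - fext s F a"
  using fext_fscale[of F "-1" a] by simp

lemma fext_diff: "fext s F (a - b) = fext s F a - fext s F b"
  using fext_add[of F a "- b"] by (simp add: fext_uminus)

lemma fext_sum: "fext s F (sum G A) = (\<Sum>i\<in>A. fext s F (G i))"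
  by (induction A rule: infinite_finite_induct) (auto simp: fext_0 fext_add)

lemma fext_cong: "a = b \<Longrightarrow> (\<And>x. x \<in> Poly_Mapping.keys b \<Longrightarrow> F x = G x) \<Longrightarrow> fext s F a = fext s G b"
  by (simp add: fext_def)

lemma fext_add_fun: "fext s (\<lambda>x. F x + G x) a = fext s F a + fext s G a"
  by (simp add: fext_def scale_right_distrib sum.distrib)

lemma fext_scale_fun: "fext s (\<lambda>x. s c (F x)) a = s c (fext s F a)"
  by (simp add: fext_def scale_sum_right mult.commute)

lemma fext_zero_fun: "fext s (\<lambda>x. 0) a = 0"
  by (simp add: fext_def)

lemma fext_comp: "fext s F (fext fscale G a) = fext s (\<lambda>x. fext s F (G x)) a"
  by (simp add: fext_def[of fscale] fext_sum fext_fscale) (simp add: fext_def)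

end

abbreviation lx :: "('a \<Rightarrow> ('b \<Rightarrow>\<^sub>0 'k)) \<Rightarrow> ('a \<Rightarrow>\<^sub>0 'k) \<Rightarrow> ('b \<Rightarrow>\<^sub>0 'k::field)" where
  "lx \<equiv> fext fscale"
abbreviation sg :: "'a \<Rightarrow> 'k::field \<Rightarrow> ('a \<Rightarrow>\<^sub>0 'k)" where
  "sg \<equiv> Poly_Mapping.single"

lemmas lx_simps = fext_0[OF vs_fscale] fext_single[OF vs_fscale] fext_add[OF vs_fscale]
  fext_fscale[OF vs_fscale] fext_uminus[OF vs_fscale] fext_diff[OF vs_fscale] fext_sum[OF vs_fscale]
lemmas lx_cong = fext_cong[OF vs_fscale]
lemmas lx_fun = fext_add_fun[OF vs_fscale] fext_scale_fun[OF vs_fscale] fext_zero_fun[OF vs_fscale]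
lemmas lx_comp = fext_comp[OF vs_fscale]

lemma lx_id: "lx (\<lambda>x. sg x 1) a = a"
proof (rule poly_mapping_eqI)
  fix k show "Poly_Mapping.lookup (lx (\<lambda>x. sg x 1) a) k = Poly_Mapping.lookup a k"
    by (simp add: fext_def lookup_sum lookup_single when_def sum.delta in_keys_iff)
qed

lemma keys_lx: "Poly_Mapping.keys (lx F a) \<subseteq> (\<Union>x\<in>Poly_Mapping.keys a. Poly_Mapping.keys (F x))"
proof
  fix y assume "y \<in> Poly_Mapping.keys (lx F a)"
  then have "(\<Sum>x\<in>Poly_Mapping.keys a. Poly_Mapping.lookup (fscale (Poly_Mapping.lookup a x) (F x)) y) \<noteq> 0"
    by (simp add: fext_def in_keys_iff lookup_sum)
  then obtain x where "x \<in> Poly_Mapping.keys a" "Poly_Mapping.lookup (fscale (Poly_Mapping.lookup a x) (F x)) y \<noteq> 0"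
    by (meson sum.not_neutral_contains_not_neutral)
  then show "y \<in> (\<Union>x\<in>Poly_Mapping.keys a. Poly_Mapping.keys (F x))"
    by (auto simp: lookup_fscale in_keys_iff)
qed

lemma psgn_mult_add: "psgn (m + n) = (psgn m * psgn n :: 'k::field)"
  by (auto simp: psgn_def)

lemma psgn_sq [simp]: "psgn m * psgn m = (1 :: 'k::field)" "psgn m * (psgn m * x) = (x :: 'k)"
  by (auto simp: psgn_def)

lemma psgn_0 [simp]: "psgn 0 = 1" by (simp add: psgn_def)

definition dw :: "('a \<Rightarrow> int) \<Rightarrow> 'a list \<Rightarrow> int" where "dw d w = sum_list (map d w)"

lemma dw_simps [simp]: "dw d [] = 0" "dw d (x # w) = d x + dw d w" "dw d (u @ w) = dw d u + dw d w"
  by (auto simp: dw_def)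

primrec unshr :: "('a \<Rightarrow> int) \<Rightarrow> 'a list \<Rightarrow> ('a list \<times> 'a list \<Rightarrow>\<^sub>0 'k::field)" where
  "unshr d [] = sg ([], []) 1"
| "unshr d (v # w) = lx (\<lambda>(a, b). sg (a, b @ [v]) 1 + sg (a @ [v], b) (psgn (d v * dw d b))) (unshr d w)"

definition unsh where "unsh d w = unshr d (rev w)"

lemma unsh_simps:
  "unsh d [] = sg ([], []) 1"
  "unsh d (w @ [v]) = lx (\<lambda>(a, b). sg (a, b @ [v]) 1 + sg (a @ [v], b) (psgn (d v * dw d b))) (unsh d w)"
  by (auto simp: unsh_def)

lemma keys_unsh: "x \<in> Poly_Mapping.keys (unsh d w :: _ \<Rightarrow>\<^sub>0 'k::field) \<Longrightarrow> mset (fst x) + mset (snd x) = mset w"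
proof (induction w arbitrary: x rule: rev_induct)
  case Nil then show ?case by (simp add: unsh_simps)
next
  case (snoc v w)
  from snoc.prems obtain y where y: "y \<in> Poly_Mapping.keys (unsh d w :: _ \<Rightarrow>\<^sub>0 'k)"
    "x \<in> Poly_Mapping.keys ((\<lambda>(a, b). sg (a, b @ [v]) (1::'k) + sg (a @ [v], b) (psgn (d v * dw d b))) y)"
    unfolding unsh_simps using keys_lx by (metis (no_types, lifting) UN_E subsetD)
  then have "x = (fst y, snd y @ [v]) \<or> x = (fst y @ [v], snd y)"
    using Poly_Mapping.keys_add by (auto split: prod.splits if_splits dest!: subsetD[OF Poly_Mapping.keys_add])
  with snoc.IH[OF y(1)] show ?case by auto
qed

lemma dw_mset: "mset u = mset w \<Longrightarrow> dw d u = dw d w"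
  unfolding dw_def by (metis mset_map sum_mset_sum_list)

lemma keys_unsh_dw:
  assumes "(a, b) \<in> Poly_Mapping.keys (unsh d w :: _ \<Rightarrow>\<^sub>0 'k::field)"
  shows "dw d a + dw d b = dw d w"
  using keys_unsh[OF assms] dw_mset[of "a @ b" w d] by simp

lemma lx_case: "lx (\<lambda>x. case x of (a, b) \<Rightarrow> F a b) = lx (\<lambda>(a, b). F a b)" ..

lemma unsh_ext_snoc:
  "lx (\<lambda>(a, b). F a b) (unsh d (w @ [v]))
   = lx (\<lambda>(a, b). F a (b @ [v]) + fscale (psgn (d v * dw d b)) (F (a @ [v]) b)) (unsh d w)"
  by (simp add: unsh_simps lx_comp lx_simps split_def)

lemma unsh_coassoc:
  "lx (\<lambda>(a, b). lx (\<lambda>(a1, a2). F a1 a2 b) (unsh d a)) (unsh d w)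
   = lx (\<lambda>(a, b). lx (\<lambda>(b1, b2). F a b1 b2) (unsh d b)) (unsh d w)"
proof (induction w arbitrary: F rule: rev_induct)
  case Nil then show ?case by (simp add: unsh_simps lx_simps)
next
  case (snoc v w)
  define G where "G a b c = F a b (c @ [v]) + fscale (psgn (d v * dw d c)) (F a (b @ [v]) c)
    + fscale (psgn (d v * (dw d b + dw d c))) (F (a @ [v]) b c)" for a b c
  have "lx (\<lambda>(a, b). lx (\<lambda>(a1, a2). F a1 a2 b) (unsh d a)) (unsh d (w @ [v]))
     = lx (\<lambda>(a, b). lx (\<lambda>(a1, a2). G a1 a2 b) (unsh d a)) (unsh d w)"
    unfolding unsh_ext_snoc
    by (simp add: G_def lx_fun split_def fscale_add psgn_mult_add distrib_left)
       (simp add: mult.commute flip: lx_fun(2))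
  also have "\<dots> = lx (\<lambda>(a, b). lx (\<lambda>(b1, b2). G a b1 b2) (unsh d b)) (unsh d w)"
    by (rule snoc.IH)
  also have "\<dots> = lx (\<lambda>(a, b). lx (\<lambda>(b1, b2). F a b1 b2) (unsh d b)) (unsh d (w @ [v]))"
    unfolding unsh_ext_snoc
  proof (intro lx_cong refl, clarsimp, goal_cases)
    case (1 a b)
    have "lx (\<lambda>(x, y). G a x y) (unsh d b) =
      lx (\<lambda>(x, y). F a x (y @ [v]) + fscale (psgn (d v * dw d y)) (F a (x @ [v]) y) +
         fscale (psgn (d v * dw d b)) (F (a @ [v]) x y)) (unsh d b)"
      by (intro lx_cong refl) (auto simp: G_def dest!: keys_unsh_dw)
    then show ?case by (simp add: split_def lx_fun)
  qed
  finally show ?case .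
qed

lemma unsh_cocomm:
  "lx (\<lambda>(a, b). F a b) (unsh d w) = lx (\<lambda>(a, b). fscale (psgn (dw d a * dw d b)) (F b a)) (unsh d w)"
proof (induction w arbitrary: F rule: rev_induct)
  case Nil then show ?case by (simp add: unsh_simps lx_simps)
next
  case (snoc v w)
  show ?case
    unfolding unsh_ext_snoc
    by (subst snoc.IH, rule lx_cong)
       (auto simp: fscale_add psgn_mult_add algebra_simps)
qed

primrec Dr :: "('a \<Rightarrow> int) \<Rightarrow> ('a list \<Rightarrow> 'a) \<Rightarrow> 'a list \<Rightarrow> ('a list \<Rightarrow>\<^sub>0 'k::field)" where
  "Dr d \<beta> [] = 0"
| "Dr d \<beta> (v # w) = lx (\<lambda>u. sg (u @ [v]) 1) (Dr d \<beta> w)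
     + lx (\<lambda>(a, b). sg (a @ [\<beta> (b @ [v])]) (psgn (dw d a))) (unshr d w)"

definition "Dg d \<beta> w = Dr d \<beta> (rev w)"

lemma Dg_simps:
  "Dg d \<beta> [] = 0"
  "Dg d \<beta> (w @ [v]) = lx (\<lambda>u. sg (u @ [v]) 1) (Dg d \<beta> w)
     + lx (\<lambda>(a, b). sg (a @ [\<beta> (b @ [v])]) (psgn (dw d a))) (unsh d w)"
  by (auto simp: Dg_def unsh_def)

definition Tg where
  "Tg d D a b = lx (\<lambda>a'. sg (a', b) 1) (D a) + fscale (psgn (dw d a)) (lx (\<lambda>b'. sg (a, b') 1) (D b))"

definition Dp where
  "Dp d u = lx (\<lambda>(a, b). sg (a, b @ [last u]) 1) (unsh d (butlast u))"

definition delta where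
  "delta d u = (if u = [] then 0 else lx (\<lambda>(a, b). if a = [] then 0 else sg (a, b @ [last u]) 1) (unsh d (butlast u)))"

definition tau where "tau d a b = sg (b, a) (psgn (dw d a * dw d b))"

lemma unsh_Dp: "unsh d (w @ [v]) = Dp d (w @ [v]) + lx (\<lambda>(a, b). tau d a b) (Dp d (w @ [v]))"
proof -
  have "unsh d (w @ [v]) = lx (\<lambda>(a, b). sg (a, b @ [v]) 1) (unsh d w)
      + lx (\<lambda>(a, b). sg (a @ [v], b) (psgn (d v * dw d b))) (unsh d w)"
    by (simp add: unsh_simps split_def lx_fun)
  also have "lx (\<lambda>(a, b). sg (a @ [v], b) (psgn (d v * dw d b))) (unsh d w)
    = lx (\<lambda>(a, b). fscale (psgn (dw d a * dw d b)) (sg (b @ [v], a) (psgn (d v * dw d a)))) (unsh d w)"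
    by (rule unsh_cocomm)
  also have "\<dots> = lx (\<lambda>(a, b). tau d a b) (Dp d (w @ [v]))"
    by (simp add: Dp_def lx_comp lx_simps split_def tau_def psgn_mult_add distrib_left mult.commute)
  finally show ?thesis by (simp add: Dp_def)
qed

lemma unsh_nil: "lx (\<lambda>(a, b). if a = [] then F b else 0) (unsh d w) = F w"
proof (induction w arbitrary: F rule: rev_induct)
  case (snoc v w)
  show ?case
    using snoc.IH[of "\<lambda>b. F (b @ [v])"] by (simp add: unsh_ext_snoc)
qed (simp add: unsh_simps lx_simps)

context
  fixes d :: "'a \<Rightarrow> int" and \<beta> :: "'a list \<Rightarrow> 'a"
  assumes beta: "\<And>w. w \<noteq> [] \<Longrightarrow> d (\<beta> w) = dw d w - 1"
begin

lemma keys_Dg_inv: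
  assumes P: "\<And>w. w \<noteq> [] \<Longrightarrow> \<forall>x\<in>set w. P x \<Longrightarrow> P (\<beta> w)"
  shows "u \<in> Poly_Mapping.keys (Dg d \<beta> w :: _ \<Rightarrow>\<^sub>0 'k::field) \<Longrightarrow> \<forall>x\<in>set w. P x \<Longrightarrow>
    u \<noteq> [] \<and> dw d u = dw d w - 1 \<and> (\<forall>x\<in>set u. P x)"
proof (induction w arbitrary: u rule: rev_induct)
  case Nil then show ?case by (simp add: Dg_simps)
next
  case (snoc v w)
  let ?A = "lx (\<lambda>u. sg (u @ [v]) (1::'k)) (Dg d \<beta> w)"
  let ?B = "lx (\<lambda>(a, b). sg (a @ [\<beta> (b @ [v])]) (psgn (dw d a) :: 'k)) (unsh d w)"
  have "u \<in> Poly_Mapping.keys ?A \<or> u \<in> Poly_Mapping.keys ?B"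
    using snoc.prems Poly_Mapping.keys_add[of ?A ?B] by (auto simp: Dg_simps)
  then show ?case
  proof
    assume "u \<in> Poly_Mapping.keys ?A"
    with keys_lx[of "\<lambda>u. sg (u @ [v]) (1::'k)"] obtain y
      where "y \<in> Poly_Mapping.keys (Dg d \<beta> w :: _ \<Rightarrow>\<^sub>0 'k)" "u = y @ [v]" by fastforce
    then show ?thesis using snoc by simp
  next
    assume "u \<in> Poly_Mapping.keys ?B"
    with keys_lx[of "\<lambda>(a, b). sg (a @ [\<beta> (b @ [v])]) (psgn (dw d a) :: 'k)"] obtain a b
      where ab: "(a, b) \<in> Poly_Mapping.keys (unsh d w :: _ \<Rightarrow>\<^sub>0 'k)" "u = a @ [\<beta> (b @ [v])]"
      by (fastforce split: if_splits)
    have "set a \<union> set b = set w"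
      using keys_unsh[OF ab(1)] by (metis fst_conv mset_append set_append set_mset_mset snd_conv)
    then have "P (\<beta> (b @ [v]))" "\<forall>x\<in>set a. P x"
      using snoc.prems by (auto intro!: P)
    then show ?thesis using ab keys_unsh_dw[OF ab(1)] beta[of "b @ [v]"] by auto
  qed
qed

lemmas keys_Dg = keys_Dg_inv[of "\<lambda>_. True", simplified]

abbreviation "T \<equiv> Tg d (Dg d \<beta>)"

lemma Dp_T:
  fixes w :: "'a list"
  assumes "lx (unsh d) (Dg d \<beta> w :: _ \<Rightarrow>\<^sub>0 'k::field) = lx (\<lambda>(a, b). T a b) (unsh d w)"
  shows "lx (Dp d) (Dg d \<beta> (w @ [v]) :: _ \<Rightarrow>\<^sub>0 'k) = lx (\<lambda>(a, b). T a b) (Dp d (w @ [v]))"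
proof -
  define F where "F a1 a2 b = sg (a1, a2 @ [\<beta> (b @ [v])]) (psgn (dw d a1) * psgn (dw d a2) :: 'k)" for a1 a2 b
  have "lx (Dp d) (Dg d \<beta> (w @ [v])) = lx (\<lambda>(a, b). sg (a, b @ [v]) 1) (lx (unsh d) (Dg d \<beta> w))
      + lx (\<lambda>(a, b). fscale (psgn (dw d a)) (lx (\<lambda>(a1, a2). sg (a1, a2 @ [\<beta> (b @ [v])]) 1) (unsh d a))) (unsh d w)"
    by (simp add: Dg_simps Dp_def lx_simps lx_comp split_def)
  also have "lx (\<lambda>(a, b). fscale (psgn (dw d a)) (lx (\<lambda>(a1, a2). sg (a1, a2 @ [\<beta> (b @ [v])]) 1) (unsh d a))) (unsh d w)
      = lx (\<lambda>(a, b). lx (\<lambda>(a1, a2). F a1 a2 b) (unsh d a)) (unsh d w)"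
    by (intro lx_cong refl, clarsimp simp flip: lx_fun(2), intro lx_cong refl)
       (auto simp: F_def psgn_mult_add dest!: keys_unsh_dw simp flip: psgn_mult_add)
  also have "\<dots> = lx (\<lambda>(a, b). lx (\<lambda>(b1, b2). F a b1 b2) (unsh d b)) (unsh d w)"
    by (rule unsh_coassoc)
  also have "lx (\<lambda>(a, b). sg (a, b @ [v]) 1) (lx (unsh d) (Dg d \<beta> w)) + \<dots> = lx (\<lambda>(a, b). T a b) (Dp d (w @ [v]))"
    unfolding assms
    by (simp add: Dp_def lx_simps lx_comp split_def Tg_def Dg_simps F_def fscale_add flip: lx_fun(1))
       (simp add: lx_fun[symmetric] algebra_simps)
  finally show ?thesis .
qed

lemma tau_T: "lx (\<lambda>(a, b). tau d a b) (T a b :: _ \<Rightarrow>\<^sub>0 'k::field) = fscale (psgn (dw d a * dw d b)) (T b a)"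
proof -
  have "lx (\<lambda>a'. tau d a' b) (Dg d \<beta> a :: _ \<Rightarrow>\<^sub>0 'k) = lx (\<lambda>a'. sg (b, a') (psgn (dw d a * dw d b) * psgn (dw d b))) (Dg d \<beta> a :: _ \<Rightarrow>\<^sub>0 'k)"
    by (intro lx_cong refl) (auto dest!: keys_Dg simp: tau_def left_diff_distrib psgn_def)
  moreover have "lx (\<lambda>b'. fscale (psgn (dw d a)) (tau d a b')) (Dg d \<beta> b :: _ \<Rightarrow>\<^sub>0 'k) = lx (\<lambda>b'. sg (b', a) (psgn (dw d a * dw d b))) (Dg d \<beta> b :: _ \<Rightarrow>\<^sub>0 'k)"
    by (intro lx_cong refl) (auto dest!: keys_Dg simp: tau_def right_diff_distrib psgn_def)
  ultimately show ?thesis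
    by (simp add: Tg_def lx_simps lx_comp fscale_add algebra_simps flip: lx_fun(2))
qed

lemma unsh_T: "lx (unsh d) (Dg d \<beta> w :: _ \<Rightarrow>\<^sub>0 'k::field) = lx (\<lambda>(a, b). T a b) (unsh d w)"
proof (induction w rule: rev_induct)
  case Nil
  show ?case by (simp add: Dg_simps Tg_def unsh_simps lx_simps)
next
  case (snoc v w)
  have "lx (unsh d) (Dg d \<beta> (w @ [v]) :: _ \<Rightarrow>\<^sub>0 'k) = lx (\<lambda>u. Dp d u + lx (\<lambda>(a, b). tau d a b) (Dp d u)) (Dg d \<beta> (w @ [v]) :: _ \<Rightarrow>\<^sub>0 'k)"
    by (intro lx_cong refl) (metis append_butlast_last_id keys_Dg unsh_Dp)
  also have "\<dots> = lx (\<lambda>(a, b). T a b) (Dp d (w @ [v])) + lx (\<lambda>(a, b). tau d a b) (lx (\<lambda>(a, b). T a b) (Dp d (w @ [v])))"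
    by (simp add: lx_fun lx_comp[symmetric] Dp_T[OF snoc.IH])
  also have "lx (\<lambda>(a, b). tau d a b) (lx (\<lambda>(a, b). T a b) (Dp d (w @ [v])))
     = lx (\<lambda>(a, b). T a b) (lx (\<lambda>(a, b). tau d a b) (Dp d (w @ [v])))"
    by (simp add: lx_comp split_def tau_T[unfolded split_def]) (simp add: tau_def lx_simps)
  finally show ?case by (simp add: unsh_Dp lx_simps)
qed

lemma delta_T: "lx (delta d) (Dg d \<beta> w :: _ \<Rightarrow>\<^sub>0 'k::field) = lx (\<lambda>(a, b). T a b) (delta d w)"
proof (cases "w = []")
  case True
  then show ?thesis by (simp add: Dg_simps delta_def lx_simps)
next
  case False
  have *: "delta d u = Dp d u - sg ([], u) (1 :: 'k)" if "u \<noteq> []" for u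
  proof -
    have "Dp d u = lx (\<lambda>(a, b). (if a = [] then 0 else sg (a, b @ [last u]) (1 :: 'k))
        + (if a = [] then sg ([], b @ [last u]) 1 else 0)) (unsh d (butlast u))"
      unfolding Dp_def by (intro lx_cong refl) auto
    also have "\<dots> = delta d u + sg ([], u) 1"
      using that unsh_nil[of "\<lambda>b. sg ([], b @ [last u]) 1" d "butlast u"]
      by (simp add: delta_def split_def lx_fun)
    finally show ?thesis by simp
  qed
  have "lx (delta d) (Dg d \<beta> w :: _ \<Rightarrow>\<^sub>0 'k) = lx (\<lambda>u. Dp d u + fscale (- 1) (sg ([], u) 1)) (Dg d \<beta> w :: _ \<Rightarrow>\<^sub>0 'k)"
    by (intro lx_cong refl) (auto dest!: keys_Dg simp: * single_uminus)
  also have "\<dots> = lx (Dp d) (Dg d \<beta> w :: _ \<Rightarrow>\<^sub>0 'k) + fscale (- 1) (lx (\<lambda>u. sg ([], u) 1) (Dg d \<beta> w :: _ \<Rightarrow>\<^sub>0 'k))"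
    by (simp only: lx_fun)
  also have "lx (Dp d) (Dg d \<beta> w :: _ \<Rightarrow>\<^sub>0 'k) = lx (\<lambda>(a, b). T a b) (Dp d w)"
    using Dp_T[OF unsh_T, of "butlast w" "last w"] False by simp
  finally show ?thesis
    using False by (simp add: * lx_simps Tg_def Dg_simps)
qed

end

definition sgnA :: "('a \<Rightarrow> int) \<Rightarrow> 'a list \<Rightarrow> nat set \<Rightarrow> 'k::field" where
  "sgnA d w A = (\<Prod>(i, j)\<in>{(i, j). i \<in> A \<and> j < length w \<and> j \<notin> A \<and> j < i}. psgn (d (w ! i) * d (w ! j)))"

lemma nths_filter: "nths w A = map ((!) w) (filter (\<lambda>i. i \<in> A) [0..<length w])"
proof (induction w rule: rev_induct)
  case (snoc v w)
  have "map ((!) (w @ [v])) (filter (\<lambda>i. i \<in> A) [0..<length w]) = map ((!) w) (filter (\<lambda>i. i \<in> A) [0..<length w])"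
    by (intro map_cong) (auto simp: nth_append)
  then show ?case using snoc by (simp add: nths_append)
qed simp

lemma dw_nths: "dw d (nths w A) = (\<Sum>i | i < length w \<and> i \<in> A. d (w ! i))"
proof -
  have "dw d (nths w A) = (\<Sum>i\<leftarrow>filter (\<lambda>i. i \<in> A) [0..<length w]. d (w ! i))"
    by (simp add: nths_filter dw_def comp_def)
  also have "\<dots> = (\<Sum>i\<in>set (filter (\<lambda>i. i \<in> A) [0..<length w]). d (w ! i))"
    by (subst sum_list_distinct_conv_sum_set) auto
  finally show ?thesis by (simp add: conj_commute)
qed

lemma psgn_sum: "finite S \<Longrightarrow> (psgn (\<Sum>i\<in>S. f i) :: 'k::field) = (\<Prod>i\<in>S. psgn (f i))"
  by (induction S rule: finite_induct) (auto simp: psgn_mult_add)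

lemma sgnA_snoc:
  assumes "A \<subseteq> {..<length w}"
  shows "sgnA d (w @ [v]) A = (sgnA d w A :: 'k::field)"
    and "sgnA d (w @ [v]) (insert (length w) A) = (psgn (d v * dw d (nths w (- A))) * sgnA d w A :: 'k)"
proof -
  have fin: "finite {(i, j). i \<in> A \<and> j < length w \<and> j \<notin> A \<and> j < i}"
    by (rule finite_subset[of _ "A \<times> {..<length w}"]) (use assms finite_subset in auto)
  have "{(i, j). i \<in> A \<and> j < length (w @ [v]) \<and> j \<notin> A \<and> j < i} = {(i, j). i \<in> A \<and> j < length w \<and> j \<notin> A \<and> j < i}"
    using assms by fastforce
  then show "sgnA d (w @ [v]) A = (sgnA d w A :: 'k)"
    unfolding sgnA_def using assms by (intro prod.cong) (auto simp: nth_append)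
  let ?N = "{j. j < length w \<and> j \<in> - A}"
  have eq: "{(i, j). i \<in> insert (length w) A \<and> j < length (w @ [v]) \<and> j \<notin> insert (length w) A \<and> j < i}
     = Pair (length w) ` ?N \<union> {(i, j). i \<in> A \<and> j < length w \<and> j \<notin> A \<and> j < i}"
    using assms by auto
  have "sgnA d (w @ [v]) (insert (length w) A)
     = (\<Prod>(i, j)\<in>Pair (length w) ` ?N. psgn (d ((w @ [v]) ! i) * d ((w @ [v]) ! j)))
       * (\<Prod>(i, j)\<in>{(i, j). i \<in> A \<and> j < length w \<and> j \<notin> A \<and> j < i}. psgn (d ((w @ [v]) ! i) * d ((w @ [v]) ! j)))"
    unfolding sgnA_def eq using assms fin by (intro prod.union_disjoint) auto
  also have "(\<Prod>(i, j)\<in>Pair (length w) ` ?N. psgn (d ((w @ [v]) ! i) * d ((w @ [v]) ! j))) = (psgn (d v * dw d (nths w (- A))) :: 'k)"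
    by (subst prod.reindex) (auto simp: inj_on_def dw_nths sum_distrib_left psgn_sum nth_append intro!: prod.cong)
  also have "(\<Prod>(i, j)\<in>{(i, j). i \<in> A \<and> j < length w \<and> j \<notin> A \<and> j < i}. psgn (d ((w @ [v]) ! i) * d ((w @ [v]) ! j))) = sgnA d w A"
    unfolding sgnA_def using assms by (intro prod.cong) (auto simp: nth_append)
  finally show "sgnA d (w @ [v]) (insert (length w) A) = (psgn (d v * dw d (nths w (- A))) * sgnA d w A :: 'k)" .
qed

lemma unsh_subsets:
  "unsh d w = (\<Sum>A\<in>Pow {..<length w}. sg (nths w A, nths w (- A)) (sgnA d w A :: 'k::field))"
proof (induction w rule: rev_induct)
  case Nil
  then show ?case by (simp add: unsh_simps sgnA_def)
next
  case (snoc v w)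
  let ?n = "length w"
  let ?g = "\<lambda>A. sg (nths (w @ [v]) A, nths (w @ [v]) (- A)) (sgnA d (w @ [v]) A :: 'k)"
  have "Pow {..<length (w @ [v])} = Pow {..<?n} \<union> insert ?n ` Pow {..<?n}"
    using Pow_insert[of ?n "{..<?n}"] by (simp add: lessThan_Suc)
  then have "sum ?g (Pow {..<length (w @ [v])}) = sum ?g (Pow {..<?n}) + sum ?g (insert ?n ` Pow {..<?n})"
    by (simp only:) (rule sum.union_disjoint, auto)
  also have "sum ?g (insert ?n ` Pow {..<?n}) = sum (?g \<circ> insert ?n) (Pow {..<?n})"
    by (rule sum.reindex) (intro inj_onI, metis PowD insert_ident lessThan_iff less_irrefl subsetD)
  also have "sum ?g (Pow {..<?n}) + sum (?g \<circ> insert ?n) (Pow {..<?n}) = unsh d (w @ [v])"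
    unfolding unsh_simps snoc.IH lx_simps sum.distrib[symmetric]
  proof (intro sum.cong refl)
    fix A assume "A \<in> Pow {..<?n}"
    then have A: "A \<subseteq> {..<?n}" by simp
    have n: "nths w (insert ?n A) = nths w A" "nths w (- insert ?n A) = nths w (- A)"
      by (auto simp: nths_filter intro!: arg_cong[where f = "map ((!) w)"] filter_cong)
    have [simp]: "?n \<notin> A" using A by auto
    show "?g A + (?g \<circ> insert ?n) A = fscale (sgnA d w A) (case (nths w A, nths w (- A)) of
        (a, b) \<Rightarrow> sg (a, b @ [v]) 1 + sg (a @ [v], b) (psgn (d v * dw d b)))"
      using sgnA_snoc[OF A, of d v, where 'k = 'k] n by (simp add: nths_append fscale_add mult.commute del: Compl_insert)
  qed
  finally show ?case ..
qed

lemma sorted_list_eqI: "sorted_wrt (<) xs \<Longrightarrow> set xs = (A :: nat set) \<Longrightarrow> xs = sorted_list_of_set A"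
  by (metis sorted_list_of_set.idem_if_sorted_distinct strict_sorted_iff)

lemma nths_sorted: "A \<subseteq> {..<length w} \<Longrightarrow> nths w A = map ((!) w) (sorted_list_of_set A)"
  unfolding nths_filter by (intro arg_cong[where f = "map _"] sorted_list_eqI) (auto simp: sorted_wrt_filter)

lemma shuffle_lists:
  assumes "\<sigma> \<in> shuffle_perms k m"
  shows "map \<sigma> [0..<k] = sorted_list_of_set (\<sigma> ` {..<k})"
    and "map \<sigma> [k..<k + m] = sorted_list_of_set ({..<k + m} - \<sigma> ` {..<k})"
proof -
  from assms have s: "\<sigma> permutes {..<k + m}" and m: "strict_mono_on {..<k} \<sigma>" "strict_mono_on {k..<k + m} \<sigma>"
    by (auto simp: shuffle_perms_def)
  show "map \<sigma> [0..<k] = sorted_list_of_set (\<sigma> ` {..<k})"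
    by (rule sorted_list_eqI) (use m(1) in \<open>auto simp: sorted_wrt_iff_nth_less strict_mono_on_def atLeast0LessThan\<close>)
  have "{..<k + m} - \<sigma> ` {..<k} = \<sigma> ` ({..<k + m} - {..<k})"
    using permutes_image[OF s] image_set_diff[OF permutes_inj[OF s]] by metis
  also have "{..<k + m} - {..<k} = {k..<k + m}" by auto
  finally show "map \<sigma> [k..<k + m] = sorted_list_of_set ({..<k + m} - \<sigma> ` {..<k})"
    by (intro sorted_list_eqI) (use m(2) in \<open>auto simp: sorted_wrt_iff_nth_less strict_mono_on_def\<close>)
qed

lemma shuffle_bij:
  "bij_betw (\<lambda>\<sigma>. \<sigma> ` {..<k}) (shuffle_perms k m) {A \<in> Pow {..<k + m}. card A = k}"
proof (rule bij_betw_imageI)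
  show "inj_on (\<lambda>\<sigma>. \<sigma> ` {..<k}) (shuffle_perms k m)"
  proof (rule inj_onI)
    fix \<sigma> \<tau> assume st: "\<sigma> \<in> shuffle_perms k m" "\<tau> \<in> shuffle_perms k m" "\<sigma> ` {..<k} = \<tau> ` {..<k}"
    have "map \<sigma> [0..<k] = map \<tau> [0..<k]" "map \<sigma> [k..<k + m] = map \<tau> [k..<k + m]"
      using shuffle_lists[OF st(1)] shuffle_lists[OF st(2)] st(3) by auto
    moreover have "\<sigma> i = i" "\<tau> i = i" if "i \<ge> k + m" for i
      using st that by (auto simp: shuffle_perms_def permutes_def)
    ultimately show "\<sigma> = \<tau>" by (intro ext) (metis atLeastLessThan_iff le0 linorder_not_le map_eq_conv set_upt)
  qed
  show "(\<lambda>\<sigma>. \<sigma> ` {..<k}) ` shuffle_perms k m = {A \<in> Pow {..<k + m}. card A = k}"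
  proof (intro equalityI subsetI)
    fix A assume "A \<in> (\<lambda>\<sigma>. \<sigma> ` {..<k}) ` shuffle_perms k m"
    then obtain \<sigma> where s: "\<sigma> permutes {..<k + m}" "A = \<sigma> ` {..<k}" by (auto simp: shuffle_perms_def)
    then show "A \<in> {A \<in> Pow {..<k + m}. card A = k}"
      using permutes_in_image[OF s(1)] permutes_inj[OF s(1)]
      by (auto simp: card_image inj_on_def inj_def)
  next
    fix A assume "A \<in> {A \<in> Pow {..<k + m}. card A = k}"
    then have A: "A \<subseteq> {..<k + m}" "card A = k" "finite A" by (auto intro: finite_subset)
    let ?B = "{..<k + m} - A"
    define xs where "xs = sorted_list_of_set A @ sorted_list_of_set ?B"
    have B: "card ?B = m" using A by (simp add: card_Diff_subset)
    have xs: "distinct xs" "set xs = {..<k + m}" "length xs = k + m"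
      using A B by (auto simp: xs_def)
    define \<sigma> where "\<sigma> i = (if i < k + m then xs ! i else i)" for i
    have "bij_betw ((!) xs) {..<k + m} {..<k + m}"
      using bij_betw_nth[OF xs(1)] xs by metis
    then have "bij_betw \<sigma> {..<k + m} {..<k + m}"
      by (rule bij_betw_cong[THEN iffD1, rotated]) (auto simp: \<sigma>_def)
    then have p: "\<sigma> permutes {..<k + m}" by (rule bij_imp_permutes) (auto simp: \<sigma>_def)
    have s1: "\<sigma> i = sorted_list_of_set A ! i" if "i < k" for i
      using that A by (simp add: \<sigma>_def xs_def nth_append)
    have s2: "\<sigma> i = sorted_list_of_set ?B ! (i - k)" if "k \<le> i" "i < k + m" for i
      using that A by (simp add: \<sigma>_def xs_def nth_append)
    have "strict_mono_on {..<k} \<sigma>"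
      using strict_sorted_list_of_set[of A] A
      by (auto simp: strict_mono_on_def s1 sorted_wrt_iff_nth_less)
    moreover have "strict_mono_on {k..<k + m} \<sigma>"
      using strict_sorted_list_of_set[of ?B] B
      by (auto simp: strict_mono_on_def s2 sorted_wrt_iff_nth_less)
    ultimately have "\<sigma> \<in> shuffle_perms k m" using p by (simp add: shuffle_perms_def)
    moreover have "\<sigma> ` {..<k} = A"
    proof -
      have "\<sigma> ` {..<k} = set (sorted_list_of_set A)"
        using s1 A by (auto simp: set_conv_nth image_iff)
      then show ?thesis using A by simp
    qed
    ultimately show "A \<in> (\<lambda>\<sigma>. \<sigma> ` {..<k}) ` shuffle_perms k m" by blast
  qed
qed

lemma koszul_shuffle:
  assumes "\<sigma> \<in> shuffle_perms k m" "length w = k + m"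
  shows "koszul (k + m) (\<lambda>i. d (w ! i)) \<sigma> = (sgnA d w (\<sigma> ` {..<k}) :: 'k::field)"
proof -
  from assms have s: "\<sigma> permutes {..<k + m}" and m: "strict_mono_on {..<k} \<sigma>" "strict_mono_on {k..<k + m} \<sigma>"
    by (auto simp: shuffle_perms_def)
  note inj = permutes_inj[OF s, unfolded inj_def, rule_format]
  let ?P = "{(i, j). i < j \<and> j < k + m \<and> \<sigma> j < \<sigma> i}"
  let ?Q = "{(i, j). i \<in> \<sigma> ` {..<k} \<and> j < length w \<and> j \<notin> \<sigma> ` {..<k} \<and> j < i}"
  have blk: "i < k \<and> k \<le> j" if "i < j" "j < k + m" "\<sigma> j < \<sigma> i" for i j
  proof (rule ccontr)
    assume "\<not> (i < k \<and> k \<le> j)"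
    then have "j < k \<or> k \<le> i" using that(1) by auto
    then have "\<sigma> i < \<sigma> j"
      using that(1,2) strict_mono_onD[OF m(1), of i j] strict_mono_onD[OF m(2), of i j] by auto
    then show False using that(3) by simp
  qed
  have "bij_betw (map_prod \<sigma> \<sigma>) ?P ?Q"
  proof (rule bij_betw_imageI)
    show "inj_on (map_prod \<sigma> \<sigma>) ?P" using inj by (auto simp: inj_on_def)
    show "map_prod \<sigma> \<sigma> ` ?P = ?Q"
    proof (intro equalityI subsetI)
      fix x assume "x \<in> map_prod \<sigma> \<sigma> ` ?P"
      then show "x \<in> ?Q" using blk permutes_in_image[OF s] assms(2) inj by fastforce
    next
      fix x assume "x \<in> ?Q"
      then obtain i b where x: "x = (\<sigma> i, b)" "i < k" "b < k + m" "b \<notin> \<sigma> ` {..<k}" "b < \<sigma> i"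
        using assms(2) by auto
      obtain j where j: "j < k + m" "b = \<sigma> j"
        using permutes_image[OF s] x(3) by (metis imageE lessThan_iff)
      then have "k \<le> j" using x by (metis imageI lessThan_iff linorder_not_le)
      then show "x \<in> map_prod \<sigma> \<sigma> ` ?P" using x j by (auto intro!: image_eqI[of _ _ "(i, j)"])
    qed
  qed
  then show ?thesis
    unfolding koszul_def sgnA_def
    by (subst prod.reindex_bij_betw[symmetric]) (auto simp: split_def intro!: prod.cong)
qed

lemma shuffles_unsh:
  fixes w :: "'a list"
  defines "n \<equiv> length w"
  shows "(\<Sum>k\<in>{0..n}. \<Sum>\<sigma>\<in>shuffle_perms k (n - k).
     F k (map (\<lambda>i. w ! \<sigma> i) [0..<k]) (map (\<lambda>i. w ! \<sigma> i) [k..<n]) (koszul n (\<lambda>i. d (w ! i)) \<sigma> :: 'k::field))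
    = (\<Sum>A\<in>Pow {..<n}. F (card A) (nths w A) (nths w (- A)) (sgnA d w A))"
proof -
  have "(\<Sum>\<sigma>\<in>shuffle_perms k (n - k).
     F k (map (\<lambda>i. w ! \<sigma> i) [0..<k]) (map (\<lambda>i. w ! \<sigma> i) [k..<n]) (koszul n (\<lambda>i. d (w ! i)) \<sigma> :: 'k))
    = (\<Sum>A\<in>{A \<in> Pow {..<n}. card A = k}. F (card A) (nths w A) (nths w (- A)) (sgnA d w A))" (is "?L = ?R")
    if "k \<le> n" for k
  proof -
    have n: "n = k + (n - k)" using that by simp
    have b: "bij_betw (\<lambda>\<sigma>. \<sigma> ` {..<k}) (shuffle_perms k (n - k)) {A \<in> Pow {..<n}. card A = k}"
      using shuffle_bij[of k "n - k"] n by simp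
    show ?thesis
    proof (subst sum.reindex_bij_betw[OF b, symmetric], rule sum.cong[OF refl])
      fix \<sigma> assume s: "\<sigma> \<in> shuffle_perms k (n - k)"
      let ?A = "\<sigma> ` {..<k}"
      have "?A \<in> {A \<in> Pow {..<n}. card A = k}" using bij_betwE[OF b] s by blast
      then have A: "?A \<subseteq> {..<n}" "card ?A = k" by simp_all
      have N: "nths w (- ?A) = nths w ({..<n} - ?A)"
        by (auto simp: nths_filter n_def intro!: arg_cong[where f = "map ((!) w)"] filter_cong)
      have "nths w ?A = map (\<lambda>i. w ! \<sigma> i) [0..<k]"
        using shuffle_lists(1)[OF s] A by (simp add: nths_sorted n_def comp_def flip: shuffle_lists(1)[OF s])
      moreover have "nths w (- ?A) = map (\<lambda>i. w ! \<sigma> i) [k..<n]"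
        using shuffle_lists(2)[OF s] that unfolding N
        by (subst nths_sorted) (auto simp: n_def comp_def simp flip: map_map[unfolded comp_def])
      moreover have "koszul n (\<lambda>i. d (w ! i)) \<sigma> = (sgnA d w ?A :: 'k)"
        using koszul_shuffle[OF s, of w d] that by (simp add: n_def)
      ultimately show "F k (map (\<lambda>i. w ! \<sigma> i) [0..<k]) (map (\<lambda>i. w ! \<sigma> i) [k..<n]) (koszul n (\<lambda>i. d (w ! i)) \<sigma> :: 'k)
        = F (card ?A) (nths w ?A) (nths w (- ?A)) (sgnA d w ?A)" using A by simp
    qed
  qed
  then have "(\<Sum>k\<in>{0..n}. \<Sum>\<sigma>\<in>shuffle_perms k (n - k).
     F k (map (\<lambda>i. w ! \<sigma> i) [0..<k]) (map (\<lambda>i. w ! \<sigma> i) [k..<n]) (koszul n (\<lambda>i. d (w ! i)) \<sigma> :: 'k))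
    = (\<Sum>k\<in>{0..n}. \<Sum>A\<in>{A \<in> Pow {..<n}. card A = k}. F (card A) (nths w A) (nths w (- A)) (sgnA d w A))"
    by (intro sum.cong refl) auto
  also have "\<dots> = (\<Sum>A\<in>Pow {..<n}. F (card A) (nths w A) (nths w (- A)) (sgnA d w A))"
    by (rule sum.group) (auto dest: card_mono[rotated])
  finally show ?thesis .
qed

lemma zin_delta_eq: "zin_delta V w = (delta (\<lambda>v. ldeg V v + 1) w :: _ \<Rightarrow>\<^sub>0 'k::field)"
proof (cases w rule: rev_cases)
  case Nil
  then show ?thesis by (simp add: zin_delta_def delta_def)
next
  case (snoc u v)
  define n where "n = length u"
  define d where "d = (\<lambda>v. ldeg V v + 1)"
  define F where "F k a b c = (if k = 0 then 0 else sg (a, b @ [v]) c)" for k :: nat and a b :: "'a list" and c :: 'k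
  have "zin_delta V w = (\<Sum>k\<in>{1..<Suc n}. \<Sum>\<sigma>\<in>shuffle_perms k (n - k).
     F k (map (\<lambda>i. u ! \<sigma> i) [0..<k]) (map (\<lambda>i. u ! \<sigma> i) [k..<n]) (koszul n (\<lambda>i. d (u ! i)) \<sigma>))"
    unfolding zin_delta_def Let_def
  proof (intro sum.cong, goal_cases)
    case (3 k \<sigma>)
    then have k: "0 < k" "k \<le> n" and s: "\<sigma> \<in> shuffle_perms k (n - k)"
      by (auto simp: snoc n_def)
    then have p: "\<sigma> permutes {..<n}" by (auto simp: shuffle_perms_def)
    have lt: "\<sigma> i < n" if "i < n" for i using permutes_in_image[OF p] that by simp
    have eq: "\<sigma> n = n" using p by (auto simp: permutes_def)
    let ?l = "map (\<lambda>i. w ! \<sigma> i) [0..<length w]"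
    have l: "?l = map (\<lambda>i. u ! \<sigma> i) [0..<n] @ [v]"
      using lt eq by (auto simp: snoc n_def nth_append)
    have t: "take k ?l = map (\<lambda>i. u ! \<sigma> i) [0..<k]" "drop k ?l = map (\<lambda>i. u ! \<sigma> i) [k..<n] @ [v]"
      unfolding l using k by (auto simp: take_map drop_map)
    have P: "{(i, j). i < j \<and> j < length w \<and> \<sigma> j < \<sigma> i} = {(i, j). i < j \<and> j < n \<and> \<sigma> j < \<sigma> i}"
      using lt eq by (auto simp: snoc n_def less_Suc_eq) (metis less_asym lt n_def)
    have "koszul (length w) (\<lambda>i. ldeg V (w ! i) + 1) \<sigma> = (koszul n (\<lambda>i. d (u ! i)) \<sigma> :: 'k)"
      unfolding koszul_def P using lt by (intro prod.cong) (auto simp: snoc d_def nth_append n_def)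
    then show ?case unfolding t F_def using k by simp
  qed (auto simp: snoc n_def)
  also have "\<dots> = (\<Sum>k\<in>{0..n}. \<Sum>\<sigma>\<in>shuffle_perms k (n - k).
     F k (map (\<lambda>i. u ! \<sigma> i) [0..<k]) (map (\<lambda>i. u ! \<sigma> i) [k..<n]) (koszul n (\<lambda>i. d (u ! i)) \<sigma>))"
    by (intro sum.mono_neutral_left) (auto simp: F_def)
  also have "\<dots> = (\<Sum>A\<in>Pow {..<n}. F (card A) (nths u A) (nths u (- A)) (sgnA d u A))"
    unfolding n_def by (rule shuffles_unsh)
  also have "\<dots> = (\<Sum>A\<in>Pow {..<n}. fscale (sgnA d u A) (if nths u A = [] then 0 else sg (nths u A, nths u (- A) @ [v]) 1))"
  proof (intro sum.cong refl)
    fix A assume "A \<in> Pow {..<n}"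
    then have "A \<subseteq> {..<length u}" "finite A" using finite_subset[of A "{..<length u}"] by (auto simp: n_def)
    then have "card A = 0 \<longleftrightarrow> nths u A = []"
      by (auto simp: nths_filter filter_empty_conv)
    then show "F (card A) (nths u A) (nths u (- A)) (sgnA d u A)
      = fscale (sgnA d u A) (if nths u A = [] then 0 else sg (nths u A, nths u (- A) @ [v]) 1)"
      by (simp add: F_def)
  qed
  also have "\<dots> = delta d w"
    by (simp add: delta_def snoc unsh_subsets lx_simps n_def cong: if_cong)
  finally show ?thesis unfolding d_def .
qed

lemma unsh_map:
  "\<forall>x\<in>set w. d' (h x) = d x \<Longrightarrow>
   (unsh d' (map h w) :: _ \<Rightarrow>\<^sub>0 'k::field) = lx (\<lambda>(a, b). sg (map h a, map h b) 1) (unsh d w)"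
proof (induction w rule: rev_induct)
  case Nil then show ?case by (simp add: unsh_simps lx_simps)
next
  case (snoc v w)
  have "(unsh d' (map h (w @ [v])) :: _ \<Rightarrow>\<^sub>0 'k) = lx (\<lambda>(a, b). sg (map h a, map h b @ [h v]) 1
      + sg (map h a @ [h v], map h b) (psgn (d v * dw d' (map h b)))) (unsh d w)"
    using snoc by (simp add: unsh_simps lx_simps lx_comp split_def)
  also have "\<dots> = lx (\<lambda>(a, b). sg (map h a, map h b @ [h v]) 1
      + sg (map h a @ [h v], map h b) (psgn (d v * dw d b))) (unsh d w)"
  proof (intro lx_cong refl, goal_cases)
    case (1 x)
    obtain a b where x: "x = (a, b)" by (cases x)
    from 1 x have "set b \<subseteq> set w"
      using keys_unsh[of "(a, b)" d w] by (metis UnI2 mset_append set_append set_mset_mset snd_conv subsetI)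
    then have "dw d' (map h b) = dw d b"
      unfolding dw_def map_map using snoc.prems by (intro arg_cong[where f = sum_list] map_cong) auto
    then show ?case by (simp add: x)
  qed
  finally show ?case by (simp add: unsh_simps lx_simps lx_comp split_def)
qed

lemma keys_unsh_set:
  "(a, b) \<in> Poly_Mapping.keys (unsh d w :: _ \<Rightarrow>\<^sub>0 'k::field) \<Longrightarrow> set a \<union> set b = set w"
  using keys_unsh[of "(a, b)" d w] by (metis fst_conv mset_append set_append set_mset_mset snd_conv)

lemma delta_map:
  assumes "\<forall>x\<in>set w. d' (h x) = d x"
  shows "(delta d' (map h w) :: _ \<Rightarrow>\<^sub>0 'k::field) = lx (\<lambda>(a, b). sg (map h a, map h b) 1) (delta d w)"
proof (cases w rule: rev_cases)
  case (snoc u v)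
  then show ?thesis using assms
    by (simp add: delta_def unsh_map[of u d' h d] lx_simps lx_comp split_def if_distrib[of "lx _"] cong: if_cong)
qed (simp add: delta_def lx_simps)

lemma keys_delta_set:
  assumes "(a, b) \<in> Poly_Mapping.keys (delta d w :: _ \<Rightarrow>\<^sub>0 'k::field)"
  shows "set a \<union> set b = set w" "a \<noteq> []" "b \<noteq> []"
proof -
  have w: "w \<noteq> []" using assms by (auto simp: delta_def)
  with assms obtain x where "x \<in> Poly_Mapping.keys (unsh d (butlast w) :: _ \<Rightarrow>\<^sub>0 'k)"
    "(a, b) \<in> Poly_Mapping.keys ((\<lambda>(a, b). if a = [] then 0 else sg (a, b @ [last w]) (1 :: 'k)) x)"
    unfolding delta_def using keys_lx by fastforce
  then have "(a, butlast b) \<in> Poly_Mapping.keys (unsh d (butlast w) :: _ \<Rightarrow>\<^sub>0 'k)" "a \<noteq> []" "b = butlast b @ [last w]"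
    by (auto split: if_splits prod.splits)
  then show "set a \<union> set b = set w" "a \<noteq> []" "b \<noteq> []"
    using keys_unsh_set[of a "butlast b" d "butlast w"] w
    by (metis Un_assoc append_butlast_last_id set_append, auto)
qed

lemma Dg_length1:
  assumes "\<And>w. w \<noteq> [] \<Longrightarrow> d (\<beta> w) = dw d w - 1"
  shows "lx (\<lambda>u. if length u = 1 then sg u 1 else 0) (Dg d \<beta> (w @ [v])) = (sg [\<beta> (w @ [v])] 1 :: _ \<Rightarrow>\<^sub>0 'k::field)"
proof -
  have "lx (\<lambda>u. if length u = 1 then sg u 1 else 0) (lx (\<lambda>u. sg (u @ [v]) 1) (Dg d \<beta> w))
      = lx (\<lambda>u. 0) (Dg d \<beta> w :: _ \<Rightarrow>\<^sub>0 'k)"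
    unfolding lx_comp by (intro lx_cong refl) (use keys_Dg[OF assms] in \<open>fastforce simp: lx_simps\<close>)
  moreover have "lx (\<lambda>u. if length u = 1 then sg u 1 else 0) (lx (\<lambda>(a, b). sg (a @ [\<beta> (b @ [v])]) (psgn (dw d a))) (unsh d w))
      = lx (\<lambda>(a, b). if a = [] then sg [\<beta> (b @ [v])] (1 :: 'k) else 0) (unsh d w)"
    unfolding lx_comp by (intro lx_cong refl) (auto simp: lx_simps)
  ultimately show ?thesis
    by (simp add: Dg_simps lx_simps lx_fun unsh_nil)
qed

context
  fixes V :: "('k::field_char_0, 'v::ab_group_add) leib2"
  assumes V: "leibniz_2term V"
begin

interpretation fs: vector_space "fscale :: 'k \<Rightarrow> ('b \<Rightarrow>\<^sub>0 'k) \<Rightarrow> _" by (rule vs_fscale)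
interpretation vs: vector_space "scl V" using V by (simp add: leibniz_2term_def graded_2term_def)

interpretation vp: vector_space_pair "scl V" "scl V" ..

abbreviation "lin f \<equiv> Vector_Spaces.linear (scl V) (scl V) f"
abbreviation "R \<equiv> tensor_rels (scl V) word_slots"

definition modlin :: "('v \<Rightarrow> ('v list \<Rightarrow>\<^sub>0 'k)) \<Rightarrow> bool" where
  "modlin G \<longleftrightarrow> (\<forall>u v. G (u + v) - G u - G v \<in> R) \<and> (\<forall>c u. G (scl V c u) - fscale c (G u) \<in> R)"

lemma R_sub: "fs.subspace R" unfolding tensor_rels_def by (rule fs.subspace_span)

lemmas R_closed = fs.subspace_add[OF R_sub] fs.subspace_diff[OF R_sub] fs.subspace_scale[OF R_sub]
  fs.subspace_0[OF R_sub] fs.subspace_sum[OF R_sub]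

lemma R_comb: "a \<in> R \<Longrightarrow> b \<in> R \<Longrightarrow> c \<in> R \<Longrightarrow> e \<in> R \<Longrightarrow> a - b - c + e \<in> R"
  "a \<in> R \<Longrightarrow> b \<in> R \<Longrightarrow> e \<in> R \<Longrightarrow> a - fscale k b + e \<in> R"
  by (simp_all add: R_closed)

lemma modlin_0: "modlin (\<lambda>u. 0)" by (simp add: modlin_def R_closed)

lemma modlin_add: assumes "modlin G" "modlin H" shows "modlin (\<lambda>u. G u + H u)"
proof -
  have "G (u + v) + H (u + v) - (G u + H u) - (G v + H v) = (G (u + v) - G u - G v) + (H (u + v) - H u - H v)"
    "G (scl V c u) + H (scl V c u) - fscale c (G u + H u) = (G (scl V c u) - fscale c (G u)) + (H (scl V c u) - fscale c (H u))"
    for u v c by (simp_all add: fscale_add)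
  with assms show ?thesis unfolding modlin_def by (metis R_closed(1))
qed

lemma modlin_scale: assumes "modlin G" shows "modlin (\<lambda>u. fscale e (G u))"
proof -
  have "fscale e (G (u + v)) - fscale e (G u) - fscale e (G v) = fscale e (G (u + v) - G u - G v)"
    "fscale e (G (scl V c u)) - fscale c (fscale e (G u)) = fscale e (G (scl V c u) - fscale c (G u))"
    for u v c by (simp_all add: fscale_diff mult.commute)
  with assms show ?thesis unfolding modlin_def by (metis R_closed(3))
qed

lemma modlin_lx: assumes "\<And>x. x \<in> Poly_Mapping.keys a \<Longrightarrow> modlin (G x)" shows "modlin (\<lambda>u. lx (\<lambda>x. G x u) a)"
proof -
  have "modlin (\<lambda>u. \<Sum>x\<in>S. fscale (Poly_Mapping.lookup a x) (G x u))" if "finite S" "S \<subseteq> Poly_Mapping.keys a" for S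
    using that by (induction S rule: finite_induct) (auto intro!: modlin_0 modlin_add modlin_scale assms)
  from this[of "Poly_Mapping.keys a"] show ?thesis by (simp add: fext_def)
qed

lemma modlin_slot: assumes "lin f" shows "modlin (\<lambda>u. sg (p @ f u # q) e)"
proof -
  interpret f: Vector_Spaces.linear "scl V" "scl V" f by (rule assms)
  have s: "(\<lambda>v. p @ v # q) \<in> word_slots" by (auto simp: word_slots_def)
  have 1: "sg (p @ (u + v) # q) 1 - sg (p @ u # q) 1 - sg (p @ v # q) 1 \<in> R" for u v
    unfolding tensor_rels_def by (rule fs.span_base, rule UnI1) (use s in fast)
  have 2: "sg (p @ scl V c u # q) 1 - sg (p @ u # q) c \<in> R" for c u
    unfolding tensor_rels_def by (rule fs.span_base, rule UnI2) (use s in fast)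
  have "modlin (\<lambda>u. sg (p @ f u # q) 1)"
    unfolding modlin_def using 1 2 by (simp add: f.add f.scale)
  from modlin_scale[OF this, of e] show ?thesis by simp
qed

lemma R_append: assumes "a \<in> R" shows "lx (\<lambda>w. sg (w @ q) 1) a \<in> R"
proof -
  have "a \<in> fs.span
     ({sg (c (u + v)) 1 - sg (c u) 1 - sg (c v) 1 | c u v. c \<in> (word_slots :: ('v \<Rightarrow> 'v list) set)} \<union>
      {sg (c (scl V e v)) 1 - sg (c v) e | c e v. c \<in> word_slots})"
    using assms by (simp add: tensor_rels_def)
  then show ?thesis
  proof (induction rule: fs.span_induct_alt)
    case base
    then show ?case by (simp add: lx_simps R_closed)
  next
    case (step c x y)
    have sl: "modlin (\<lambda>v. sg (g v @ q) 1)" if "g \<in> word_slots" for g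
      using that modlin_slot[OF vs.linear_id, of _ "_ @ q" 1] by (auto simp: word_slots_def id_def)
    have "lx (\<lambda>w. sg (w @ q) 1) x \<in> R"
      using step(1) sl by (fastforce simp: lx_simps modlin_def)
    then show ?case using step by (simp add: lx_simps R_closed)
  qed
qed

lemma modlin_append: assumes "modlin G" shows "modlin (\<lambda>u. lx (\<lambda>w. sg (w @ q) 1) (G u))"
  using assms unfolding modlin_def by (auto simp flip: lx_simps(4,6) intro!: R_append)

lemma bracket_long: "length w > 3 \<Longrightarrow> bracket V w = 0"
  by (cases "(V, w)" rule: bracket.cases) auto

lemma bracket_lin: "lin (\<lambda>u. bracket V (p @ u # q))"
proof -
  have Z: "lin (\<lambda>u. 0)" by (rule vp.linear_zero)
  have L: "lin (br1 V)" "bilinear_map (scl V) (scl V) (br2 V)" "trilinear_map (scl V) (scl V) (br3 V)"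
    using V by (auto simp: leibniz_2term_def)
  consider "length p = 0" "length q = 0" | "length p = 0" "length q = 1" | "length p = 1" "length q = 0"
    | "length p = 0" "length q = 2" | "length p = 1" "length q = 1" | "length p = 2" "length q = 0"
    | "length p + length q > 2"
    by linarith
  then show ?thesis
  proof cases
    case 7
    then have "bracket V (p @ u # q) = 0" for u
      by (intro bracket_long) simp
    then show ?thesis using Z by simp
  qed (use L in \<open>auto simp: bilinear_map_def trilinear_map_def length_Suc_conv numeral_2_eq_2\<close>)
qed

definition tdeg :: "int \<times> 'v \<Rightarrow> int" where "tdeg x = fst x + 1"

definition tbet :: "(int \<times> 'v) list \<Rightarrow> int \<times> 'v" where
  "tbet xs = (sum_list (map fst xs) + int (length xs) - 2,
     scl V (tensor_sgn (replicate (length xs) 1) (map fst xs)) (bracket V (map snd xs)))"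

lemma tdeg_sum: "dw tdeg xs = sum_list (map fst xs) + int (length xs)"
  by (induction xs) (auto simp: tdeg_def)

lemma tbet_deg: "xs \<noteq> [] \<Longrightarrow> tdeg (tbet xs) = dw tdeg xs - 1"
  by (simp add: tdeg_sum) (simp add: tdeg_def tbet_def)

lemma lin_scale: assumes "lin f" shows "lin (\<lambda>u. scl V c (f u))"
  using assms by (rule vp.linear_compose_scale_right)

definition E :: "(int \<times> 'v) list \<Rightarrow> ('v list \<Rightarrow>\<^sub>0 'k)" where
  "E xs = lx (\<lambda>ys. sg (map snd ys) 1) (Dg tdeg tbet xs)"

lemma E_snoc: "E (w @ [x]) = lx (\<lambda>y. sg (y @ [snd x]) 1) (E w)
   + lx (\<lambda>(a, b). sg (map snd a @ [snd (tbet (b @ [x]))]) (psgn (dw tdeg a))) (unsh tdeg w)"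
  by (simp add: E_def Dg_simps lx_simps lx_comp split_def)

lemma tbet_lin: "lin (\<lambda>u. snd (tbet (p @ (i, u) # q)))"
  using lin_scale[OF bracket_lin[of "map snd p" "map snd q"]] by (simp add: tbet_def)

lemma E_modlin: "modlin (\<lambda>u. E (us @ (i, u) # vs))"
proof (induction vs rule: rev_induct)
  case Nil
  show ?case
    unfolding E_snoc
  proof (intro modlin_add modlin_lx)
    show "modlin (\<lambda>u. sg (x @ [snd (i, u)]) 1)" for x
      using modlin_slot[OF vs.linear_id, of x "[]" 1] by (simp add: id_def)
  next
    fix x show "modlin (\<lambda>u. case x of (a, b) \<Rightarrow> sg (map snd a @ [snd (tbet (b @ [(i, u)]))]) (psgn (dw tdeg a)))"
      using modlin_slot[OF tbet_lin, of "map snd (fst x)" "snd x" i "[]" "[]"] by (simp add: split_def)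
  qed
next
  case (snoc x vs)
  define W where "W = map Some us @ None # map Some vs"
  define h where "h u y = (case y of None \<Rightarrow> (i, u) | Some z \<Rightarrow> z)" for u :: 'v and y
  define d' where "d' y = (case y of None \<Rightarrow> i + 1 | Some z \<Rightarrow> tdeg z)" for y
  have d: "tdeg (h u y) = d' y" for u y by (auto simp: h_def d'_def tdeg_def split: option.split)
  have hW: "map (h u) W = us @ (i, u) # vs" for u by (simp add: W_def h_def comp_def)
  have dwh: "dw tdeg (map (h u) A) = dw d' A" for u A by (induction A) (auto simp: d)
  have hS: "map (h u) A = map (h 0) A" if "None \<notin> set A" for u A
    using that by (auto simp: h_def split: option.splits)
  have "E ((us @ (i, u) # vs) @ [x]) = lx (\<lambda>y. sg (y @ [snd x]) 1) (E (us @ (i, u) # vs))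
   + lx (\<lambda>(a, b). sg (map snd (map (h u) a) @ [snd (tbet (map (h u) b @ [x]))]) (psgn (dw d' a))) (unsh d' W)" for u
    unfolding E_snoc hW[of u, symmetric] by (subst unsh_map[where d = d']) (simp_all add: d lx_comp lx_simps split_def dwh)
  moreover have "modlin (\<lambda>u. lx (\<lambda>(a, b). sg (map snd (map (h u) a) @ [snd (tbet (map (h u) b @ [x]))]) (psgn (dw d' a))) (unsh d' W))"
  proof (rule modlin_lx)
    fix y assume y: "y \<in> Poly_Mapping.keys (unsh d' W :: _ \<Rightarrow>\<^sub>0 'k)"
    obtain A B where AB: "y = (A, B)" by (cases y)
    have "count (mset A) None + count (mset B) None = count (mset W) None"
      using keys_unsh[OF y] by (metis AB count_union fst_conv snd_conv)
    also have "\<dots> = 1" by (simp add: W_def count_eq_zero_iff)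
    finally have "(count (mset A) None = 1 \<and> None \<notin> set B) \<or> (None \<notin> set A \<and> count (mset B) None = 1)"
      by (auto simp: add_is_1 count_eq_zero_iff)
    then show "modlin (\<lambda>u. case y of (a, b) \<Rightarrow> sg (map snd (map (h u) a) @ [snd (tbet (map (h u) b @ [x]))]) (psgn (dw d' a)))"
    proof
      assume A: "count (mset A) None = 1 \<and> None \<notin> set B"
      then have "None \<in> set A" by (metis count_inI count_mset_0_iff zero_neq_one set_mset_mset)
      then obtain A1 A2 where A12: "A = A1 @ None # A2" by (meson split_list)
      with A have n: "None \<notin> set A1" "None \<notin> set A2" by (auto simp: count_eq_zero_iff)
      have "sg (map snd (map (h u) A) @ [snd (tbet (map (h u) B @ [x]))]) (psgn (dw d' A))
        = sg (map snd (map (h 0) A1) @ u # (map snd (map (h 0) A2) @ [snd (tbet (map (h 0) B @ [x]))])) (psgn (dw d' A) :: 'k)" for u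
        unfolding A12 list.map map_append hS[OF n(1), of u] hS[OF n(2), of u] hS[OF conjunct2[OF A], of u]
        by (simp add: h_def)
      then show ?thesis using modlin_slot[OF vs.linear_id] by (simp add: AB id_def)
    next
      assume B: "None \<notin> set A \<and> count (mset B) None = 1"
      then have "None \<in> set B" by (metis count_inI count_mset_0_iff zero_neq_one set_mset_mset)
      then obtain B1 B2 where B12: "B = B1 @ None # B2" by (meson split_list)
      with B have n: "None \<notin> set B1" "None \<notin> set B2" by (auto simp: count_eq_zero_iff)
      have "sg (map snd (map (h u) A) @ [snd (tbet (map (h u) B @ [x]))]) (psgn (dw d' A))
        = sg (map snd (map (h 0) A) @ snd (tbet (map (h 0) B1 @ (i, u) # (map (h 0) B2 @ [x]))) # []) (psgn (dw d' A) :: 'k)" for u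
        unfolding B12 list.map map_append hS[OF n(1), of u] hS[OF n(2), of u] hS[OF conjunct1[OF B], of u]
        by (simp add: h_def)
      then show ?thesis using modlin_slot[OF tbet_lin] by (simp add: AB)
    qed
  qed
  ultimately show ?case
    using modlin_add[OF modlin_append[OF snoc.IH]] by simp
qed

lemma E_zero: "E (us @ (i, 0) # vs) \<in> R"
  using E_modlin[of us i vs] unfolding modlin_def
  by (metis diff_zero fscale_simps(3) vs.scale_zero_left)

text \<open>Letters tagged with a degree. A tag can be incoherent with \<open>ldeg\<close> only if the letter is 0.\<close>

definition ok :: "int \<times> 'v \<Rightarrow> bool" where "ok x \<longleftrightarrow> snd x \<in> gr V (fst x)"
definition coh :: "int \<times> 'v \<Rightarrow> bool" where "coh x \<longleftrightarrow> fst x = ldeg V (snd x)"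
definition tagw :: "'v list \<Rightarrow> (int \<times> 'v) list" where "tagw w = map (\<lambda>v. (ldeg V v, v)) w"
definition strip :: "(int \<times> 'v) list \<Rightarrow> ('v list \<Rightarrow>\<^sub>0 'k)" where
  "strip xs = (if \<forall>x\<in>set xs. coh x then sg (map snd xs) 1 else 0)"
definition strip2 where
  "strip2 a b = (if \<forall>x\<in>set a \<union> set b. coh x then sg (map snd a, map snd b) (1 :: 'k) else 0)"
definition DV :: "'v list \<Rightarrow> ('v list \<Rightarrow>\<^sub>0 'k)" where "DV w = lx strip (Dg tdeg tbet (tagw w))"

lemma gr_sub: "vs.subspace (gr V i)" and gr_out: "i \<notin> {0, 1} \<Longrightarrow> gr V i = {0}"
  and gr_dec: "\<exists>!(x, h). x \<in> gr V 0 \<and> h \<in> gr V 1 \<and> v = x + h"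
proof -
  have "graded_2term V" using V by (simp add: leibniz_2term_def)
  note g = this[unfolded graded_2term_def]
  show "vs.subspace (gr V i)" using g by simp
  show "i \<notin> {0, 1} \<Longrightarrow> gr V i = {0}" using g by simp
  show "\<exists>!(x, h). x \<in> gr V 0 \<and> h \<in> gr V 1 \<and> v = x + h"
    by (rule g[THEN conjunct2, THEN conjunct2, THEN conjunct2, rule_format])
qed

lemma gr_0: "0 \<in> gr V i" by (rule vs.subspace_0[OF gr_sub])

lemma gr_int: "v \<in> gr V 0 \<Longrightarrow> v \<in> gr V 1 \<Longrightarrow> v = 0"
proof -
  assume v: "v \<in> gr V 0" "v \<in> gr V 1"
  obtain p where p: "\<And>q. (case q of (x, h) \<Rightarrow> x \<in> gr V 0 \<and> h \<in> gr V 1 \<and> v = x + h) \<Longrightarrow> q = p"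
    using gr_dec[of v] by (elim ex1E) blast
  have "(v, 0) = p" "(0, v) = p" by (rule p; simp add: v gr_0)+
  then show "v = 0" by auto
qed

lemma ok_coh: assumes "ok x" "\<not> coh x" shows "snd x = 0"
  using assms gr_int[of "snd x"] gr_out[of "fst x"] unfolding ok_def coh_def ldeg_def
  by (cases "fst x \<in> {0, 1}") (auto split: if_splits)

lemma ok_coh_hom: "ok x \<Longrightarrow> coh x \<Longrightarrow> snd x \<in> gr V 0 \<union> gr V 1"
  by (auto simp: ok_def coh_def ldeg_def split: if_splits)

lemma ok_tbet: assumes "xs \<noteq> []" "\<forall>x\<in>set xs. ok x" shows "ok (tbet xs)"
proof -
  have L: "\<And>i u. u \<in> gr V i \<Longrightarrow> br1 V u \<in> gr V (i - 1)"
    "\<And>i j u v. u \<in> gr V i \<Longrightarrow> v \<in> gr V j \<Longrightarrow> br2 V u v \<in> gr V (i + j)"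
    "\<And>i j k u v w. u \<in> gr V i \<Longrightarrow> v \<in> gr V j \<Longrightarrow> w \<in> gr V k \<Longrightarrow> br3 V u v w \<in> gr V (i + j + k + 1)"
    using V unfolding leibniz_2term_def by blast+
  have "bracket V (map snd xs) \<in> gr V (sum_list (map fst xs) + int (length xs) - 2)"
  proof -
    consider "length xs = 1" | "length xs = 2" | "length xs = 3" | "length xs > 3"
      using assms(1) unfolding length_0_conv[symmetric] by linarith
    then show ?thesis
    proof cases
      case 1
      then obtain x where "xs = [x]" by (auto simp: length_Suc_conv)
      then show ?thesis using assms L(1) by (auto simp: ok_def)
    next
      case 2
      then obtain x y where "xs = [x, y]" by (auto simp: length_Suc_conv numeral_2_eq_2)
      then show ?thesis using assms L(2) by (auto simp: ok_def)
    next
      case 3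
      then obtain x y z where "xs = [x, y, z]" by (auto simp: length_Suc_conv numeral_3_eq_3)
      then show ?thesis using assms L(3)[of "snd x" "fst x" "snd y" "fst y" "snd z" "fst z"] by (auto simp: ok_def ac_simps)
    next
      case 4
      then show ?thesis using gr_0 by (simp add: bracket_long)
    qed
  qed
  then show ?thesis unfolding ok_def tbet_def by (auto intro: vs.subspace_scale[OF gr_sub])
qed

lemma ok_tagw: "w \<in> hwords V \<Longrightarrow> \<forall>x\<in>set (tagw w). ok x \<and> coh x"
  by (auto simp: hwords_def tagw_def ok_def coh_def ldeg_def)

lemma keys_D: "w \<in> hwords V \<Longrightarrow> xs \<in> Poly_Mapping.keys (Dg tdeg tbet (tagw w) :: _ \<Rightarrow>\<^sub>0 'k) \<Longrightarrow>
    xs \<noteq> [] \<and> dw tdeg xs = dw tdeg (tagw w) - 1 \<and> (\<forall>x\<in>set xs. ok x)"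
  by (rule keys_Dg_inv[OF tbet_deg, of ok]) (auto simp: ok_tbet dest: ok_tagw)

lemma wdeg_snd: "\<forall>x\<in>set xs. coh x \<Longrightarrow> wdeg V (map snd xs) = dw tdeg xs"
  by (induction xs) (auto simp: wdeg_def tdeg_def coh_def)

lemma snd_tagw [simp]: "map snd (tagw w) = w" by (simp add: tagw_def comp_def)

lemma tagw_snd: "\<forall>x\<in>set xs. coh x \<Longrightarrow> tagw (map snd xs) = xs"
  by (induction xs) (auto simp: tagw_def coh_def)

lemma wdeg_tagw: "w \<in> hwords V \<Longrightarrow> dw tdeg (tagw w) = wdeg V w"
  using wdeg_snd[of "tagw w"] ok_tagw[of w] by simp

lemma DV_keys: assumes "w \<in> hwords V" shows "Poly_Mapping.keys (DV w) \<subseteq> {u \<in> hwords V. wdeg V u = wdeg V w - 1}"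
proof
  fix u assume "u \<in> Poly_Mapping.keys (DV w)"
  then obtain xs where xs: "xs \<in> Poly_Mapping.keys (Dg tdeg tbet (tagw w) :: _ \<Rightarrow>\<^sub>0 'k)" "u \<in> Poly_Mapping.keys (strip xs)"
    unfolding DV_def using keys_lx by fastforce
  from xs(2) have c: "\<forall>x\<in>set xs. coh x" "u = map snd xs" by (auto simp: strip_def split: if_splits)
  then show "u \<in> {u \<in> hwords V. wdeg V u = wdeg V w - 1}"
    using keys_D[OF assms xs(1)] ok_coh_hom wdeg_tagw[OF assms] by (auto simp: hwords_def wdeg_snd)
qed

lemma word_zero_R: "0 \<in> set w \<Longrightarrow> sg w e \<in> R"
proof -
  assume "0 \<in> set w"
  then obtain p q where "w = p @ 0 # q" by (meson split_list)
  moreover have "modlin (\<lambda>u. sg (p @ u # q) e)" using modlin_slot[OF vs.linear_id] by (simp add: id_def)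
  ultimately show ?thesis unfolding modlin_def by (metis diff_zero fscale_simps(3) vs.scale_zero_left)
qed

lemma DV_E: assumes "w \<in> hwords V" shows "DV w - E (tagw w) \<in> R"
proof -
  have "DV w - E (tagw w) = lx (\<lambda>xs. strip xs + fscale (- 1) (sg (map snd xs) 1)) (Dg tdeg tbet (tagw w))"
    unfolding DV_def E_def lx_fun by simp
  also have "\<dots> \<in> R"
    unfolding fext_def
  proof (intro R_closed(5) R_closed(3))
    fix xs assume "xs \<in> Poly_Mapping.keys (Dg tdeg tbet (tagw w) :: _ \<Rightarrow>\<^sub>0 'k)"
    then have ok: "\<forall>x\<in>set xs. ok x" using keys_D[OF assms] by blast
    show "strip xs + fscale (- 1) (sg (map snd xs) 1) \<in> R"
    proof (cases "\<forall>x\<in>set xs. coh x")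
      case True
      then show ?thesis by (simp add: strip_def R_closed del: fscale_simps(1))
    next
      case False
      then have "0 \<in> set (map snd xs)" using ok ok_coh by force
      then show ?thesis using False word_zero_R by (auto simp: strip_def)
    qed
  qed
  finally show ?thesis .
qed

lemma E_retag:
  assumes "u \<in> gr V i" "i \<in> {0, 1}"
  shows "E (tagw (us @ u # vs)) - E (tagw us @ (i, u) # tagw vs) \<in> R"
proof (cases "ldeg V u = i")
  case True
  then show ?thesis by (simp add: tagw_def R_closed)
next
  case False
  then have "u = 0" using ok_coh[of "(i, u)"] assms by (auto simp: ok_def coh_def)
  then show ?thesis using E_zero R_closed(2) by (simp add: tagw_def)
qed

lemma DV_retag:
  assumes "us @ u # vs \<in> hwords V" "u \<in> gr V i" "i \<in> {0, 1}"
  shows "DV (us @ u # vs) - E (tagw us @ (i, u) # tagw vs) \<in> R"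
  using R_closed(1)[OF DV_E[OF assms(1)] E_retag[OF assms(2,3), of us vs]] by simp

lemma DV_add:
  assumes "us @ u # vs \<in> hwords V" "u \<in> gr V i" "v \<in> gr V i" "i \<in> {0, 1}"
  shows "DV (us @ (u + v) # vs) - DV (us @ u # vs) - DV (us @ v # vs) \<in> R"
proof -
  have g: "u + v \<in> gr V i" using assms by (auto intro: vs.subspace_add[OF gr_sub])
  have h: "us @ v # vs \<in> hwords V" "us @ (u + v) # vs \<in> hwords V"
    using assms g by (auto simp: hwords_def)
  let ?G = "\<lambda>u. E (tagw us @ (i, u) # tagw vs)"
  have "?G (u + v) - ?G u - ?G v \<in> R" using E_modlin[of "tagw us" i "tagw vs"] by (simp add: modlin_def)
  moreover note DV_retag[OF assms(1,2,4)] DV_retag[OF h(1) assms(3,4)] DV_retag[OF h(2) g assms(4)]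
  ultimately have "(DV (us @ (u + v) # vs) - ?G (u + v)) - (DV (us @ u # vs) - ?G u) - (DV (us @ v # vs) - ?G v)
     + (?G (u + v) - ?G u - ?G v) \<in> R"
    by (intro R_comb(1))
  then show ?thesis by (simp add: algebra_simps)
qed

lemma DV_scale:
  assumes "us @ u # vs \<in> hwords V"
  shows "DV (us @ scl V c u # vs) - fscale c (DV (us @ u # vs)) \<in> R"
proof -
  obtain i where i: "u \<in> gr V i" "i \<in> {0, 1}" using assms by (auto simp: hwords_def)
  have g: "scl V c u \<in> gr V i" using i by (auto intro: vs.subspace_scale[OF gr_sub])
  have h: "us @ scl V c u # vs \<in> hwords V" using assms g i by (auto simp: hwords_def)
  let ?G = "\<lambda>u. E (tagw us @ (i, u) # tagw vs)"
  have "?G (scl V c u) - fscale c (?G u) \<in> R" using E_modlin[of "tagw us" i "tagw vs"] by (simp add: modlin_def)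
  moreover note DV_retag[OF assms i] DV_retag[OF h g i(2)]
  ultimately have "(DV (us @ scl V c u # vs) - ?G (scl V c u)) - fscale c (DV (us @ u # vs) - ?G u)
     + (?G (scl V c u) - fscale c (?G u)) \<in> R"
    by (intro R_comb(2))
  then show ?thesis by (simp add: algebra_simps fscale_diff)
qed

abbreviation "dV \<equiv> \<lambda>v. ldeg V v + 1"

lemma delta_strip: "lx (delta dV) (strip xs) = lx (\<lambda>(a, b). strip2 a b) (delta tdeg xs)"
proof (cases "\<forall>x\<in>set xs. coh x")
  case True
  then have "\<forall>x\<in>set xs. dV (snd x) = tdeg x" by (auto simp: coh_def tdeg_def)
  then have "lx (delta dV) (strip xs) = lx (\<lambda>(a, b). sg (map snd a, map snd b) 1) (delta tdeg xs)"
    using True by (simp add: strip_def lx_simps delta_map)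
  also have "\<dots> = lx (\<lambda>(a, b). strip2 a b) (delta tdeg xs)"
    by (intro lx_cong refl) (use True in \<open>auto simp: strip2_def dest!: keys_delta_set(1)\<close>)
  finally show ?thesis .
next
  case False
  have "lx (\<lambda>(a, b). strip2 a b) (delta tdeg xs) = lx (\<lambda>_. 0) (delta tdeg xs)"
    by (intro lx_cong refl) (use False in \<open>auto simp: strip2_def dest!: keys_delta_set(1)\<close>)
  moreover have "strip xs = 0" using False by (auto simp: strip_def)
  ultimately show ?thesis by (simp add: lx_simps lx_fun)
qed

lemma DV_coder:
  assumes "w \<in> hwords V"
  shows "lx (delta dV) (DV w) = lx (\<lambda>(a, b). lx (\<lambda>a'. sg (a', b) 1) (DV a)
      + fscale (psgn (wdeg V a)) (lx (\<lambda>b'. sg (a, b') 1) (DV b))) (delta dV w)"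
proof -
  have coh: "\<forall>x\<in>set (tagw w). coh x" using ok_tagw[OF assms] by blast
  have "lx (delta dV) (DV w) = lx (\<lambda>(a, b). strip2 a b) (lx (delta tdeg) (Dg tdeg tbet (tagw w)))"
    unfolding DV_def lx_comp by (simp add: delta_strip)
  also have "\<dots> = lx (\<lambda>(a, b). lx (\<lambda>(a, b). strip2 a b) (Tg tdeg (Dg tdeg tbet) a b)) (delta tdeg (tagw w))"
    by (subst delta_T[OF tbet_deg]) (simp_all add: lx_comp split_def)
  also have "\<dots> = lx (\<lambda>(a, b). lx (\<lambda>a'. sg (a', map snd b) 1) (DV (map snd a))
      + fscale (psgn (wdeg V (map snd a))) (lx (\<lambda>b'. sg (map snd a, b') 1) (DV (map snd b)))) (delta tdeg (tagw w))"
  proof (intro lx_cong refl, goal_cases)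
    case (1 x)
    obtain a b where x: "x = (a, b)" by (cases x)
    have c: "\<forall>x\<in>set a. coh x" "\<forall>x\<in>set b. coh x"
      using keys_delta_set(1)[OF 1[unfolded x]] coh by auto
    have s: "strip2 a' b = lx (\<lambda>u. sg (u, map snd b) 1) (strip a')"
      "strip2 a = (\<lambda>b'. lx (\<lambda>u. sg (map snd a, u) 1) (strip b'))" for a'
      using c by (auto simp: strip2_def[abs_def] strip_def lx_simps fun_eq_iff)
    show ?case
      by (simp add: x Tg_def DV_def tagw_snd c wdeg_snd lx_simps lx_comp s)
  qed
  also have "\<dots> = lx (\<lambda>(a, b). lx (\<lambda>a'. sg (a', b) 1) (DV a)
      + fscale (psgn (wdeg V a)) (lx (\<lambda>b'. sg (a, b') 1) (DV b))) (delta dV (map snd (tagw w)))"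
    by (subst delta_map[where d = tdeg]) (use coh in \<open>auto simp: coh_def tdeg_def lx_comp lx_simps split_def\<close>)
  finally show ?thesis by simp
qed

lemma DV_corestr:
  assumes "w \<in> hwords V"
  shows "bracket V w = scl V (tensor_sgn (replicate (length w) 1) (map (ldeg V) w))
    (fext (scl V) (\<lambda>u. if length u = 1 then hd u else 0) (DV w))"
proof -
  let ?pr = "\<lambda>u. if length u = 1 then hd u else 0"
  let ?s = "tensor_sgn (replicate (length w) 1) (map (ldeg V) w) :: 'k"
  have VS: "vector_space (scl V)" by unfold_locales
  have w: "tagw w \<noteq> []" using assms by (auto simp: hwords_def tagw_def)
  have H: "fext (scl V) ?pr (strip xs) = fext (scl V) (\<lambda>ys. fext (scl V) ?pr (strip ys)) (if length xs = 1 then sg xs 1 else 0)" for xs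
    by (auto simp: fext_single[OF VS] fext_0[OF VS] strip_def)
  have "fext (scl V) ?pr (DV w) = fext (scl V) (\<lambda>ys. fext (scl V) ?pr (strip ys))
      (lx (\<lambda>xs. if length xs = 1 then sg xs 1 else 0) (Dg tdeg tbet (tagw w)))"
    unfolding DV_def fext_comp[OF VS] by (rule fext_cong[OF VS refl H])
  also have "lx (\<lambda>xs. if length xs = 1 then sg xs 1 else 0) (Dg tdeg tbet (tagw w)) = (sg [tbet (tagw w)] 1 :: _ \<Rightarrow>\<^sub>0 'k)"
    using Dg_length1[OF tbet_deg, of "butlast (tagw w)" "last (tagw w)"] w by simp
  also have "fext (scl V) (\<lambda>ys. fext (scl V) ?pr (strip ys)) \<dots> = snd (tbet (tagw w))"
    using ok_coh[OF ok_tbet[OF w]] ok_tagw[OF assms]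
    by (auto simp: fext_single[OF VS] fext_0[OF VS] strip_def)
  also have "\<dots> = scl V ?s (bracket V w)"
    by (simp add: tbet_def) (simp add: tagw_def comp_def)
  finally have "scl V ?s (fext (scl V) ?pr (DV w)) = scl V (?s * ?s) (bracket V w)" by simp
  also have "?s * ?s = 1"
    unfolding tensor_sgn_def prod.distrib[symmetric] by (rule prod.neutral) auto
  finally show ?thesis by simp
qed

theorem DV_ok: "coderivation V DV \<and> corestrictions V DV"
proof -
  have 0: "0 \<in> tensor_rels (scl V) pair_slots"
    unfolding tensor_rels_def by (rule fs.span_zero)
  show ?thesis
    unfolding coderivation_def corestrictions_def
    using DV_keys DV_add DV_scale DV_corestr 0 DV_coder by (auto simp: zin_delta_eq[abs_def])
qed

lemma zin_D_ok: "coderivation V (zin_D V)" "corestrictions V (zin_D V)"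
  using someI[of "\<lambda>D. coderivation V D \<and> corestrictions V D", OF DV_ok] unfolding zin_D_def by blast+

end

hide_const (open) T R lin E ok coh strip strip2 DV dV tau modlin tagw tdeg tbet Tg Dg Dr Dp delta dw unsh unshr sgnA
hide_const (open) lx sg

end

theory Submission
  imports Defs
begin

text \<open>A Maurer-Cartan element of \<open>L(V, W) \<otimes> \<Omega>\<^sub>1\<close> is a polynomial path \<open>\<alpha>(t) + \<beta>(t) dt\<close> with
  \<open>\<alpha>(t)\<close> of degree \<open>-1\<close> and \<open>\<beta>(t)\<close> of degree \<open>0\<close> in \<open>L(V, W)\<close>. As \<open>W\<close> lives in degrees 0 and 1, only
  the components \<open>\<alpha>\<^sup>1(x)\<close>, \<open>\<alpha>\<^sup>1(h)\<close>, \<open>\<alpha>\<^sup>2(x, y)\<close> and \<open>\<beta>(x)\<close> with \<open>x, y \<in> V\<^sub>0\<close>, \<open>h \<in> V\<^sub>1\<close> survive.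
  The part of the Maurer-Cartan equation without \<open>dt\<close> says that \<open>\<alpha>(t)\<close> is an infinity morphism for
  every \<open>t\<close>; the coefficient of \<open>dt\<close> is the differential equation
    \<open>\<alpha>\<^sup>1'(x) = m\<^sub>1 \<beta>(x)\<close>, \<open>\<alpha>\<^sup>1'(h) = \<beta>(l\<^sub>1 h)\<close>,
    \<open>\<alpha>\<^sup>2'(x, y) = \<beta>(l\<^sub>2(x, y)) - m\<^sub>2(\<alpha>\<^sup>1 x, \<beta> y) - m\<^sub>2(\<beta> x, \<alpha>\<^sup>1 y)\<close>.

  The map from \<open>\<infinity>\<close>-homotopies to 2-term homotopies is \<open>\<theta> = \<integral>\<^sub>0\<^sup>1 \<beta> dt\<close>, and it serves for both values of
  the index \<open>i\<close>. Integrating the first two equations gives the first two conditions on \<open>\<theta>\<close>. In the third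
  one, \<open>\<alpha>\<^sup>1 x = f\<^sub>1 x + m\<^sub>1 B(x)\<close> with \<open>B(t) = \<integral>\<^sub>0\<^sup>t \<beta>\<close>, and the identity
  \<open>m\<^sub>2(m\<^sub>1 h, k) = m\<^sub>2(h, m\<^sub>1 k)\<close> turns the quadratic remainder into the derivative of \<open>m\<^sub>2(B x, m\<^sub>1 B y)\<close>,
  whose integral \<open>m\<^sub>2(\<theta> x, m\<^sub>1 \<theta> y)\<close> changes \<open>f\<^sub>1 y\<close> into \<open>g\<^sub>1 y\<close> (\<open>homotopy_2term_dt_integral\<close>).

  For surjectivity, a 2-term homotopy \<open>\<theta>\<close> from \<open>f\<close> to \<open>g\<close> is the integral of the path with constant
  \<open>\<beta> = \<theta>\<close> that starts at \<open>f\<close>. Its value at \<open>t\<close> is the endpoint of the 2-term homotopy \<open>t\<theta>\<close> starting at \<open>f\<close>,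
  and this endpoint is an infinity morphism (\<open>infinity_morphism_homotopy_target\<close>); at \<open>t = 1\<close> it is \<open>g\<close>.
  That all values are Maurer-Cartan elements of \<open>L(V, W)\<close> gives the equation for the coefficients of
  \<open>t\<^sup>n\<close> because the field is infinite (\<open>mc_forms_value_0_form\<close>); the \<open>dt\<close>-part is checked by hand.

  What remains is to make the abstract Maurer-Cartan equation explicit. Degrees leave only words of at
  most three letters (\<open>mc_forms_value_gr\<close>, \<open>short_words\<close>), and on these the coderivation \<open>D\<close> is pinned
  down by its corestrictions together with the coderivation identity (\<open>conv_hom_zin_D_short\<close>).\<close>

section \<open>Two-term Leibniz infinity algebras and their morphisms\<close>

lemmas linear_imp_module_hom = Vector_Spaces.linear_iff_module_hom[THEN iffD1]
lemmas linear_ops = module_hom.add[OF linear_imp_module_hom] module_hom.diff[OF linear_imp_module_hom]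
  module_hom.zero[OF linear_imp_module_hom] module_hom.neg[OF linear_imp_module_hom]
lemmas linear_scale = module_hom.scale[OF linear_imp_module_hom]
lemmas linear_sum = module_hom.sum[OF linear_imp_module_hom]

locale leibniz2 =
  fixes V :: "('k::field_char_0, 'v::ab_group_add) leib2"
  assumes leibniz: "leibniz_2term V"
begin

sublocale vs: vector_space "scl V"
  using leibniz by (simp add: leibniz_2term_def graded_2term_def)

lemma br1_linear: "Vector_Spaces.linear (scl V) (scl V) (br1 V)"
  and br2_linear: "Vector_Spaces.linear (scl V) (scl V) (br2 V u)"
    "Vector_Spaces.linear (scl V) (scl V) (\<lambda>u. br2 V u v)"
  and br3_linear: "Vector_Spaces.linear (scl V) (scl V) (br3 V u v)"
    "Vector_Spaces.linear (scl V) (scl V) (\<lambda>v. br3 V u v w)"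
    "Vector_Spaces.linear (scl V) (scl V) (\<lambda>u. br3 V u v w)"
  using leibniz by (auto simp: leibniz_2term_def bilinear_map_def trilinear_map_def)

lemmas br_ops = linear_ops[OF br1_linear] linear_ops[OF br2_linear(1)] linear_ops[OF br2_linear(2)]
  linear_ops[OF br3_linear(1)] linear_ops[OF br3_linear(2)] linear_ops[OF br3_linear(3)]

lemma br_scale:
  "br1 V (scl V c u) = scl V c (br1 V u)"
  "br2 V (scl V c u) v = scl V c (br2 V u v)"
  "br2 V u (scl V c v) = scl V c (br2 V u v)"
  "br3 V (scl V c u) v w = scl V c (br3 V u v w)"
  "br3 V u (scl V c v) w = scl V c (br3 V u v w)"
  "br3 V u v (scl V c w) = scl V c (br3 V u v w)"
  using br1_linear br2_linear br3_linear by (simp_all add: Vector_Spaces.linear_iff)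

lemma br_gr:
  "u \<in> gr V i \<Longrightarrow> br1 V u \<in> gr V (i - 1)"
  "u \<in> gr V i \<Longrightarrow> v \<in> gr V j \<Longrightarrow> br2 V u v \<in> gr V (i + j)"
  "u \<in> gr V i \<Longrightarrow> v \<in> gr V j \<Longrightarrow> w \<in> gr V k \<Longrightarrow> br3 V u v w \<in> gr V (i + j + k + 1)"
  using leibniz unfolding leibniz_2term_def by blast+

lemma gr_ops:
  "0 \<in> gr V i"
  "u \<in> gr V i \<Longrightarrow> v \<in> gr V i \<Longrightarrow> u + v \<in> gr V i"
  "u \<in> gr V i \<Longrightarrow> v \<in> gr V i \<Longrightarrow> u - v \<in> gr V i"
  "u \<in> gr V i \<Longrightarrow> scl V c u \<in> gr V i"
  using gr_sub[OF leibniz] by (simp_all add: vs.subspace_0 vs.subspace_add vs.subspace_diff vs.subspace_scale)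

lemma gr_outside: "u \<in> gr V i \<Longrightarrow> i \<noteq> 0 \<Longrightarrow> i \<noteq> 1 \<Longrightarrow> u = 0"
  using gr_out[OF leibniz, of i] by auto

lemma br_gr_low:
  "x \<in> gr V 0 \<Longrightarrow> br1 V x = 0"
  "h \<in> gr V 1 \<Longrightarrow> br1 V h \<in> gr V 0"
  "x \<in> gr V 0 \<Longrightarrow> y \<in> gr V 0 \<Longrightarrow> br2 V x y \<in> gr V 0"
  "x \<in> gr V 0 \<Longrightarrow> h \<in> gr V 1 \<Longrightarrow> br2 V x h \<in> gr V 1"
  "h \<in> gr V 1 \<Longrightarrow> x \<in> gr V 0 \<Longrightarrow> br2 V h x \<in> gr V 1"
  "h \<in> gr V 1 \<Longrightarrow> k \<in> gr V 1 \<Longrightarrow> br2 V h k = 0"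
  "x \<in> gr V 0 \<Longrightarrow> y \<in> gr V 0 \<Longrightarrow> z \<in> gr V 0 \<Longrightarrow> br3 V x y z \<in> gr V 1"
  subgoal by (rule gr_outside[OF br_gr(1)[of x 0]]) simp_all
  subgoal by (drule br_gr(1)) simp
  subgoal by (drule (1) br_gr(2)) simp
  subgoal by (drule (1) br_gr(2)) simp
  subgoal by (drule (1) br_gr(2)) simp
  subgoal by (rule gr_outside[OF br_gr(2)[of h 1 k 1]]) simp_all
  subgoal by (drule (2) br_gr(3)) simp
  done

lemma homogeneous_parts:
  obtains x h where "x \<in> gr V 0" "h \<in> gr V 1" "v = x + h"
proof -
  have "\<exists>!(x, h). x \<in> gr V 0 \<and> h \<in> gr V 1 \<and> v = x + h"
    using leibniz by (simp add: leibniz_2term_def graded_2term_def)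
  from ex1_implies_ex[OF this] obtain p where "case p of (x, h) \<Rightarrow> x \<in> gr V 0 \<and> h \<in> gr V 1 \<and> v = x + h"
    by (rule exE)
  then show ?thesis by (intro that[of "fst p" "snd p"]) (simp_all add: split_def)
qed

lemma br_identities:
  "x \<in> gr V 0 \<Longrightarrow> h \<in> gr V 1 \<Longrightarrow> br1 V (br2 V x h) = br2 V x (br1 V h)"
  "x \<in> gr V 0 \<Longrightarrow> h \<in> gr V 1 \<Longrightarrow> br1 V (br2 V h x) = br2 V (br1 V h) x"
  "h \<in> gr V 1 \<Longrightarrow> k \<in> gr V 1 \<Longrightarrow> br2 V (br1 V h) k = br2 V h (br1 V k)"
  "x \<in> gr V 0 \<Longrightarrow> y \<in> gr V 0 \<Longrightarrow> z \<in> gr V 0 \<Longrightarrow>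
    br1 V (br3 V x y z) = br2 V x (br2 V y z) - br2 V y (br2 V x z) - br2 V (br2 V x y) z"
  "x \<in> gr V 0 \<Longrightarrow> y \<in> gr V 0 \<Longrightarrow> h \<in> gr V 1 \<Longrightarrow>
    br3 V x y (br1 V h) = br2 V x (br2 V y h) - br2 V y (br2 V x h) - br2 V (br2 V x y) h"
  "x \<in> gr V 0 \<Longrightarrow> y \<in> gr V 0 \<Longrightarrow> h \<in> gr V 1 \<Longrightarrow>
    br3 V x (br1 V h) y = br2 V x (br2 V h y) - br2 V h (br2 V x y) - br2 V (br2 V x h) y"
  "x \<in> gr V 0 \<Longrightarrow> y \<in> gr V 0 \<Longrightarrow> h \<in> gr V 1 \<Longrightarrow>
    br3 V (br1 V h) x y = br2 V h (br2 V x y) - br2 V x (br2 V h y) - br2 V (br2 V h x) y"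
  using leibniz unfolding leibniz_2term_def Let_def by blast+

end

locale leibniz2_pair = V: leibniz2 V + W: leibniz2 W
  for V :: "('k::field_char_0, 'v::ab_group_add) leib2" and W :: "('k, 'w::ab_group_add) leib2"
begin

abbreviation lin :: "('v \<Rightarrow> 'w) \<Rightarrow> bool" where "lin \<equiv> Vector_Spaces.linear (scl V) (scl W)"

lemma lin_iff: "lin F \<longleftrightarrow> (\<forall>u v. F (u + v) = F u + F v) \<and> (\<forall>c u. F (scl V c u) = scl W c (F u))"
  using V.vs.vector_space_axioms W.vs.vector_space_axioms by (simp add: Vector_Spaces.linear_iff)

lemma infinity_morphismI:
  assumes "lin f1" "\<And>u. lin (f2 u)" "\<And>v. lin (\<lambda>u. f2 u v)"
    "\<And>i u. u \<in> gr V i \<Longrightarrow> f1 u \<in> gr W i"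
    "\<And>i j u v. u \<in> gr V i \<Longrightarrow> v \<in> gr V j \<Longrightarrow> f2 u v \<in> gr W (i + j + 1)"
    "\<And>h. h \<in> gr V 1 \<Longrightarrow> br1 W (f1 h) = f1 (br1 V h)"
    "\<And>x y. x \<in> gr V 0 \<Longrightarrow> y \<in> gr V 0 \<Longrightarrow> br2 W (f1 x) (f1 y) + br1 W (f2 x y) = f1 (br2 V x y)"
    "\<And>x h. x \<in> gr V 0 \<Longrightarrow> h \<in> gr V 1 \<Longrightarrow> br2 W (f1 x) (f1 h) = f1 (br2 V x h) - f2 x (br1 V h)"
    "\<And>x h. x \<in> gr V 0 \<Longrightarrow> h \<in> gr V 1 \<Longrightarrow> br2 W (f1 h) (f1 x) = f1 (br2 V h x) - f2 (br1 V h) x"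
    "\<And>x y z. x \<in> gr V 0 \<Longrightarrow> y \<in> gr V 0 \<Longrightarrow> z \<in> gr V 0 \<Longrightarrow>
      br3 W (f1 x) (f1 y) (f1 z) - br2 W (f2 x y) (f1 z) + br2 W (f1 x) (f2 y z) - br2 W (f1 y) (f2 x z)
      = f1 (br3 V x y z) + f2 (br2 V x y) z - f2 x (br2 V y z) + f2 y (br2 V x z)"
  shows "infinity_morphism V W (f1, f2)"
  using assms by (simp add: infinity_morphism_def bilinear_map_def)

lemma infinity_morphism_facts:
  assumes "infinity_morphism V W f"
  shows "lin (fst f)" "lin (snd f u)" "lin (\<lambda>u. snd f u v)"
    "u \<in> gr V i \<Longrightarrow> fst f u \<in> gr W i" "u \<in> gr V i \<Longrightarrow> v \<in> gr V j \<Longrightarrow> snd f u v \<in> gr W (i + j + 1)"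
  using assms by (simp_all add: infinity_morphism_def Let_def bilinear_map_def)

text \<open>By degree, the bilinear component of a morphism vanishes outside \<open>V\<^sub>0 \<otimes> V\<^sub>0\<close>, and the linear
  one is determined on the two homogeneous parts.\<close>

lemma infinity_morphism_eqI:
  assumes f: "infinity_morphism V W f" and g: "infinity_morphism V W g"
    and eq: "\<And>x. x \<in> gr V 0 \<Longrightarrow> fst f x = fst g x" "\<And>h. h \<in> gr V 1 \<Longrightarrow> fst f h = fst g h"
      "\<And>x y. x \<in> gr V 0 \<Longrightarrow> y \<in> gr V 0 \<Longrightarrow> snd f x y = snd g x y"
  shows "f = g"
proof (rule prod_eqI)
  note F = infinity_morphism_facts[OF f] and G = infinity_morphism_facts[OF g]
  show "fst f = fst g"
  proof
    fix v
    obtain x h where "x \<in> gr V 0" "h \<in> gr V 1" "v = x + h" using V.homogeneous_parts .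
    then show "fst f v = fst g v" by (simp add: linear_ops[OF F(1)] linear_ops[OF G(1)] eq)
  qed
  have zero: "snd f u v = 0" "snd g u v = 0" if "u \<in> gr V i" "v \<in> gr V j" "i + j \<in> {1, 2}" for u v i j
    by (rule W.gr_outside[OF F(5)[OF that(1,2)]] W.gr_outside[OF G(5)[OF that(1,2)]]; use that(3) in auto)+
  show "snd f = snd g"
  proof (intro ext)
    fix u v
    obtain x h where u: "x \<in> gr V 0" "h \<in> gr V 1" "u = x + h" using V.homogeneous_parts .
    obtain y k where v: "y \<in> gr V 0" "k \<in> gr V 1" "v = y + k" using V.homogeneous_parts .
    have "snd f x k = snd g x k" "snd f h y = snd g h y" "snd f h k = snd g h k"
      using zero[of x 0 k 1] zero[of h 1 y 0] zero[of h 1 k 1] u v by simp_all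
    then show "snd f u v = snd g u v"
      by (simp add: u(3) v(3) linear_ops(1)[OF F(2)] linear_ops(1)[OF F(3)] linear_ops(1)[OF G(2)]
          linear_ops(1)[OF G(3)]
          eq(3)[OF u(1) v(1)])
  qed
qed

text \<open>The only possible endpoint of a 2-term homotopy \<open>\<theta>\<close> starting at \<open>f\<close>: its defining equations
  solved for \<open>g\<close>. On \<open>V\<^sub>0\<close> the summand \<open>\<theta> (br1 V u)\<close> vanishes, and on \<open>V\<^sub>1\<close> the summand \<open>br1 W (\<theta>
  u)\<close>, so one formula covers both degrees.\<close>

definition homotopy_target :: "('v \<Rightarrow> 'w) \<Rightarrow> ('v, 'w) inf_mor \<Rightarrow> ('v, 'w) inf_mor" where
  "homotopy_target \<theta> f = (\<lambda>u. fst f u + br1 W (\<theta> u) + \<theta> (br1 V u),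
     \<lambda>u v. snd f u v + \<theta> (br2 V u v) - br2 W (fst f u) (\<theta> v) - br2 W (\<theta> u) (fst f v + br1 W (\<theta> v)))"

text \<open>Homotopies can be transported: the endpoint is again a morphism. Only the last axiom takes
  work. In it, \<open>m\<^sub>3(g\<^sub>1 x, g\<^sub>1 y, g\<^sub>1 z)\<close> differs from \<open>m\<^sub>3(f\<^sub>1 x, f\<^sub>1 y, f\<^sub>1 z)\<close> by terms with an
  argument in the image of \<open>m\<^sub>1\<close>, which the axioms of \<open>W\<close> express by \<open>m\<^sub>2\<close>; these cancel against the
  corrections in \<open>g\<^sub>2\<close>.\<close>

theorem infinity_morphism_homotopy_target:
  assumes f: "infinity_morphism V W f"
    and lin: "lin \<theta>" and deg: "\<forall>i. \<forall>u\<in>gr V i. \<theta> u \<in> gr W (i + 1)"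
  shows "infinity_morphism V W (homotopy_target \<theta> f)"
proof -
  obtain f1 f2 where f12: "f = (f1, f2)" by (cases f)
  have f1: "lin f1" and f2: "lin (f2 u)" "lin (\<lambda>u. f2 u v)" for u v
    using f by (auto simp: f12 infinity_morphism_def bilinear_map_def Let_def)
  note ops = V.br_ops W.br_ops linear_ops[OF lin] linear_ops[OF f1]
    linear_ops[OF f2(1)] linear_ops[OF f2(2)]
  have degf: "u \<in> gr V i \<Longrightarrow> f1 u \<in> gr W i" "u \<in> gr V i \<Longrightarrow> v \<in> gr V j \<Longrightarrow> f2 u v \<in> gr W (i + j + 1)" for u v i j
    using f by (auto simp: f12 infinity_morphism_def Let_def)
  have deg': "x \<in> gr V 0 \<Longrightarrow> \<theta> x \<in> gr W 1" "h \<in> gr V 1 \<Longrightarrow> \<theta> h = 0"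
    "x \<in> gr V 0 \<Longrightarrow> y \<in> gr V 0 \<Longrightarrow> f2 x y \<in> gr W 1" for x y h
    using deg[rule_format, of x 0] deg[rule_format, of h 1] degf(2)[of x 0 y 0] by (auto dest: W.gr_outside)
  have eqs:
    "h \<in> gr V 1 \<Longrightarrow> br1 W (f1 h) = f1 (br1 V h)"
    "x \<in> gr V 0 \<Longrightarrow> y \<in> gr V 0 \<Longrightarrow> br2 W (f1 x) (f1 y) = f1 (br2 V x y) - br1 W (f2 x y)"
    "x \<in> gr V 0 \<Longrightarrow> h \<in> gr V 1 \<Longrightarrow> br2 W (f1 x) (f1 h) = f1 (br2 V x h) - f2 x (br1 V h)"
    "x \<in> gr V 0 \<Longrightarrow> h \<in> gr V 1 \<Longrightarrow> br2 W (f1 h) (f1 x) = f1 (br2 V h x) - f2 (br1 V h) x"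
    "x \<in> gr V 0 \<Longrightarrow> y \<in> gr V 0 \<Longrightarrow> z \<in> gr V 0 \<Longrightarrow> br3 W (f1 x) (f1 y) (f1 z) =
      f1 (br3 V x y z) + f2 (br2 V x y) z - f2 x (br2 V y z) + f2 y (br2 V x z)
      + br2 W (f2 x y) (f1 z) - br2 W (f1 x) (f2 y z) + br2 W (f1 y) (f2 x z)" for x y z h
    using f by (force simp: f12 infinity_morphism_def Let_def algebra_simps)+
  let ?g1 = "\<lambda>u. f1 u + br1 W (\<theta> u) + \<theta> (br1 V u)"
  let ?g2 = "\<lambda>u v. f2 u v + \<theta> (br2 V u v) - br2 W (f1 u) (\<theta> v) - br2 W (\<theta> u) (f1 v + br1 W (\<theta> v))"
  have g: "homotopy_target \<theta> f = (?g1, ?g2)" by (simp add: f12 homotopy_target_def)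
  have g_lin: "lin ?g1" "\<And>u. lin (?g2 u)" "\<And>v. lin (\<lambda>u. ?g2 u v)"
    unfolding lin_iff using linear_scale[OF lin] linear_scale[OF f1] linear_scale[OF f2(1)] linear_scale[OF
        f2(2)]
    by (simp_all add: ops V.br_scale W.br_scale W.vs.scale_right_distrib W.vs.scale_right_diff_distrib)
  have g1_gr: "?g1 u \<in> gr W i" if "u \<in> gr V i" for i u
    using that W.br_gr(1)[of "\<theta> u" "i + 1"] deg[rule_format, of u i] deg[rule_format, of "br1 V u" "i - 1"]
    by (simp add: W.gr_ops degf V.br_gr)
  have g2_gr: "?g2 u v \<in> gr W (i + j + 1)" if "u \<in> gr V i" "v \<in> gr V j" for i j u v
    using that degf(2)[of u i v j] W.br_gr(2)[of "f1 u" i "\<theta> v" "j + 1"] W.br_gr(2)[of "\<theta> u" "i + 1" "f1 v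
        + br1 W (\<theta> v)" j]
      deg[rule_format, of "br2 V u v" "i + j"] W.br_gr(1)[of "\<theta> v" "j + 1"]
      deg[rule_format, of u i] deg[rule_format, of v j]
    by (simp add: W.gr_ops degf V.br_gr ac_simps)
  have m1: "br1 W (?g1 h) = ?g1 (br1 V h)" if h: "h \<in> gr V 1" for h
    using h by (simp add: ops V.br_gr_low(1,2) deg' eqs V.br_gr_low(1)[OF V.br_gr_low(2)[OF h]])
  have g2: "br2 W (?g1 x) (?g1 y) + br1 W (?g2 x y) = ?g1 (br2 V x y)" if "x \<in> gr V 0" "y \<in> gr V 0" for x y
    using that by (simp add: ops V.br_gr_low W.br_gr_low(2-5) degf(1) deg' eqs(2) W.br_identities(1,2))
  have m2: "br2 W (?g1 x) (?g1 h) = ?g1 (br2 V x h) - ?g2 x (br1 V h)"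
    "br2 W (?g1 h) (?g1 x) = ?g1 (br2 V h x) - ?g2 (br1 V h) x" if "x \<in> gr V 0" "h \<in> gr V 1" for x h
    using that
    by (simp_all add: ops V.br_gr_low(1-5) W.br_gr_low(2) degf(1) deg' eqs(1)[symmetric] eqs(2-4)
        W.br_identities(3) V.br_identities(1,2))
  have m3: "br3 W (?g1 x) (?g1 y) (?g1 z) - br2 W (?g2 x y) (?g1 z) + br2 W (?g1 x) (?g2 y z)
      - br2 W (?g1 y) (?g2 x z)
      = ?g1 (br3 V x y z) + ?g2 (br2 V x y) z - ?g2 x (br2 V y z) + ?g2 y (br2 V x z)"
    if x: "x \<in> gr V 0" "y \<in> gr V 0" "z \<in> gr V 0" for x y z
  proof -
    define X Y Z where XYZ: "X = f1 x + br1 W (\<theta> x)" "Y = f1 y + br1 W (\<theta> y)" "Z = f1 z + br1 W (\<theta> z)"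
    have g1: "?g1 x = X" "?g1 y = Y" "?g1 z = Z" using x by (simp_all add: XYZ V.br_gr_low(1) ops)
    note mem' = x V.br_gr_low(2-5,7) degf(1) deg' W.br_gr_low(2-5) W.gr_ops(2)
    have XYZ0: "X \<in> gr W 0" "Y \<in> gr W 0" "Z \<in> gr W 0" by (simp_all add: XYZ mem')
    define P Q R where PQR: "P = ?g2 x y" "Q = ?g2 y z" "R = ?g2 x z"
    have Q1: "Q \<in> gr W 1"
      by (simp add: PQR XYZ[symmetric] XYZ0 mem' W.gr_ops(2,3))
    \<comment> \<open>replacing \<open>f\<^sub>1\<close> by \<open>g\<^sub>1\<close> one argument at a time leaves one argument of the form \<open>m\<^sub>1 k\<close> in each
        new term\<close>
    have m3: "br3 W X Y Z =
        br3 W (f1 x) (f1 y) (f1 z) + br3 W (f1 x) (f1 y) (br1 W (\<theta> z))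
        + br3 W (f1 x) (br1 W (\<theta> y)) Z + br3 W (br1 W (\<theta> x)) Y Z"
      by (simp add: XYZ ops)
    have m3': "br3 W (f1 x) (f1 y) (br1 W (\<theta> z)) = br2 W (f1 x) (br2 W (f1 y) (\<theta> z))
        - br2 W (f1 y) (br2 W (f1 x) (\<theta> z)) - br2 W (br2 W (f1 x) (f1 y)) (\<theta> z)"
      "br3 W (f1 x) (br1 W (\<theta> y)) Z = br2 W (f1 x) (br2 W (\<theta> y) Z)
        - br2 W (\<theta> y) (br2 W (f1 x) Z) - br2 W (br2 W (f1 x) (\<theta> y)) Z"
      "br3 W (br1 W (\<theta> x)) Y Z = br2 W (\<theta> x) (br2 W Y Z)
        - br2 W Y (br2 W (\<theta> x) Z) - br2 W (br2 W (\<theta> x) Y) Z"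
      by (simp_all add: mem' XYZ0 W.br_identities(5-7))
    have q: "br2 W (\<theta> y) (br2 W (f1 x) Z) = br2 W (\<theta> y) (br2 W (f1 x) (f1 z))
        + br2 W (br1 W (\<theta> y)) (br2 W (f1 x) (\<theta> z))"
      by (simp add: XYZ ops mem' W.br_identities(1,3))
    \<comment> \<open>the axiom for \<open>m\<^sub>2(g\<^sub>1 y, g\<^sub>1 z)\<close> is already available as \<open>g2\<close>\<close>
    have p: "br2 W (\<theta> x) (br2 W Y Z) + br2 W (br1 W (\<theta> x)) Q
        = br2 W (\<theta> x) (f1 (br2 V y z) + br1 W (\<theta> (br2 V y z)))"
    proof -
      have "br2 W (br1 W (\<theta> x)) Q = br2 W (\<theta> x) (br1 W Q)"
        by (rule W.br_identities(3)[OF _ Q1]) (simp add: mem')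
      moreover have "br2 W Y Z + br1 W Q = f1 (br2 V y z) + br1 W (\<theta> (br2 V y z))"
        using g2[of y z] x by (simp only: g1 PQR[symmetric]) (simp add: mem' V.br_gr_low(1) ops)
      ultimately show ?thesis by (simp only: W.br_ops(5)[symmetric])
    qed
    have f2XYZ: "br2 W (f2 x y) Z = br2 W (f2 x y) (f1 z) + br2 W (br1 W (f2 x y)) (\<theta> z)"
      "br2 W Y (f2 x z) = br2 W (f1 y) (f2 x z) + br2 W (\<theta> y) (br1 W (f2 x z))"
      "br2 W Y (\<theta> (br2 V x z)) = br2 W (f1 y) (\<theta> (br2 V x z)) + br2 W (\<theta> y) (br1 W (\<theta> (br2 V x z)))"
      "br2 W Y (br2 W (f1 x) (\<theta> z)) = br2 W (f1 y) (br2 W (f1 x) (\<theta> z))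
          + br2 W (br1 W (\<theta> y)) (br2 W (f1 x) (\<theta> z))"
      by (simp_all add: XYZ ops mem' W.br_identities(3))
    have PQR': "br2 W P Z = br2 W (f2 x y) Z + br2 W (\<theta> (br2 V x y)) Z - br2 W (br2 W (f1 x) (\<theta> y)) Z
        - br2 W (br2 W (\<theta> x) Y) Z"
      "br2 W X Q = br2 W (f1 x) (f2 y z) + br2 W (f1 x) (\<theta> (br2 V y z)) - br2 W (f1 x) (br2 W (f1 y) (\<theta> z))
          - br2 W (f1 x) (br2 W (\<theta> y) Z)
        + br2 W (br1 W (\<theta> x)) Q"
      "br2 W Y R = br2 W Y (f2 x z) + br2 W Y (\<theta> (br2 V x z)) - br2 W Y (br2 W (f1 x) (\<theta> z))
          - br2 W Y (br2 W (\<theta> x) Z)"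
    proof -
      show "br2 W P Z = br2 W (f2 x y) Z + br2 W (\<theta> (br2 V x y)) Z - br2 W (br2 W (f1 x) (\<theta> y)) Z
          - br2 W (br2 W (\<theta> x) Y) Z"
        by (simp only: PQR XYZ(2)[symmetric] W.br_ops)
      have "br2 W X Q = br2 W (f1 x) Q + br2 W (br1 W (\<theta> x)) Q" by (simp only: XYZ(1) W.br_ops)
      also have "br2 W (f1 x) Q = br2 W (f1 x) (f2 y z) + br2 W (f1 x) (\<theta> (br2 V y z))
          - br2 W (f1 x) (br2 W (f1 y) (\<theta> z)) - br2 W (f1 x) (br2 W (\<theta> y) Z)"
        by (simp only: PQR XYZ(3)[symmetric] W.br_ops)
      finally show "br2 W X Q = \<dots> + br2 W (br1 W (\<theta> x)) Q" .
      show "br2 W Y R = br2 W Y (f2 x z) + br2 W Y (\<theta> (br2 V x z)) - br2 W Y (br2 W (f1 x) (\<theta> z))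
          - br2 W Y (br2 W (\<theta> x) Z)"
        by (simp only: PQR XYZ(3)[symmetric] W.br_ops)
    qed
    have "br3 W X Y Z - br2 W P Z + br2 W X Q - br2 W Y R
      = br3 W (f1 x) (f1 y) (f1 z) - br2 W (f2 x y) (f1 z) - br2 W (f1 y) (f2 x z) + br2 W (f1 x) (f2 y z)
        - br2 W (f1 (br2 V x y)) (\<theta> z) - br2 W (\<theta> y) (f1 (br2 V x z) + br1 W (\<theta> (br2 V x z)))
        - br2 W (f1 y) (\<theta> (br2 V x z)) + br2 W (f1 x) (\<theta> (br2 V y z)) - br2 W (\<theta> (br2 V x y)) Z
        + br2 W (\<theta> x) (f1 (br2 V y z) + br1 W (\<theta> (br2 V y z)))"
      unfolding m3 m3' q PQR' f2XYZ eqs(2)[OF x(1,2)] eqs(2)[OF x(1,3)] W.br_ops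
      using p by (simp add: algebra_simps W.br_ops)
    also have "\<dots> = ?g1 (br3 V x y z) + ?g2 (br2 V x y) z - ?g2 x (br2 V y z) + ?g2 y (br2 V x z)"
    proof -
      have "?g1 (br3 V x y z) = f1 (br3 V x y z) + \<theta> (br2 V x (br2 V y z)) - \<theta> (br2 V y (br2 V x z))
          - \<theta> (br2 V (br2 V x y) z)"
        by (simp add: x V.br_gr_low(7) deg'(2) V.br_identities(4) linear_ops[OF lin] W.br_ops(3))
      then show ?thesis
        unfolding eqs(5)[OF x] XYZ(3)[symmetric] by (simp add: algebra_simps)
    qed
    finally show ?thesis by (simp only: g1 PQR)
  qed
  show ?thesis
    unfolding g
  proof (rule infinity_morphismI)
    show "lin ?g1" by (rule g_lin)
    show "\<And>u. lin (?g2 u)" by (rule g_lin)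
    show "\<And>v. lin (\<lambda>u. ?g2 u v)" by (rule g_lin)
  qed (erule (1) g1_gr g2_gr m1 g2 m2 m3 | erule g1_gr m1 | erule (2) m3)+
qed

end

section \<open>The coderivation on short words\<close>

lemma tensor_sgn_short:
  "tensor_sgn [a] [b] = 1"
  "tensor_sgn [a1, a2] [b1, b2] = psgn (a2 * b1)"
  "tensor_sgn [a1, a2, a3] [b1, b2, b3] = psgn (a2 * b1) * psgn (a3 * b1) * psgn (a3 * b2)"
proof -
  show "tensor_sgn [a] [b] = 1" by (auto simp: tensor_sgn_def intro!: prod.neutral)
  have "{(i, j). j < i \<and> i < Suc (Suc 0)} = {(1, 0)}"
    "{(i, j). j < i \<and> i < Suc (Suc (Suc 0))} = {(1, 0), (2, 0), (2, 1)}"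
    by auto
  then show "tensor_sgn [a1, a2] [b1, b2] = psgn (a2 * b1)"
    "tensor_sgn [a1, a2, a3] [b1, b2, b3] = psgn (a2 * b1) * psgn (a3 * b1) * psgn (a3 * b2)"
    by (simp_all add: tensor_sgn_def numeral_2_eq_2 mult.assoc del: less_Suc0 less_Suc_eq_0_disj)
qed

lemma zin_delta_short:
  "zin_delta V [a] = 0"
  "zin_delta V [a, b] = Poly_Mapping.single ([a], [b]) 1"
  "zin_delta V [a, b, c] = Poly_Mapping.single ([a], [b, c]) 1
      + Poly_Mapping.single ([b], [a, c]) (psgn ((ldeg V a + 1) * (ldeg V b + 1)))
    + Poly_Mapping.single ([a, b], [c]) 1"
  by (simp_all add: zin_delta_eq Defs.delta_def Defs.unsh_def lx_simps algebra_simps)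

lemma keys_zin_delta:
  assumes "(a, b) \<in> Poly_Mapping.keys (zin_delta V w :: _ \<Rightarrow>\<^sub>0 'k::field)"
  shows "mset a + mset b = mset w" "a \<noteq> []" "b \<noteq> []"
proof -
  let ?d = "\<lambda>v. ldeg V v + 1"
  have w: "w \<noteq> []" using assms by (auto simp: zin_delta_eq Defs.delta_def)
  with assms obtain x where "x \<in> Poly_Mapping.keys (Defs.unsh ?d (butlast w) :: _ \<Rightarrow>\<^sub>0 'k)"
    "(a, b) \<in> Poly_Mapping.keys ((\<lambda>(a, b). if a = [] then 0 else Poly_Mapping.single (a, b @ [last w]) (1 ::
        'k)) x)"
    unfolding zin_delta_eq Defs.delta_def using keys_lx by fastforce
  then have "(a, butlast b) \<in> Poly_Mapping.keys (Defs.unsh ?d (butlast w) :: _ \<Rightarrow>\<^sub>0 'k)"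
    and ab: "a \<noteq> []" "b = butlast b @ [last w]"
    by (auto split: if_splits prod.splits)
  from keys_unsh[OF this(1)] have "mset a + (mset (butlast b) + {#last w#}) = mset (butlast w) + {#last w#}"
    by simp
  also have "\<dots> = mset w" using w by (metis append_butlast_last_id mset.simps mset_append
      union_mset_add_mset_right)
  also have "mset (butlast b) + {#last w#} = mset b"
    by (subst (2) ab(2)) simp
  finally show "mset a + mset b = mset w" .
  show "a \<noteq> []" "b \<noteq> []" using ab by auto
qed

text \<open>Identities in the Zinbiel coalgebra hold modulo the multilinearity relations, so they are
  tested against functionals that are linear in each letter; these descend to the quotient.\<close>

lemma fext_tensor_rels:
  assumes "vector_space t" "\<And>c. c \<in> C \<Longrightarrow> Vector_Spaces.linear s t (\<lambda>v. F (c v))" "r \<in> tensor_rels s C"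
  shows "fext t F r = 0"
proof -
  interpret f: vector_space fscale by (rule vs_fscale)
  interpret t: vector_space t by (rule assms(1))
  note F = fext_add[OF assms(1)] fext_diff[OF assms(1)] fext_fscale[OF assms(1)] fext_single[OF assms(1)]
      fext_0[OF assms(1)]
  have "r \<in> {r. fext t F r = 0}"
    using assms(3) unfolding tensor_rels_def
  proof (rule f.span_minimal[THEN subsetD, rotated 2])
    show "f.subspace {r. fext t F r = 0}" by (rule f.subspaceI) (simp_all add: F)
  qed (auto simp: F linear_ops[OF assms(2)] linear_scale[OF assms(2)])
  then show ?thesis by simp
qed

context leibniz2_pair
begin

lemmas fextW = fext_0[OF W.vs.vector_space_axioms] fext_single[OF W.vs.vector_space_axioms]
  fext_add[OF W.vs.vector_space_axioms] fext_fscale[OF W.vs.vector_space_axioms]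
  fext_diff[OF W.vs.vector_space_axioms]

text \<open>The sign of \<open>s\<^bsup>\<otimes>p\<^esup>\<close> applied to a word, by which the corestriction of \<open>D\<close> differs from the
  bracket.\<close>

definition susp_sgn :: "'v list \<Rightarrow> 'k" where
  "susp_sgn w = tensor_sgn (replicate (length w) 1) (map (ldeg V) w)"

lemma susp_sgn_sq: "susp_sgn w * susp_sgn w = 1"
  unfolding susp_sgn_def tensor_sgn_def prod.distrib[symmetric] by (rule prod.neutral) auto

lemma keys_zin_D:
  assumes "w \<in> hwords V" "u \<in> Poly_Mapping.keys (zin_D V w)"
  shows "u \<in> hwords V" "wdeg V u = wdeg V w - 1"
  using zin_D_ok(1)[OF V.leibniz] assms unfolding coderivation_def by blast+

lemma zin_D_letters:
  assumes "w \<in> hwords V" "lin F"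
  shows "fext (scl W) (\<lambda>u. if length u = 1 then F (hd u) else 0) (zin_D V w)
    = scl W (susp_sgn w) (F (bracket V w))"
proof -
  let ?p = "fext (scl V) (\<lambda>u. if length u = 1 then hd u else 0) (zin_D V w)"
  have "bracket V w = scl V (susp_sgn w) ?p"
    using zin_D_ok(2)[OF V.leibniz] assms(1) unfolding corestrictions_def susp_sgn_def by blast
  then have "F ?p = scl W (susp_sgn w) (F (bracket V w))"
    by (simp add: linear_scale[OF assms(2)] susp_sgn_sq)
  moreover have "F ?p = fext (scl W) (\<lambda>u. if length u = 1 then F (hd u) else 0) (zin_D V w)"
    unfolding fext_def by (auto simp: linear_sum[OF assms(2)] linear_scale[OF assms(2)] linear_ops[OF
        assms(2)] intro!: sum.cong)
  ultimately show ?thesis by simp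
qed

text \<open>The two-letter part of \<open>D w\<close>. A two-letter word \<open>[x, y]\<close> is recovered from its
  comultiplication \<open>[x] \<otimes> [y]\<close>, and the comultiplication of \<open>D w\<close> is computed by the coderivation
  identity. Only those terms count in which \<open>D\<close> is projected to a single letter, and there it is a
  bracket.\<close>

lemma zin_D_pairs:
  assumes w: "w \<in> hwords V" and \<Phi>: "\<And>u. lin (\<Phi> u)" "\<And>v. lin (\<lambda>u. \<Phi> u v)"
  shows "fext (scl W) (\<lambda>u. if length u = 2 then \<Phi> (u ! 0) (u ! 1) else 0) (zin_D V w)
    = fext (scl W) (\<lambda>(a, b). (if length b = 1 then scl W (susp_sgn a) (\<Phi> (bracket V a) (hd b)) else 0)
        + (if length a = 1 then scl W (psgn (wdeg V a) * susp_sgn b) (\<Phi> (hd a) (bracket V b)) else 0))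
      (zin_delta V w)"
proof -
  have VS: "vector_space (scl W)" by (rule W.vs.vector_space_axioms)
  \<comment> \<open>read off the coefficient of a pair of single letters; applied to \<open>zin_delta V u\<close> this sees \<open>u\<close> only if it
      has two letters\<close>
  let ?\<Psi> = "\<lambda>(a, b). if length a = 1 \<and> length b = 1 then \<Phi> (hd a) (hd b) else 0"
  have \<Psi>_delta: "fext (scl W) ?\<Psi> (zin_delta V u) = (if length u = 2 then \<Phi> (u ! 0) (u ! 1) else 0)" for u
  proof (cases "length u = 2")
    case True
    then obtain x y where "u = [x, y]" by (auto simp: numeral_2_eq_2 length_Suc_conv)
    then show ?thesis by (simp add: zin_delta_short fextW)
  next
    case False
    have "fext (scl W) ?\<Psi> (zin_delta V u) = fext (scl W) (\<lambda>_. 0) (zin_delta V u)"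
    proof (intro fext_cong[OF VS refl], clarsimp)
      fix a b assume "(a, b) \<in> Poly_Mapping.keys (zin_delta V u :: _ \<Rightarrow>\<^sub>0 'k)" "length a = Suc 0" "length b
          = Suc 0"
      then have "length u = 2" using arg_cong[OF keys_zin_delta(1), of a b V u size] by simp
      with False show "\<Phi> (hd a) (hd b) = 0" by simp
    qed
    then show ?thesis using False by (simp add: fext_zero_fun[OF VS])
  qed
  have slots: "lin (\<lambda>v. ?\<Psi> (c v))" if "c \<in> pair_slots" for c
  proof -
    have Z: "lin (\<lambda>v. 0)" by (simp add: lin_iff)
    consider us vs' w where "c = (\<lambda>v. (us @ v # vs', w))" | us vs' w where "c = (\<lambda>v. (w, us @ v # vs'))"
      using \<open>c \<in> pair_slots\<close> unfolding pair_slots_def by blast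
    then show ?thesis
    proof cases
      case 1
      then show ?thesis using Z \<Phi> by (cases "us = [] \<and> vs' = [] \<and> length w = 1") auto
    next
      case 2
      then show ?thesis using Z \<Phi> by (cases "us = [] \<and> vs' = [] \<and> length w = 1") auto
    qed
  qed
  let ?T = "\<lambda>(a, b). fext fscale (\<lambda>a'. Poly_Mapping.single (a', b) 1) (zin_D V a)
      + fscale (psgn (wdeg V a)) (fext fscale (\<lambda>b'. Poly_Mapping.single (a, b') 1) (zin_D V b))"
  have "fext fscale (zin_delta V) (zin_D V w) - fext fscale ?T (zin_delta V w) \<in> tensor_rels (scl V) pair_slots"
    using zin_D_ok(1)[OF V.leibniz] w unfolding coderivation_def by blast
  from fext_tensor_rels[OF VS slots this]
  have "fext (scl W) ?\<Psi> (fext fscale (zin_delta V) (zin_D V w))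
      = fext (scl W) ?\<Psi> (fext fscale ?T (zin_delta V w))"
    by (simp add: fextW)
  then have "fext (scl W) (\<lambda>u. if length u = 2 then \<Phi> (u ! 0) (u ! 1) else 0) (zin_D V w)
     = fext (scl W) (\<lambda>x. fext (scl W) ?\<Psi> (?T x)) (zin_delta V w)"
    by (simp only: fext_comp[OF VS] \<Psi>_delta)
  also have "\<dots> = fext (scl W) (\<lambda>(a, b). (if length b = 1 then scl W (susp_sgn a) (\<Phi> (bracket V a) (hd b)) else
      0)
        + (if length a = 1 then scl W (psgn (wdeg V a) * susp_sgn b) (\<Phi> (hd a) (bracket V b)) else 0))
      (zin_delta V w)"
  proof (intro fext_cong[OF VS refl], clarsimp simp only: split_paired_all prod.case)
    fix a b assume ab: "(a, b) \<in> Poly_Mapping.keys (zin_delta V w :: _ \<Rightarrow>\<^sub>0 'k)"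
    from keys_zin_delta[OF ab] have "set a \<union> set b = set w" "a \<noteq> []" "b \<noteq> []"
      by (metis set_mset_mset set_mset_union)+
    then have h: "a \<in> hwords V" "b \<in> hwords V" using w by (auto simp: hwords_def)
    have "fext (scl W) (\<lambda>a'. ?\<Psi> (a', b)) (zin_D V a)
        = (if length b = 1 then scl W (susp_sgn a) (\<Phi> (bracket V a) (hd b)) else 0)"
      using zin_D_letters[OF h(1) \<Phi>(2)[of "hd b"]] by (simp add: fext_zero_fun[OF VS])
    moreover have "fext (scl W) (\<lambda>b'. ?\<Psi> (a, b')) (zin_D V b)
        = (if length a = 1 then scl W (susp_sgn b) (\<Phi> (hd a) (bracket V b)) else 0)"
      using zin_D_letters[OF h(2) \<Phi>(1)[of "hd a"]] by (simp add: fext_zero_fun[OF VS])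
    ultimately show "fext (scl W) ?\<Psi> (fext fscale (\<lambda>a'. Poly_Mapping.single (a', b) 1) (zin_D V a)
        + fscale (psgn (wdeg V a)) (fext fscale (\<lambda>b'. Poly_Mapping.single (a, b') 1) (zin_D V b)))
        = (if length b = 1 then scl W (susp_sgn a) (\<Phi> (bracket V a) (hd b)) else 0)
        + (if length a = 1 then scl W (psgn (wdeg V a) * susp_sgn b) (\<Phi> (hd a) (bracket V b)) else 0)"
      by (simp add: fextW fext_comp[OF VS])
  qed
  finally show ?thesis .
qed

end

section \<open>The convolution brackets on short words\<close>

lemma sum_permutes_2:
  fixes G :: "(nat \<Rightarrow> nat) \<Rightarrow> 'a::ab_group_add"
  shows "(\<Sum>\<sigma> | \<sigma> permutes {..<2}. G \<sigma>) = G id + G (Transposition.transpose 0 1)"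
proof -
  have "{..<2::nat} = insert 0 {1}" by auto
  then show ?thesis by (simp add: sum_over_permutations_insert)
qed

lemma sum_permutes_3:
  fixes G :: "(nat \<Rightarrow> nat) \<Rightarrow> 'a::ab_group_add"
  shows "(\<Sum>\<sigma> | \<sigma> permutes {..<3}. G \<sigma>) = 
    G id + G (Transposition.transpose 1 2)
    + (G (Transposition.transpose 0 1) + G (Transposition.transpose 0 1 \<circ> Transposition.transpose 1 2))
    + (G (Transposition.transpose 0 2) + G (Transposition.transpose 0 2 \<circ> Transposition.transpose 1 2))"
proof -
  have "{..<3::nat} = insert 0 {1, 2}" by auto
  then show ?thesis by (simp add: sum_over_permutations_insert)
qed

lemma koszul_2: "koszul 2 d \<sigma> = (if \<sigma> 1 < \<sigma> 0 then psgn (d (\<sigma> 0) * d (\<sigma> 1)) else 1)"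
proof -
  have "{(i, j). i < j \<and> j < (2::nat) \<and> \<sigma> j < \<sigma> i} = (if \<sigma> 1 < \<sigma> 0 then {(0, 1)} else {})"
    by (auto simp: less_2_cases_iff)
  then show ?thesis by (simp add: koszul_def)
qed

lemma koszul_3:
  "koszul 3 d \<sigma> = (if \<sigma> 1 < \<sigma> 0 then psgn (d (\<sigma> 0) * d (\<sigma> 1)) else 1)
    * (if \<sigma> 2 < \<sigma> 0 then psgn (d (\<sigma> 0) * d (\<sigma> 2)) else 1)
    * (if \<sigma> 2 < \<sigma> 1 then psgn (d (\<sigma> 1) * d (\<sigma> 2)) else 1)"
proof -
  have "{(i, j). i < j \<and> j < (3::nat) \<and> \<sigma> j < \<sigma> i} =
    (if \<sigma> 1 < \<sigma> 0 then {(0, 1)} else {}) \<union> ((if \<sigma> 2 < \<sigma> 0 then {(0, 2)} else {}) \<union> (if \<sigma> 2 < \<sigma> 1 then {(1, 2)}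
        else {}))"
    by (auto simp: less_Suc_eq numeral_3_eq_3 numeral_2_eq_2)
  then show ?thesis by (auto simp: koszul_def)
qed

lemma zin_delta_iter_1: "zin_delta_iter V 1 w = fext fscale (\<lambda>(a, b). Poly_Mapping.single [a, b] 1) (zin_delta
    V w)"
  by (simp add: lx_simps)

lemma zin_delta_iter_2_short:
  "zin_delta_iter V 2 [a] = 0"
  "zin_delta_iter V 2 [a, b] = 0"
  "zin_delta_iter V 2 [a, b, c] = Poly_Mapping.single [[a], [b], [c]] 1"
  by (simp_all add: numeral_2_eq_2 lx_simps zin_delta_short)

lemma psgn_simps: "psgn 1 = (- 1 :: 'k::field)" "psgn (- n) = (psgn n :: 'k)"
  by (simp_all add: psgn_def)

lemma wdeg_simps: "wdeg V [] = 0" "wdeg V (v # w) = ldeg V v + 1 + wdeg V w"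
  by (simp_all add: wdeg_def)

lemma wdeg_mset: "mset u = mset w \<Longrightarrow> wdeg V u = wdeg V w"
  unfolding wdeg_def by (metis mset_map sum_mset_sum_list)

lemma wdeg_append: "wdeg V (u @ w) = wdeg V u + wdeg V w"
  by (simp add: wdeg_def)

lemma keys_zin_delta_hwords:
  assumes "(a, b) \<in> Poly_Mapping.keys (zin_delta V w :: _ \<Rightarrow>\<^sub>0 'k::field)" "w \<in> hwords V"
  shows "a \<in> hwords V" "b \<in> hwords V" "wdeg V a + wdeg V b = wdeg V w"
proof -
  have ab: "mset (a @ b) = mset w" "a \<noteq> []" "b \<noteq> []" using keys_zin_delta[OF assms(1)] by simp_all
  from mset_eq_setD[OF ab(1)] have "set a \<union> set b = set w" by simp
  then show "a \<in> hwords V" "b \<in> hwords V" using ab assms(2) by (auto simp: hwords_def)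
  show "wdeg V a + wdeg V b = wdeg V w" using wdeg_mset[OF ab(1)] by (simp add: wdeg_append)
qed

lemma keys_zin_delta_iter:
  assumes "ws \<in> Poly_Mapping.keys (zin_delta_iter V n w :: _ \<Rightarrow>\<^sub>0 'k::field)" "w \<in> hwords V"
  shows "length ws = Suc n \<and> set ws \<subseteq> hwords V \<and> sum_list (map (wdeg V) ws) = wdeg V w"
  using assms(1)
proof (induction n arbitrary: ws)
  case 0
  then show ?case using assms(2) by simp
next
  case (Suc n)
  then obtain us where us: "us \<in> Poly_Mapping.keys (zin_delta_iter V n w :: _ \<Rightarrow>\<^sub>0 'k)"
    "ws \<in> Poly_Mapping.keys (fext fscale (\<lambda>(a, b). Poly_Mapping.single (a # b # tl us) 1) (zin_delta V (hd
        us)) :: _ \<Rightarrow>\<^sub>0 'k)"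
    using keys_lx by fastforce
  then obtain a b where ab: "(a, b) \<in> Poly_Mapping.keys (zin_delta V (hd us) :: _ \<Rightarrow>\<^sub>0 'k)" "ws = a # b # tl us"
    using keys_lx[of "\<lambda>(a, b). Poly_Mapping.single (a # b # tl us) (1 :: 'k)" "zin_delta V (hd us)"]
    by (auto split: prod.splits if_splits)
  from Suc.IH[OF us(1)] obtain u us' where u: "us = u # us'" by (cases us) auto
  with Suc.IH[OF us(1)] keys_zin_delta_hwords[of a b V u] ab show ?case by auto
qed

context leibniz2_pair
begin

lemma ldeg_simps: "x \<in> gr V 0 \<Longrightarrow> ldeg V x = 0" "v \<in> gr V 0 \<union> gr V 1 \<Longrightarrow> ldeg V v \<noteq> 0 \<Longrightarrow> ldeg V v = 1 \<and> v \<in> gr V 1"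
  by (auto simp: ldeg_def)

lemma conv_hom_lin:
  assumes "f \<in> conv_hom V W d"
  shows "lin (\<lambda>v. f [v])" "lin (\<lambda>v. f [u, v])" "lin (\<lambda>u. f [u, v])"
proof -
  have "lin (\<lambda>v. f (us @ v # vs))" for us vs using assms by (simp add: conv_hom_def)
  from this[of "[]" "[]"] this[of "[u]" "[]"] this[of "[]" "[v]"]
  show "lin (\<lambda>v. f [v])" "lin (\<lambda>v. f [u, v])" "lin (\<lambda>u. f [u, v])" by simp_all
qed

lemma conv_hom_gr: "f \<in> conv_hom V W d \<Longrightarrow> w \<in> hwords V \<Longrightarrow> f w \<in> gr W (wdeg V w + d)"
  by (simp add: conv_hom_def)

lemma length_wdeg: "w \<in> hwords V \<Longrightarrow> int (length w) \<le> wdeg V w"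
proof -
  assume "w \<in> hwords V"
  have "int (length w) \<le> wdeg V w" for w
    by (induction w) (auto simp: wdeg_simps ldeg_def)
  then show ?thesis .
qed

lemma conv_hom_long:
  assumes "f \<in> conv_hom V W d" "w \<in> hwords V" "wdeg V w + d > 1"
  shows "f w = 0"
  using conv_hom_gr[OF assms(1,2)] assms(3) by (rule_tac W.gr_outside) auto

text \<open>A map of degree \<open>d \<ge> -1\<close> sends words of three or more letters to degree at least 2, hence to
  0. Composed with it, \<open>D\<close> is therefore known from its one- and two-letter parts.\<close>

lemma conv_hom_zin_D:
  assumes f: "f \<in> conv_hom V W d" and d: "- 1 \<le> d" and w: "w \<in> hwords V"
  shows "fext (scl W) f (zin_D V w) = scl W (susp_sgn w) (f [bracket V w])
    + fext (scl W) (\<lambda>(a, b). (if length b = 1 then scl W (susp_sgn a) (f [bracket V a, hd b]) else 0)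
        + (if length a = 1 then scl W (psgn (wdeg V a) * susp_sgn b) (f [hd a, bracket V b]) else 0))
      (zin_delta V w)"
proof -
  have VS: "vector_space (scl W)" by (rule W.vs.vector_space_axioms)
  have "fext (scl W) f (zin_D V w) = fext (scl W) (\<lambda>u. (if length u = 1 then f [hd u] else 0)
      + (if length u = 2 then f [u ! 0, u ! 1] else 0)) (zin_D V w)"
  proof (rule fext_cong[OF VS refl])
    fix u assume "u \<in> Poly_Mapping.keys (zin_D V w)"
    then have u: "u \<in> hwords V" by (rule keys_zin_D[OF w])
    consider "length u = 1" | "length u = 2" | "length u \<ge> 3"
      using u by (cases u rule: remdups_adj.cases) (auto simp: hwords_def Suc_le_eq)
    then show "f u = (if length u = 1 then f [hd u] else 0) + (if length u = 2 then f [u ! 0, u ! 1] else 0)"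
    proof cases
      case 3
      then show ?thesis using conv_hom_long[OF f u] length_wdeg[OF u] d by simp
    qed (auto simp: length_Suc_conv numeral_2_eq_2)
  qed
  then show ?thesis
    by (simp only: fext_add_fun[OF VS] zin_D_letters[OF w conv_hom_lin(1)[OF f]]
        zin_D_pairs[OF w, of "\<lambda>x y. f [x, y]", OF conv_hom_lin(2,3)[OF f]])
qed

lemma conv_hom_zin_D_short:
  assumes f: "f \<in> conv_hom V W d" and d: "- 1 \<le> d"
  shows "[u] \<in> hwords V \<Longrightarrow> fext (scl W) f (zin_D V [u]) = f [br1 V u]"
    "[u, v] \<in> hwords V \<Longrightarrow> fext (scl W) f (zin_D V [u, v]) =
      scl W (psgn (ldeg V u)) (f [br2 V u v]) + (f [br1 V u, v] + scl W (psgn (ldeg V u + 1)) (f [u, br1 V v]))"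
    "x \<in> gr V 0 \<Longrightarrow> y \<in> gr V 0 \<Longrightarrow> z \<in> gr V 0 \<Longrightarrow> fext (scl W) f (zin_D V [x, y, z]) =
      f [br3 V x y z] + f [br2 V x y, z] - f [x, br2 V y z] + f [y, br2 V x z]"
proof -
  note simps = conv_hom_zin_D[OF f d] zin_delta_short fextW susp_sgn_def tensor_sgn_short wdeg_simps
      ldeg_simps(1) psgn_def[of 1]
  show "[u] \<in> hwords V \<Longrightarrow> fext (scl W) f (zin_D V [u]) = f [br1 V u]"
    by (simp add: simps)
  show "[u, v] \<in> hwords V \<Longrightarrow> fext (scl W) f (zin_D V [u, v]) =
      scl W (psgn (ldeg V u)) (f [br2 V u v]) + (f [br1 V u, v] + scl W (psgn (ldeg V u + 1)) (f [u, br1 V v]))"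
    by (simp add: simps)
  show "x \<in> gr V 0 \<Longrightarrow> y \<in> gr V 0 \<Longrightarrow> z \<in> gr V 0 \<Longrightarrow> fext (scl W) f (zin_D V [x, y, z]) =
      f [br3 V x y z] + f [br2 V x y, z] - f [x, br2 V y z] + f [y, br2 V x z]"
    using conv_hom_zin_D[OF f d, of "[x, y, z]"]
    by (simp add: simps hwords_def)
qed

lemma conv_bracket_1:
  "conv_bracket V W [d] [f] w = br1 W (f w) + scl W (psgn d) (fext (scl W) f (zin_D V w))"
  by (simp add: conv_bracket_def)

lemma conv_bracket_2:
  "conv_bracket V W [d1, d2] [f, g] w = fext (scl W) (\<lambda>(a, b).
     scl W (psgn (d2 * wdeg V a)) (br2 W (f a) (g b))
     - scl W (psgn (d1 * d2) * psgn (d1 * wdeg V a)) (br2 W (g a) (f b))) (zin_delta V w)"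
  unfolding conv_bracket_def
  by (simp add: zin_delta_iter_1[unfolded One_nat_def] fext_comp[OF W.vs.vector_space_axioms] fextW
      sum_permutes_2[unfolded One_nat_def]
     koszul_2 tensor_sgn_short upt_rec sign_swap_id split_def numeral_2_eq_2[symmetric] W.vs.scale_minus_left
         mult.commute[of d2 d1]
     del: zin_delta_iter.simps)

text \<open>For three arguments of degree \<open>-1\<close> the Koszul sign of a permutation cancels its signature, so
  all six orders enter with the same sign. Words of one or two letters have no iterated
  comultiplication.\<close>

lemma conv_bracket_3:
  "conv_bracket V W [- 1, - 1, - 1] [f, g, h] [x, y, z] = scl W (psgn (wdeg V [y]))
    (br3 W (f [x]) (g [y]) (h [z]) + br3 W (f [x]) (h [y]) (g [z]) + (br3 W (g [x]) (f [y]) (h [z])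
     + br3 W (g [x]) (h [y]) (f [z])) + (br3 W (h [x]) (g [y]) (f [z]) + br3 W (h [x]) (f [y]) (g [z])))"
  "conv_bracket V W [d1, d2, d3] [f, g, h] [x] = 0"
  "conv_bracket V W [d1, d2, d3] [f, g, h] [x, y] = 0"
proof -
  have *: "conv_bracket V W [d1, d2, d3] [f, g, h] w = fext (scl W)
       (\<lambda>ws. \<Sum>\<sigma> | \<sigma> permutes {..<3}.
          scl W (koszul 3 (\<lambda>i. [d1, d2, d3] ! i) \<sigma> * of_int (sign \<sigma>)
                 * tensor_sgn (map (\<lambda>i. [d1, d2, d3] ! \<sigma> i) [0..<3]) (map (wdeg V) ws))
            (bracket W (map (\<lambda>i. ([f, g, h] ! \<sigma> i) (ws ! i)) [0..<3])))
       (zin_delta_iter V 2 w)" for d1 d2 d3 w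
    by (simp only: conv_bracket_def Let_def) (simp add: numeral_3_eq_3 numeral_2_eq_2 del:
        zin_delta_iter.simps upt_Suc)
  have [simp]: "[0..<3] = [0, 1, 2]" by (simp add: upt_rec)
  show "conv_bracket V W [d1, d2, d3] [f, g, h] [x] = 0" "conv_bracket V W [d1, d2, d3] [f, g, h] [x, y] = 0"
    by (simp_all add: * zin_delta_iter_2_short fextW)
  show "conv_bracket V W [- 1, - 1, - 1] [f, g, h] [x, y, z] = scl W (psgn (wdeg V [y]))
    (br3 W (f [x]) (g [y]) (h [z]) + br3 W (f [x]) (h [y]) (g [z]) + (br3 W (g [x]) (f [y]) (h [z])
     + br3 W (g [x]) (h [y]) (f [z])) + (br3 W (h [x]) (g [y]) (f [z]) + br3 W (h [x]) (f [y]) (g [z])))"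
    unfolding * zin_delta_iter_2_short fextW sum_permutes_3
    by (simp add: koszul_3 tensor_sgn_short sign_swap_id sign_compose permutation_swap_id
     Transposition.transpose_def psgn_simps W.vs.scale_right_distrib)
qed

section \<open>Degrees and Maurer-Cartan elements\<close>

lemma bracket_gr:
  assumes "length us = length es" "us \<noteq> []" "\<forall>i<length us. us ! i \<in> gr W (es ! i)"
  shows "bracket W us \<in> gr W (sum_list es + int (length us) - 2)"
proof -
  consider "length us = 1" | "length us = 2" | "length us = 3" | "length us > 3"
    using assms(2) unfolding length_0_conv[symmetric] by linarith
  then show ?thesis
  proof cases
    case 1
    then obtain u e where "us = [u]" "es = [e]" using assms(1) by (auto simp: length_Suc_conv)
    then show ?thesis using assms W.br_gr(1)[of u e] by simp
  next
    case 2
    then obtain u v e e' where "us = [u, v]" "es = [e, e']"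
      using assms(1) by (auto simp: length_Suc_conv numeral_2_eq_2)
    then show ?thesis using assms(3) W.br_gr(2)[of u e v e'] by (simp add: All_less_Suc)
  next
    case 3
    then obtain u v w e e' e'' where "us = [u, v, w]" "es = [e, e', e'']"
      using assms(1) by (auto simp: length_Suc_conv numeral_3_eq_3)
    then show ?thesis using assms(3) W.br_gr(3)[of u e v e' w e''] by (simp add: All_less_Suc ac_simps)
  next
    case 4
    then show ?thesis using bracket_long[OF W.leibniz] W.gr_ops by simp
  qed
qed

lemma gr_sum: "(\<And>i. i \<in> I \<Longrightarrow> F i \<in> gr W d) \<Longrightarrow> sum F I \<in> gr W d"
  using W.gr_ops gr_sub[OF W.leibniz] by (intro W.vs.subspace_sum) auto

lemma gr_fext: "(\<And>x. x \<in> Poly_Mapping.keys a \<Longrightarrow> F x \<in> gr W d) \<Longrightarrow> fext (scl W) F a \<in> gr W d"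
  unfolding fext_def by (intro gr_sum W.gr_ops(4))

text \<open>The bracket \<open>\<L>\<^sub>p\<close> has degree \<open>p - 2\<close>. This is what reduces the Maurer-Cartan equation to short
  words.\<close>

lemma conv_bracket_gr:
  assumes len: "length ds = length fs" "fs \<noteq> []"
    and fs: "\<forall>i<length fs. fs ! i \<in> conv_hom V W (ds ! i)" and w: "w \<in> hwords V"
  shows "conv_bracket V W ds fs w \<in> gr W (wdeg V w + sum_list ds + int (length fs) - 2)"
proof (cases "length fs = 1")
  case True
  then obtain f d where fd: "fs = [f]" "ds = [d]" using len by (auto simp: length_Suc_conv)
  then have f: "f \<in> conv_hom V W d" using fs by simp
  have "br1 W (f w) \<in> gr W (wdeg V w + d - 1)" by (rule W.br_gr(1)[OF conv_hom_gr[OF f w]])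
  moreover have "fext (scl W) f (zin_D V w) \<in> gr W (wdeg V w + d - 1)"
  proof (rule gr_fext)
    fix u assume "u \<in> Poly_Mapping.keys (zin_D V w)"
    from keys_zin_D[OF w this] have "u \<in> hwords V" "wdeg V w + d - 1 = wdeg V u + d" by simp_all
    with conv_hom_gr[OF f] show "f u \<in> gr W (wdeg V w + d - 1)" by metis
  qed
  ultimately show ?thesis by (simp add: fd conv_bracket_1 W.gr_ops)
next
  case False
  define p where "p = length fs"
  have p: "Suc (p - 1) = p" using len by (simp add: p_def)
  have "bracket W (map (\<lambda>i. (fs ! \<sigma> i) (ws ! i)) [0..<p]) \<in> gr W (wdeg V w + sum_list ds + int p - 2)"
    if ws: "ws \<in> Poly_Mapping.keys (zin_delta_iter V (p - 1) w :: _ \<Rightarrow>\<^sub>0 'k)" and \<sigma>: "\<sigma> permutes {..<p}" for ws \<sigma>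
  proof -
    from keys_zin_delta_iter[OF ws w] p
    have ws': "length ws = p" "set ws \<subseteq> hwords V" "sum_list (map (wdeg V) ws) = wdeg V w" by auto
    let ?es = "map (\<lambda>i. wdeg V (ws ! i) + ds ! \<sigma> i) [0..<p]"
    have "bracket W (map (\<lambda>i. (fs ! \<sigma> i) (ws ! i)) [0..<p]) \<in>
        gr W (sum_list ?es + int (length (map (\<lambda>i. (fs ! \<sigma> i) (ws ! i)) [0..<p])) - 2)"
    proof (rule bracket_gr)
      show "\<forall>i<length (map (\<lambda>i. (fs ! \<sigma> i) (ws ! i)) [0..<p]).
          map (\<lambda>i. (fs ! \<sigma> i) (ws ! i)) [0..<p] ! i \<in> gr W (?es ! i)"
        using fs ws' permutes_in_image[OF \<sigma>] by (auto simp: p_def intro!: conv_hom_gr)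
    qed (use len in \<open>auto simp: p_def\<close>)
    also have "sum_list ?es = (\<Sum>i<p. wdeg V (ws ! i)) + (\<Sum>i<p. ds ! \<sigma> i)"
      by (simp add: sum_list_distinct_conv_sum_set lessThan_atLeast0 sum.distrib)
    also have "(\<Sum>i<p. ds ! \<sigma> i) = (\<Sum>i<p. ds ! i)"
      using sum.permute[OF \<sigma>, of "\<lambda>i. ds ! i"] by (simp add: comp_def)
    also have "\<dots> = sum_list ds" using len by (simp add: p_def sum_list_sum_nth lessThan_atLeast0)
    also have "(\<Sum>i<p. wdeg V (ws ! i)) = wdeg V w"
      using ws'(1,3) by (simp add: sum_list_sum_nth lessThan_atLeast0)
    finally show ?thesis by simp
  qed
  with False show ?thesis
    unfolding conv_bracket_def Let_def p_def[symmetric] by (auto intro!: gr_fext gr_sum W.gr_ops(4))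
qed

lemma mc_of_hom:
  assumes p: "lin p" and q: "\<And>u. lin (q u)" "\<And>v. lin (\<lambda>u. q u v)"
    and deg_p: "\<And>i u. u \<in> gr V i \<Longrightarrow> p u \<in> gr W (i + 1 + d)"
    and deg_q: "\<And>i j u v. u \<in> gr V i \<Longrightarrow> v \<in> gr V j \<Longrightarrow> q u v \<in> gr W (i + j + 2 + d)"
  shows "mc_of (p, q) \<in> conv_hom V W d"
proof -
  have Z: "lin (\<lambda>v. 0)" by (simp add: lin_iff)
  have "lin (\<lambda>v. mc_of (p, q) (us @ v # vs))" for us vs
  proof -
    consider "us = []" "vs = []" | u where "us = [u]" "vs = []" | v where "us = []" "vs = [v]"
      | "length us + length vs \<ge> 2"
      by (cases us; cases vs; cases "tl us"; cases "tl vs") auto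
    then show ?thesis
    proof cases
      case 4
      then have "mc_of (p, q) (us @ v # vs) = 0" for v
        by (cases "((p, q), us @ v # vs)" rule: mc_of.cases) (auto simp: append_eq_Cons_conv
            Cons_eq_append_conv)
      then show ?thesis using Z by simp
    qed (use p q in simp_all)
  qed
  moreover have "mc_of (p, q) w \<in> gr W (wdeg V w + d)" if "w \<in> hwords V" for w
  proof -
    have *: "v \<in> gr V (ldeg V v)" if "v \<in> gr V 0 \<union> gr V 1" for v using that by (auto simp: ldeg_def)
    show ?thesis
      using that deg_p[OF *] deg_q[OF * *]
      by (cases "((p, q), w)" rule: mc_of.cases) (auto simp: wdeg_simps hwords_def W.gr_ops ac_simps)
  qed
  ultimately show ?thesis by (simp add: conv_hom_def)
qed

lemma mc_of_conv_hom:
  assumes "infinity_morphism V W f" shows "mc_of f \<in> conv_hom V W (- 1)"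
proof -
  note F = infinity_morphism_facts[OF assms]
  have "mc_of (fst f, snd f) \<in> conv_hom V W (- 1)"
    by (rule mc_of_hom) (use F in \<open>simp_all add: add.commute\<close>)
  then show ?thesis by simp
qed

text \<open>These are the words on which an element of degree \<open>-2\<close> can be nonzero; they match the axioms
  of an infinity morphism one by one.\<close>

lemma short_words:
  assumes w: "w \<in> hwords V" and d: "wdeg V w \<in> {2, 3}"
  obtains h where "w = [h]" "h \<in> gr V 1" "ldeg V h = 1"
    | x y where "w = [x, y]" "x \<in> gr V 0" "y \<in> gr V 0"
    | x h where "w = [x, h]" "x \<in> gr V 0" "h \<in> gr V 1" "ldeg V h = 1"
    | x h where "w = [h, x]" "x \<in> gr V 0" "h \<in> gr V 1" "ldeg V h = 1"
    | x y z where "w = [x, y, z]" "x \<in> gr V 0" "y \<in> gr V 0" "z \<in> gr V 0"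
proof -
  have ne: "w \<noteq> []" and hom: "\<forall>v\<in>set w. v \<in> gr V 0 \<and> ldeg V v = 0 \<or> v \<in> gr V 1 \<and> ldeg V v = 1"
    using w by (auto simp: hwords_def ldeg_def)
  have "length w \<le> 3" using length_wdeg[OF w] d by auto
  with ne consider u where "w = [u]" | u v where "w = [u, v]" | x y z where "w = [x, y, z]"
    by (cases w; cases "tl w"; cases "tl (tl w)"; cases "tl (tl (tl w))") auto
  then show ?thesis
  proof cases
    case 1
    then show ?thesis using hom d that(1) by (auto simp: wdeg_simps)
  next
    case (2 u v)
    then show ?thesis using hom d that(2-4) by (auto simp: wdeg_simps)
  next
    case (3 x y z)
    then show ?thesis using hom d that(5) by (auto simp: wdeg_simps)
  qed
qed

text \<open>The left-hand side of the Maurer-Cartan equation; \<open>(-1)\<^bsup>p(p-1)/2\<^esup> / p!\<close> is \<open>1\<close>, \<open>-1/2\<close>, \<open>-1/6\<close>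
  for \<open>p = 1, 2, 3\<close>.\<close>

definition mc_value :: "('v list \<Rightarrow> 'w) \<Rightarrow> 'v list \<Rightarrow> 'w" where
  "mc_value \<alpha> w = conv_bracket V W [- 1] [\<alpha>] w
     - scl W (1 / 2) (conv_bracket V W [- 1, - 1] [\<alpha>, \<alpha>] w)
     - scl W (1 / 6) (conv_bracket V W [- 1, - 1, - 1] [\<alpha>, \<alpha>, \<alpha>] w)"

lemma scale_fractions: "u + u = scl W 2 u" "scl W (1/2) (u + u) = u" "scl W (1/2) (- u - u) = - u"
  "scl W (1 / 3) u + scl W (2 / 3) u = u"
proof -
  show 2: "u + u = scl W 2 u" for u
    using W.vs.scale_left_distrib[of 1 1 u] by simp
  show "scl W (1/2) (u + u) = u" by (simp add: 2)
  show "scl W (1/2) (- u - u) = - u" using 2[of "- u"] by simp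
  show "scl W (1 / 3) u + scl W (2 / 3) u = u"
    using W.vs.scale_left_distrib[of "1 / 3" "2 / 3" u] by simp
qed

text \<open>On each kind of short word the Maurer-Cartan equation is one of the axioms, up to sign. The
  factors \<open>1/2\<close> and \<open>1/6\<close> disappear because the symmetrized brackets contain \<open>m\<^sub>2\<close> and \<open>m\<^sub>3\<close> with
  multiplicity 2 and 6.\<close>

lemma mc_of_MC:
  assumes f: "infinity_morphism V W f" and w: "w \<in> hwords V" and d: "wdeg V w \<in> {2, 3}"
  shows "mc_value (mc_of f) w = 0"
proof -
  note h = mc_of_conv_hom[OF f]
  note D = conv_hom_zin_D_short[OF h order_refl]
  obtain f1 f2 where f12: "f = (f1, f2)" by (cases f)
  have lin: "lin f1" "\<And>u. lin (f2 u)" "\<And>v. lin (\<lambda>u. f2 u v)"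
    and deg: "\<And>i j u v. u \<in> gr V i \<Longrightarrow> v \<in> gr V j \<Longrightarrow> f2 u v \<in> gr W (i + j + 1)"
    using f by (simp_all add: f12 infinity_morphism_def Let_def bilinear_map_def)
  note ops = linear_ops[OF lin(1)] linear_ops[OF lin(2)] linear_ops[OF lin(3)] W.br_ops
  have f2_0: "f2 u v = 0" if "u \<in> gr V i" "v \<in> gr V j" "i + j \<in> {1, 2}" for u v i j
    by (rule W.gr_outside[OF deg[OF that(1,2)]]) (use that(3) in auto)
  have eqs:
    "h \<in> gr V 1 \<Longrightarrow> br1 W (f1 h) = f1 (br1 V h)"
    "x \<in> gr V 0 \<Longrightarrow> y \<in> gr V 0 \<Longrightarrow> br2 W (f1 x) (f1 y) + br1 W (f2 x y) = f1 (br2 V x y)"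
    "x \<in> gr V 0 \<Longrightarrow> h \<in> gr V 1 \<Longrightarrow> br2 W (f1 x) (f1 h) = f1 (br2 V x h) - f2 x (br1 V h)"
    "x \<in> gr V 0 \<Longrightarrow> h \<in> gr V 1 \<Longrightarrow> br2 W (f1 h) (f1 x) = f1 (br2 V h x) - f2 (br1 V h) x"
    "x \<in> gr V 0 \<Longrightarrow> y \<in> gr V 0 \<Longrightarrow> z \<in> gr V 0 \<Longrightarrow>
      br3 W (f1 x) (f1 y) (f1 z) - br2 W (f2 x y) (f1 z) + br2 W (f1 x) (f2 y z) - br2 W (f1 y) (f2 x z)
      = f1 (br3 V x y z) + f2 (br2 V x y) z - f2 x (br2 V y z) + f2 y (br2 V x z)" for x y z h
    using f by (simp_all add: f12 infinity_morphism_def Let_def)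
  note simps = mc_value_def conv_bracket_1 conv_bracket_2 conv_bracket_3 zin_delta_short fextW wdeg_simps
    psgn_simps V.br_gr_low(1) f12 ldeg_simps(1) ops
  from w d show ?thesis
  proof (cases rule: short_words)
    case (1 h)
    then show ?thesis using w D(1)[of h] by (simp add: simps eqs)
  next
    case (2 x y)
    then show ?thesis using w D(2)[of x y] eqs(2)[of x y] by (simp add: simps scale_fractions) (simp add:
        algebra_simps)
  next
    case (3 x h)
    then have "br1 W (f2 x h) = 0" using f2_0[of x 0 h 1] by (simp add: ops)
    with 3 show ?thesis using w D(2)[of x h] eqs(3)[of x h] by (simp add: simps scale_fractions)
  next
    case (4 x h)
    then have "br1 W (f2 h x) = 0" using f2_0[of h 1 x 0] by (simp add: ops)
    with 4 show ?thesis using w D(2)[of h x] eqs(4)[of x h] by (simp add: simps scale_fractions psgn_def)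
  next
    case (5 x y z)
    then show ?thesis using w D(3)[of x y z] eqs(5)[of x y z] by (simp add: simps scale_fractions psgn_def)
        (simp add: algebra_simps scale_fractions)
  qed
qed

end

section \<open>Polynomial forms and the Maurer-Cartan equation with coefficients\<close>

lemma sum_listset_Cons:
  fixes F :: "'a list \<Rightarrow> 'b::comm_monoid_add"
  shows "(\<Sum>xs\<in>listset (A # As). F xs) = (\<Sum>x\<in>A. \<Sum>xs\<in>listset As. F (x # xs))"
proof -
  have "listset (A # As) = (\<lambda>(x, xs). x # xs) ` (A \<times> listset As)"
    by (auto simp: set_Cons_def)
  then show ?thesis
    by (simp add: sum.reindex inj_on_def sum.cartesian_product split_def)
qed

lemma form_mult_1 [simp]: "form_mult \<omega> (1, 0) = \<omega>"
  by (simp add: form_mult_def)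

lemma form_eval_mult: "form_eval t (form_mult \<omega> \<eta>) = form_eval t \<omega> * form_eval t \<eta>"
  by (simp add: form_eval_def form_mult_def)

lemma form_eval_mono: "form_eval t (mono_form (n, b)) = (if b then 0 else t ^ n)"
  by (simp add: form_eval_def mono_form_def poly_monom)

lemma form_eval_coeffs:
  assumes "degree (fst \<omega>) \<le> N"
  shows "form_eval t \<omega> = (\<Sum>n\<le>N. t ^ n * mono_coeff \<omega> (n, False))"
proof -
  have "form_eval t \<omega> = (\<Sum>n\<le>degree (fst \<omega>). coeff (fst \<omega>) n * t ^ n)"
    by (simp add: form_eval_def poly_altdef)
  also have "\<dots> = (\<Sum>n\<le>N. coeff (fst \<omega>) n * t ^ n)"
    using assms by (intro sum.mono_neutral_left) (auto simp: coeff_eq_0)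
  finally show ?thesis by (simp add: mono_coeff_def mult.commute)
qed

lemma mono_coeff_mult_dt:
  "mono_coeff (form_mult (mono_form (i, b)) (mono_form (j, c))) (n, True) =
    (if b \<noteq> c \<and> i + j = n then 1 else 0)"
  by (auto simp: mono_coeff_def form_mult_def mono_form_def mult_monom)

text \<open>Homogeneity in the grading in which \<open>k\<close>-forms have degree \<open>-k\<close>. The zero form is homogeneous
  of every degree.\<close>

definition form_homog :: "'k::field form \<Rightarrow> int \<Rightarrow> bool" where
  "form_homog \<omega> k \<longleftrightarrow> (k \<noteq> 0 \<longrightarrow> fst \<omega> = 0) \<and> (k \<noteq> - 1 \<longrightarrow> snd \<omega> = 0)"

lemma form_homog_mult: "form_homog \<omega> k \<Longrightarrow> form_homog \<eta> l \<Longrightarrow> form_homog (form_mult \<omega> \<eta>) (k + l)"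
  by (cases "k = 0"; cases "l = 0"; cases "k = - 1"; cases "l = - 1")
     (auto simp: form_homog_def form_mult_def)

lemma form_homog_prod:
  "form_homog (foldr form_mult (map mono_form es) (1, 0)) (sum_list (map mono_deg es))"
proof (induction es)
  case Nil
  then show ?case by (simp add: form_homog_def)
next
  case (Cons e es)
  have "form_homog (mono_form e) (mono_deg e)" by (simp add: form_homog_def mono_form_def mono_deg_def)
  from form_homog_mult[OF this Cons.IH] show ?case by simp
qed

lemma form_homog_coeff: "form_homog \<omega> k \<Longrightarrow> mono_coeff \<omega> e \<noteq> 0 \<Longrightarrow> k = mono_deg e"
  by (cases "snd e") (auto simp: form_homog_def mono_coeff_def mono_deg_def)

lemma mono_coeff_prod_nonzero:
  "mono_coeff (foldr form_mult (map mono_form es) (1, 0)) e \<noteq> 0 \<Longrightarrow> sum_list (map mono_deg es) = mono_deg e"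
  using form_homog_coeff[OF form_homog_prod] .

context leibniz2_pair
begin

text \<open>A polynomial \<open>P\<close> with vector coefficients that vanishes at all scalars is zero: \<open>P(2t) - 2\<^sup>N
  P(t)\<close> has no term of degree \<open>N\<close>, and its other coefficients are those of \<open>P\<close> up to the factors
  \<open>2\<^sup>n - 2\<^sup>N\<close>, which are nonzero in characteristic 0. This allows induction on the degree.\<close>

lemma polynomial_coeffs_zero:
  assumes "\<And>t :: 'k. (\<Sum>n\<le>N. scl W (t ^ n) (c n)) = 0" "n \<le> N"
  shows "c n = 0"
  using assms
proof (induction N arbitrary: c n)
  case 0
  then show ?case using "0.prems"(1)[of 1] by simp
next
  case (Suc N)
  have low: "c n = 0" if n: "n \<le> N" for n
  proof -
    have "(\<Sum>n\<le>N. scl W (t ^ n) (scl W (2 ^ n - 2 ^ Suc N) (c n))) = 0" for t :: 'k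
    proof -
      have "(\<Sum>n\<le>N. scl W (t ^ n) (scl W (2 ^ n - 2 ^ Suc N) (c n)))
          = (\<Sum>n\<le>Suc N. scl W ((2 * t) ^ n) (c n)) - scl W (2 ^ Suc N) (\<Sum>n\<le>Suc N. scl W (t ^ n) (c n))"
        by (simp add: power_mult_distrib W.vs.scale_sum_right W.vs.scale_right_distrib algebra_simps
            W.vs.scale_left_diff_distrib sum_subtractf)
      also have "\<dots> = 0" by (simp only: Suc.prems(1)) simp
      finally show ?thesis .
    qed
    from Suc.IH[OF this n] have "scl W (2 ^ n - 2 ^ Suc N) (c n) = 0" .
    moreover have "(2 :: 'k) ^ n \<noteq> 2 ^ Suc N"
    proof -
      have "of_nat (2 ^ n) \<noteq> (of_nat (2 ^ Suc N) :: 'k)"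
        unfolding of_nat_eq_iff using n by (simp add: power_inject_exp del: power_Suc)
      then show ?thesis by (simp del: power_Suc)
    qed
    ultimately show ?thesis by simp
  qed
  have "c (Suc N) = 0" using Suc.prems(1)[of 1] low by simp
  with low Suc.prems(2) show ?case by (cases "n = Suc N") auto
qed

lemma conv_forms_hom:
  assumes "\<gamma> \<in> conv_forms V W (- 1)"
  shows "\<gamma> e \<in> conv_hom V W (- 1 - mono_deg e)" "\<gamma> (n, False) \<in> conv_hom V W (- 1)" "\<gamma> (n, True)
      \<in> conv_hom V W 0"
proof -
  show *: "\<gamma> e \<in> conv_hom V W (- 1 - mono_deg e)" for e
    using assms by (simp add: conv_forms_def del: split_paired_All)
  show "\<gamma> (n, False) \<in> conv_hom V W (- 1)" "\<gamma> (n, True) \<in> conv_hom V W 0"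
    using *[of "(n, False)"] *[of "(n, True)"] by (simp_all add: mono_deg_def)
qed

lemma msupp_bound:
  assumes "\<gamma> \<in> conv_forms V W d"
  obtains K where "msupp \<gamma> \<subseteq> {..K} \<times> UNIV"
proof -
  have "finite (fst ` msupp \<gamma>)" using assms by (simp add: conv_forms_def)
  then obtain K where "\<forall>n\<in>fst ` msupp \<gamma>. n \<le> K" using finite_nat_set_iff_bounded_le by blast
  then have "msupp \<gamma> \<subseteq> {..K} \<times> UNIV" by fastforce
  then show ?thesis by (rule that)
qed

lemma not_msupp: "e \<notin> msupp \<gamma> \<Longrightarrow> \<gamma> e = (\<lambda>_. 0)"
  by (auto simp: msupp_def fun_eq_iff)

lemma sum_msupp:
  assumes "msupp \<gamma> \<subseteq> {..K} \<times> UNIV" "\<And>e. \<gamma> e = (\<lambda>_. 0) \<Longrightarrow> F e = 0"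
  shows "(\<Sum>e\<in>msupp \<gamma>. F e) = (\<Sum>n\<le>K. F (n, False) + F (n, True) :: 'w)"
proof -
  have "(\<Sum>e\<in>msupp \<gamma>. F e) = (\<Sum>e\<in>{..K} \<times> UNIV. F e)"
    using assms(1) by (intro sum.mono_neutral_left) (auto intro!: assms(2) not_msupp)
  also have "\<dots> = (\<Sum>n\<le>K. \<Sum>b\<in>UNIV. F (n, b))" by (simp add: sum.cartesian_product)
  finally show ?thesis by (simp add: UNIV_bool add.commute)
qed

text \<open>The differential of \<open>\<Omega>\<^sub>1\<close> feeds \<open>t\<^bsup>n+1\<^esup>\<close> into \<open>t\<^sup>n dt\<close>: this term is \<open>-\<alpha>'(t)\<close> in the \<open>dt\<close>-part
  of the equation.\<close>

lemma forms_bracket_1: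
  assumes "finite (msupp \<gamma>)"
  shows "forms_bracket V W [- 1] [\<gamma>] (n, False) w = conv_bracket V W [- 1] [\<gamma> (n, False)] w"
    "forms_bracket V W [- 1] [\<gamma>] (n, True) w = conv_bracket V W [0] [\<gamma> (n, True)] w
        - scl W (of_nat (Suc n)) (\<gamma> (Suc n, False) w)"
proof -
  have *: "mono_coeff (form_d (mono_form (m, b))) (n, c) = (if c \<and> \<not> b \<and> m
      = Suc n then of_nat (Suc n) else (0::'k))" for m b c
    by (auto simp: mono_coeff_def form_d_def mono_form_def coeff_pderiv)
  show "forms_bracket V W [- 1] [\<gamma>] (n, False) w = conv_bracket V W [- 1] [\<gamma> (n, False)] w"
    by (simp add: forms_bracket_def mono_deg_def[of "(n, False)"] * split_paired_all del: of_nat_Suc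
        flip: prod.collapse)
  have "(\<Sum>e'\<in>msupp \<gamma>. scl W (psgn (- 1 - mono_deg e') * mono_coeff (form_d (mono_form e')) (n, True)) (\<gamma> e' w))
    = (\<Sum>e'\<in>msupp \<gamma>. if e' = (Suc n, False) then - scl W (of_nat (Suc n)) (\<gamma> (Suc n, False) w) else 0)"
    by (intro sum.cong refl, clarsimp simp only: split_paired_all * mono_deg_def) (auto simp: psgn_simps
        W.vs.scale_left_distrib W.vs.scale_left_diff_distrib)
  also have "\<dots> = - scl W (of_nat (Suc n)) (\<gamma> (Suc n, False) w)"
    using assms not_msupp[of "(Suc n, False)" \<gamma>] by (simp add: sum.delta)
  finally show "forms_bracket V W [- 1] [\<gamma>] (n, True) w = conv_bracket V W [0] [\<gamma> (n, True)] w
      - scl W (of_nat (Suc n)) (\<gamma> (Suc n, False) w)"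
    by (simp add: forms_bracket_def mono_deg_def[of "(n, True)"] del: of_nat_Suc)
qed

lemma forms_bracket_2:
  "forms_bracket V W [- 1, - 1] [\<gamma>, \<gamma>] e w = (\<Sum>a\<in>msupp \<gamma>. \<Sum>b\<in>msupp \<gamma>.
     scl W (psgn (mono_deg a * (- 1 - mono_deg b)) * mono_coeff (form_mult (mono_form a) (mono_form b)) e)
       (conv_bracket V W [- 1 - mono_deg a, - 1 - mono_deg b] [\<gamma> a, \<gamma> b] w))"
proof -
  have "{(i, j). i < j \<and> j < Suc (Suc 0)} = {(0, 1)}" by auto
  then show ?thesis
    by (simp add: forms_bracket_def sum_listset_Cons Let_def del: listset.simps(2))
qed

lemma forms_bracket_3:
  "forms_bracket V W [- 1, - 1, - 1] [\<gamma>, \<gamma>, \<gamma>] e w = (\<Sum>a\<in>msupp \<gamma>. \<Sum>b\<in>msupp \<gamma>. \<Sum>c\<in>msupp \<gamma>.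
     scl W (psgn (mono_deg a * (- 1 - mono_deg b)) * (psgn (mono_deg a * (- 1
         - mono_deg c)) * psgn (mono_deg b * (- 1 - mono_deg c)))
         * mono_coeff (form_mult (mono_form a) (form_mult (mono_form b) (mono_form c))) e)
       (conv_bracket V W [- 1 - mono_deg a, - 1 - mono_deg b, - 1 - mono_deg c] [\<gamma> a, \<gamma> b, \<gamma> c] w))"
proof -
  have "{(i, j). i < j \<and> j < Suc (Suc (Suc 0))} = {(0, 1), (0, 2), (1, 2)}" by auto
  then show ?thesis
    by (simp add: forms_bracket_def sum_listset_Cons Let_def del: listset.simps(2))
qed

definition mc_forms_value :: "(mono \<Rightarrow> 'v list \<Rightarrow> 'w) \<Rightarrow> mono \<Rightarrow> 'v list \<Rightarrow> 'w" where
  "mc_forms_value \<gamma> e w = forms_bracket V W [- 1] [\<gamma>] e w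
     - scl W (1 / 2) (forms_bracket V W [- 1, - 1] [\<gamma>, \<gamma>] e w)
     - scl W (1 / 6) (forms_bracket V W [- 1, - 1, - 1] [\<gamma>, \<gamma>, \<gamma>] e w)"

lemma mc_forms_iff:
  "mc_forms V W \<gamma> \<longleftrightarrow> \<gamma> \<in> conv_forms V W (- 1) \<and> (\<forall>e. \<forall>w\<in>hwords V. mc_forms_value \<gamma> e w = 0)"
proof -
  have "{1..3::nat} = {1, 2, 3}" by auto
  moreover have "replicate 2 u = [u, u]" "replicate 3 u = [u, u, u]" for u :: int
    by (simp_all add: numeral_2_eq_2 numeral_3_eq_3)
  moreover have "replicate 2 u = [u, u]" "replicate 3 u = [u, u, u]" for u :: "mono \<Rightarrow> 'v list \<Rightarrow> 'w"
    by (simp_all add: numeral_2_eq_2 numeral_3_eq_3)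
  ultimately have "(\<Sum>p = 1..3. scl W ((- 1) ^ (p * (p - 1) div 2) / fact p)
           (forms_bracket V W (replicate p (- 1)) (replicate p \<gamma>) e w)) = mc_forms_value \<gamma> e w" for e w
    by (simp add: mc_forms_value_def fact_numeral)
  then show ?thesis by (simp add: mc_forms_def)
qed

lemma gr_scale_coeff: "(c \<noteq> 0 \<Longrightarrow> k = l) \<Longrightarrow> u \<in> gr W (d - k) \<Longrightarrow> scl W (s * c) u \<in> gr W (d - l)"
  by (cases "c = 0") (simp_all add: W.gr_ops)

text \<open>A monomial form shifts degrees by its own degree, so the coefficient at \<open>t\<^sup>n\<close> has degree \<open>-2\<close>
  and that at \<open>t\<^sup>n dt\<close> has degree \<open>-1\<close>.\<close>

lemma mc_forms_value_gr:
  assumes \<gamma>: "\<gamma> \<in> conv_forms V W (- 1)" and w: "w \<in> hwords V"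
  shows "mc_forms_value \<gamma> e w \<in> gr W (wdeg V w - 2 - mono_deg e)"
proof -
  have hom: "\<gamma> e \<in> conv_hom V W (- 1 - mono_deg e)" for e by (rule conv_forms_hom(1)[OF \<gamma>])
  have fin: "finite (msupp \<gamma>)" using \<gamma> by (simp add: conv_forms_def)
  obtain n b where e: "e = (n, b)" by (cases e)
  have "forms_bracket V W [- 1] [\<gamma>] e w \<in> gr W (wdeg V w - 2 - mono_deg e)"
    using conv_bracket_gr[of "[- 1 - mono_deg e]" "[\<gamma> e]" w] conv_hom_gr[OF hom[of "(Suc n, False)"] w] w
        hom[of e]
    by (cases b) (simp_all add: e forms_bracket_1[OF fin] mono_deg_def W.gr_ops)
  moreover have "forms_bracket V W [- 1, - 1] [\<gamma>, \<gamma>] e w \<in> gr W (wdeg V w - 2 - mono_deg e)"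
    unfolding forms_bracket_2
  proof (intro gr_sum)
    fix a b
    have "conv_bracket V W [- 1 - mono_deg a, - 1 - mono_deg b] [\<gamma> a, \<gamma> b] w
        \<in> gr W (wdeg V w - 2 - (mono_deg a + mono_deg b))"
      using conv_bracket_gr[of "[- 1 - mono_deg a, - 1 - mono_deg b]" "[\<gamma> a, \<gamma> b]" w] hom w
      by (simp add: All_less_Suc algebra_simps)
    then show "scl W (psgn (mono_deg a * (- 1 - mono_deg b)) * mono_coeff (form_mult (mono_form a) (mono_form
        b)) e)
       (conv_bracket V W [- 1 - mono_deg a, - 1 - mono_deg b] [\<gamma> a, \<gamma> b] w) \<in> gr W (wdeg V w - 2 - mono_deg e)"
      by (rule gr_scale_coeff[rotated]) (use mono_coeff_prod_nonzero[of "[a, b]" e, where 'a = 'k] in simp)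
  qed
  moreover have "forms_bracket V W [- 1, - 1, - 1] [\<gamma>, \<gamma>, \<gamma>] e w \<in> gr W (wdeg V w - 2 - mono_deg e)"
    unfolding forms_bracket_3
  proof (intro gr_sum)
    fix a b c
    have "conv_bracket V W [- 1 - mono_deg a, - 1 - mono_deg b, - 1 - mono_deg c] [\<gamma> a, \<gamma> b, \<gamma> c] w
        \<in> gr W (wdeg V w - 2 - (mono_deg a + (mono_deg b + mono_deg c)))"
      using conv_bracket_gr[of "[- 1 - mono_deg a, - 1 - mono_deg b, - 1
          - mono_deg c]" "[\<gamma> a, \<gamma> b, \<gamma> c]" w] hom w
      by (simp add: All_less_Suc algebra_simps)
    then show "scl W (psgn (mono_deg a * (- 1 - mono_deg b)) * (psgn (mono_deg a * (- 1
        - mono_deg c)) * psgn (mono_deg b * (- 1 - mono_deg c)))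
         * mono_coeff (form_mult (mono_form a) (form_mult (mono_form b) (mono_form c))) e)
       (conv_bracket V W [- 1 - mono_deg a, - 1 - mono_deg b, - 1 - mono_deg c] [\<gamma> a, \<gamma> b, \<gamma> c] w)
           \<in> gr W (wdeg V w - 2 - mono_deg e)"
      by (rule gr_scale_coeff[rotated]) (use mono_coeff_prod_nonzero[of "[a, b, c]" e, where 'a = 'k] in simp)
  qed
  ultimately show ?thesis by (simp add: mc_forms_value_def W.gr_ops)
qed

end

section \<open>Evaluation at a point of the interval\<close>

context leibniz2_pair
begin

lemma msupp_le: "msupp \<gamma> \<subseteq> {..K} \<times> UNIV \<Longrightarrow> e \<in> msupp \<gamma> \<Longrightarrow> fst e \<le> K"
  by auto

lemma conv_eval_sum:
  assumes "msupp \<gamma> \<subseteq> {..K} \<times> UNIV"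
  shows "conv_eval W t \<gamma> w = (\<Sum>n\<le>K. scl W (t ^ n) (\<gamma> (n, False) w))"
  unfolding conv_eval_def using assms by (subst sum_msupp) (simp_all add: form_eval_mono)

lemma fext_sum_fun: "fext (scl W) (\<lambda>x. \<Sum>i\<in>I. F i x) a = (\<Sum>i\<in>I. fext (scl W) (F i) a)"
  unfolding fext_def W.vs.scale_sum_right by (rule sum.swap)

text \<open>Evaluation at \<open>t\<close> commutes with the brackets: forms are multiplied pointwise, and \<open>dt\<close>
  evaluates to 0, so that only coefficients of degree \<open>-1\<close> are left and all signs are trivial. Sums
  over \<open>n\<close> run up to any bound on the exponents that can occur.\<close>

lemma eval_bracket_1:
  assumes K: "msupp \<gamma> \<subseteq> {..K} \<times> UNIV" and fin: "finite (msupp \<gamma>)" and N: "K \<le> N"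
  shows "(\<Sum>n\<le>N. scl W (t ^ n) (forms_bracket V W [- 1] [\<gamma>] (n, False) w))
    = conv_bracket V W [- 1] [conv_eval W t \<gamma>] w"
proof -
  have "msupp \<gamma> \<subseteq> {..N} \<times> UNIV" using K N by fastforce
  note ev = conv_eval_sum[OF this, of t, abs_def]
  show ?thesis
    unfolding forms_bracket_1[OF fin] conv_bracket_1 ev
    by (simp add: fext_sum_fun fext_scale_fun[OF W.vs.vector_space_axioms] linear_sum[OF W.br1_linear]
        W.br_scale
        W.vs.scale_sum_right W.vs.scale_right_distrib sum.distrib psgn_simps sum_negf W.vs.scale_left_commute
        sum_subtractf W.vs.scale_right_diff_distrib)
qed

lemma degree_mono: "degree (fst (mono_form e :: 'k form)) \<le> fst e"
  by (auto simp: mono_form_def degree_monom_eq)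

lemma degree_form_mult: "degree (fst \<omega>) \<le> m \<Longrightarrow> degree (fst \<eta>) \<le> n \<Longrightarrow> degree (fst (form_mult \<omega> \<eta>)) \<le> m + n"
  using degree_mult_le[of "fst \<omega>" "fst \<eta>"] by (simp add: form_mult_def)

lemma br_sum:
  "br2 W (\<Sum>i\<in>I. F i) v = (\<Sum>i\<in>I. br2 W (F i) v)" "br2 W u (\<Sum>i\<in>I. F i) = (\<Sum>i\<in>I. br2 W u (F i))"
  "br3 W (\<Sum>i\<in>I. F i) v w = (\<Sum>i\<in>I. br3 W (F i) v w)" "br3 W u (\<Sum>i\<in>I. F i) w = (\<Sum>i\<in>I. br3 W u (F i) w)"
  "br3 W u v (\<Sum>i\<in>I. F i) = (\<Sum>i\<in>I. br3 W u v (F i))"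
  by (rule linear_sum[OF W.br2_linear(2)] linear_sum[OF W.br2_linear(1)]
      linear_sum[OF W.br3_linear(3)] linear_sum[OF W.br3_linear(2)] linear_sum[OF W.br3_linear(1)])+

lemma eval_bracket_2:
  assumes K: "msupp \<gamma> \<subseteq> {..K} \<times> UNIV" and N: "2 * K \<le> N"
  shows "(\<Sum>n\<le>N. scl W (t ^ n) (forms_bracket V W [- 1, - 1] [\<gamma>, \<gamma>] (n, False) w))
    = conv_bracket V W [- 1, - 1] [conv_eval W t \<gamma>, conv_eval W t \<gamma>] w"
proof -
  let ?S = "msupp \<gamma>" and ?m = "mono_form :: mono \<Rightarrow> 'k form"
  let ?ev = "\<lambda>e. form_eval t (?m e)"
  let ?B = "\<lambda>a b. conv_bracket V W [- 1 - mono_deg a, - 1 - mono_deg b] [\<gamma> a, \<gamma> b] w"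
  let ?C = "\<lambda>a b. conv_bracket V W [- 1, - 1] [\<gamma> a, \<gamma> b] w"
  have "(\<Sum>n\<le>N. scl W (t ^ n) (forms_bracket V W [- 1, - 1] [\<gamma>, \<gamma>] (n, False) w))
     = (\<Sum>a\<in>?S. \<Sum>b\<in>?S. \<Sum>n\<le>N. scl W (t ^ n * (psgn (mono_deg a * (- 1
         - mono_deg b)) * mono_coeff (form_mult (?m a) (?m b)) (n, False))) (?B a b))"
    unfolding forms_bracket_2 W.vs.scale_sum_right
    by (subst sum.swap, intro sum.cong refl, subst sum.swap) (simp add: mult.assoc)
  also have "\<dots> = (\<Sum>a\<in>?S. \<Sum>b\<in>?S. scl W (?ev a * ?ev b) (?C a b))"
  proof (intro sum.cong refl)
    fix a b assume ab: "a \<in> ?S" "b \<in> ?S"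
    have "degree (fst (form_mult (?m a) (?m b))) \<le> fst a + fst b" by (intro degree_form_mult degree_mono)
    also have "\<dots> \<le> N" using msupp_le[OF K ab(1)] msupp_le[OF K ab(2)] N by linarith
    finally have "form_eval t (form_mult (?m a) (?m b)) = (\<Sum>n\<le>N. t ^ n * mono_coeff (form_mult (?m a) (?m b))
        (n, False))"
      by (rule form_eval_coeffs)
    then have "(\<Sum>n\<le>N. scl W (t ^ n * (psgn (mono_deg a * (- 1
        - mono_deg b)) * mono_coeff (form_mult (?m a) (?m b)) (n, False))) (?B a b))
      = scl W (psgn (mono_deg a * (- 1 - mono_deg b)) * (?ev a * ?ev b)) (?B a b)"
      by (simp add: form_eval_mult W.vs.scale_sum_left[symmetric] sum_distrib_left mult.left_commute)
    also have "\<dots> = scl W (?ev a * ?ev b) (?C a b)"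
      by (cases a; cases b; cases "snd a"; cases "snd b") (simp_all add: form_eval_mono mono_deg_def)
    finally show "(\<Sum>n\<le>N. scl W (t ^ n * (psgn (mono_deg a * (- 1
        - mono_deg b)) * mono_coeff (form_mult (?m a) (?m b)) (n, False))) (?B a b))
      = scl W (?ev a * ?ev b) (?C a b)" .
  qed
  also have "\<dots> = conv_bracket V W [- 1, - 1] [conv_eval W t \<gamma>, conv_eval W t \<gamma>] w"
    unfolding conv_bracket_2 fext_scale_fun[OF W.vs.vector_space_axioms, symmetric] fext_sum_fun[symmetric]
  proof (rule fext_cong[OF W.vs.vector_space_axioms refl], clarsimp simp del: mult_minus1, goal_cases)
    case (1 u v)
    let ?A = "conv_eval W t \<gamma>"
    have R: "br2 W (?A u) (?A v) = (\<Sum>a\<in>?S. \<Sum>b\<in>?S. scl W (?ev a * ?ev b) (br2 W (\<gamma> a u) (\<gamma> b v)))"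
      unfolding conv_eval_def br_sum(1) unfolding br_sum(2) W.br_scale W.vs.scale_sum_right W.vs.scale_scale
      by (simp add: mult_ac)
    also have "\<dots> = (\<Sum>a\<in>?S. \<Sum>b\<in>?S. scl W (?ev a * ?ev b) (br2 W (\<gamma> b u) (\<gamma> a v)))"
      by (subst sum.swap) (simp add: mult.commute)
    finally have R': "br2 W (?A u) (?A v) = \<dots>" .
    have "(\<Sum>a\<in>?S. \<Sum>b\<in>?S. scl W (?ev a * ?ev b) (scl W k (br2 W (\<gamma> a u) (\<gamma> b v))
        - scl W l (br2 W (\<gamma> b u) (\<gamma> a v))))
        = scl W k (br2 W (?A u) (?A v)) - scl W l (br2 W (?A u) (?A v))" for k l
      by (subst R, subst R') (simp add: W.vs.scale_right_diff_distrib sum_subtractf W.vs.scale_sum_right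
          mult.commute)
    then show ?case .
  qed
  finally show ?thesis .
qed

lemma eval_bracket_3:
  assumes K: "msupp \<gamma> \<subseteq> {..K} \<times> UNIV" and N: "3 * K \<le> N" and w: "length w \<in> {1, 2, 3}"
  shows "(\<Sum>n\<le>N. scl W (t ^ n) (forms_bracket V W [- 1, - 1, - 1] [\<gamma>, \<gamma>, \<gamma>] (n, False) w))
    = conv_bracket V W [- 1, - 1, - 1] [conv_eval W t \<gamma>, conv_eval W t \<gamma>, conv_eval W t \<gamma>] w"
proof -
  let ?S = "msupp \<gamma>" and ?m = "mono_form :: mono \<Rightarrow> 'k form"
  let ?ev = "\<lambda>e. form_eval t (?m e)"
  let ?B = "\<lambda>a b c. conv_bracket V W [- 1 - mono_deg a, - 1 - mono_deg b, - 1 - mono_deg c] [\<gamma> a, \<gamma> b, \<gamma> c] w"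
  let ?C = "\<lambda>a b c. conv_bracket V W [- 1, - 1, - 1] [\<gamma> a, \<gamma> b, \<gamma> c] w"
  let ?s = "\<lambda>a b c. psgn (mono_deg a * (- 1 - mono_deg b)) * (psgn (mono_deg a * (- 1
      - mono_deg c)) * psgn (mono_deg b * (- 1 - mono_deg c)))"
  let ?m3 = "\<lambda>a b c. form_mult (?m a) (form_mult (?m b) (?m c))"
  have "(\<Sum>n\<le>N. scl W (t ^ n) (forms_bracket V W [- 1, - 1, - 1] [\<gamma>, \<gamma>, \<gamma>] (n, False) w))
     = (\<Sum>a\<in>?S. \<Sum>b\<in>?S. \<Sum>c\<in>?S. \<Sum>n\<le>N. scl W (t ^ n * (?s a b c * mono_coeff (?m3 a b c) (n, False))) (?B a b c))"
    unfolding forms_bracket_3 W.vs.scale_sum_right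
    by (subst sum.swap, intro sum.cong refl, subst sum.swap, intro sum.cong refl, subst sum.swap) (simp add:
        mult.assoc)
  also have "\<dots> = (\<Sum>a\<in>?S. \<Sum>b\<in>?S. \<Sum>c\<in>?S. scl W (?ev a * (?ev b * ?ev c)) (?C a b c))"
  proof (intro sum.cong refl)
    fix a b c assume ab: "a \<in> ?S" "b \<in> ?S" "c \<in> ?S"
    have "degree (fst (?m3 a b c)) \<le> fst a + (fst b + fst c)" by (intro degree_form_mult degree_mono)
    also have "\<dots> \<le> N" using msupp_le[OF K ab(1)] msupp_le[OF K ab(2)] msupp_le[OF K ab(3)] N by linarith
    finally have "form_eval t (?m3 a b c) = (\<Sum>n\<le>N. t ^ n * mono_coeff (?m3 a b c) (n, False))"
      by (rule form_eval_coeffs)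
    then have "(\<Sum>n\<le>N. scl W (t ^ n * (?s a b c * mono_coeff (?m3 a b c) (n, False))) (?B a b c))
      = scl W (?s a b c * (?ev a * (?ev b * ?ev c))) (?B a b c)"
      by (simp add: form_eval_mult W.vs.scale_sum_left[symmetric] sum_distrib_left mult.left_commute mult.assoc)
    also have "\<dots> = scl W (?ev a * (?ev b * ?ev c)) (?C a b c)"
      by (cases a; cases b; cases c; cases "snd a"; cases "snd b"; cases "snd c") (simp_all add:
          form_eval_mono mono_deg_def)
    finally show "(\<Sum>n\<le>N. scl W (t ^ n * (?s a b c * mono_coeff (?m3 a b c) (n, False))) (?B a b c))
      = scl W (?ev a * (?ev b * ?ev c)) (?C a b c)" .
  qed
  also have "\<dots> = conv_bracket V W [- 1, - 1, - 1] [conv_eval W t \<gamma>, conv_eval W t \<gamma>, conv_eval W t \<gamma>] w"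
  proof -
    consider x where "w = [x]" | x y where "w = [x, y]" | x y z where "w = [x, y, z]"
      using w by (auto simp: length_Suc_conv numeral_2_eq_2 numeral_3_eq_3)
    then show ?thesis
    proof cases
      case (3 x y z)
      let ?T = "\<lambda>a b c. scl W (?ev a * (?ev b * ?ev c)) (br3 W (\<gamma> a [x]) (\<gamma> b [y]) (\<gamma> c [z]))"
      let ?R = "br3 W (conv_eval W t \<gamma> [x]) (conv_eval W t \<gamma> [y]) (conv_eval W t \<gamma> [z])"
      have R: "?R = (\<Sum>a\<in>?S. \<Sum>b\<in>?S. \<Sum>c\<in>?S. ?T a b c)"
        unfolding conv_eval_def br_sum(3) unfolding br_sum(4) unfolding br_sum(5)
          W.br_scale W.vs.scale_sum_right W.vs.scale_scale
      by (simp add: mult_ac)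
      have swap1: "(\<Sum>a\<in>?S. \<Sum>b\<in>?S. \<Sum>c\<in>?S. F a c b) = (\<Sum>a\<in>?S. \<Sum>b\<in>?S. \<Sum>c\<in>?S. F a b c)"
        and swap2: "(\<Sum>a\<in>?S. \<Sum>b\<in>?S. \<Sum>c\<in>?S. F b a c) = (\<Sum>a\<in>?S. \<Sum>b\<in>?S. \<Sum>c\<in>?S. F a b c)" for F :: "_ \<Rightarrow> _ \<Rightarrow> _ \<Rightarrow> 'w"
        by (intro sum.cong refl sum.swap, rule sum.swap)
      have perm: "(\<Sum>a\<in>?S. \<Sum>b\<in>?S. \<Sum>c\<in>?S. ?T a c b) = ?R" "(\<Sum>a\<in>?S. \<Sum>b\<in>?S. \<Sum>c\<in>?S. ?T b a c) = ?R"
        "(\<Sum>a\<in>?S. \<Sum>b\<in>?S. \<Sum>c\<in>?S. ?T b c a) = ?R" "(\<Sum>a\<in>?S. \<Sum>b\<in>?S. \<Sum>c\<in>?S. ?T c b a) = ?R"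
        "(\<Sum>a\<in>?S. \<Sum>b\<in>?S. \<Sum>c\<in>?S. ?T c a b) = ?R"
        unfolding R
        using swap1[of ?T] swap2[of ?T] swap2[of "\<lambda>a b c. ?T a c b"] swap1[of "\<lambda>a b c. ?T b a c"]
          swap1[of "\<lambda>a b c. ?T b c a"] swap2[of "\<lambda>a b c. ?T c a b"] 
        by metis+
      have "(\<Sum>a\<in>?S. \<Sum>b\<in>?S. \<Sum>c\<in>?S. scl W (?ev a * (?ev b * ?ev c)) (?C a b c))
        = (\<Sum>a\<in>?S. \<Sum>b\<in>?S. \<Sum>c\<in>?S. scl W (psgn (wdeg V [y])) (?T a b c + ?T a c b + (?T b a c + ?T b c a)
            + (?T c b a + ?T c a b)))"
        unfolding 3 conv_bracket_3(1)
        by (intro sum.cong refl) (simp add: W.vs.scale_right_distrib mult_ac)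
      also have "\<dots> = scl W (psgn (wdeg V [y])) (?R + ?R + (?R + ?R) + (?R + ?R))"
        unfolding W.vs.scale_sum_right[symmetric] sum.distrib perm R[symmetric] ..
      also have "\<dots> = conv_bracket V W [- 1, - 1, - 1] [conv_eval W t \<gamma>, conv_eval W t \<gamma>, conv_eval W t \<gamma>] w"
        unfolding 3 conv_bracket_3(1) ..
      finally show ?thesis .
    qed (simp_all add: conv_bracket_3)
  qed
  finally show ?thesis .
qed

text \<open>If every point of a path is a morphism, the \<open>dt\<close>-free part of the Maurer-Cartan equation holds
  at every \<open>t\<close>. Its left-hand side is polynomial in \<open>t\<close>, hence all coefficients vanish.\<close>

lemma mc_forms_value_0_form:
  assumes \<gamma>: "\<gamma> \<in> conv_forms V W (- 1)"
    and path: "\<And>t. \<exists>f. infinity_morphism V W f \<and> conv_eval W t \<gamma> = mc_of f"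
    and w: "w \<in> hwords V"
  shows "mc_forms_value \<gamma> (n, False) w = 0"
proof (cases "wdeg V w \<in> {2, 3}")
  case False
  then show ?thesis
    using mc_forms_value_gr[OF \<gamma> w, of "(n, False)"]
    by (intro W.gr_outside[of _ "wdeg V w - 2"]) (auto simp: mono_deg_def)
next
  case True
  have len: "length w \<in> {1, 2, 3}"
    by (rule short_words[OF w True]) simp_all
  obtain K where K: "msupp \<gamma> \<subseteq> {..K} \<times> UNIV" using msupp_bound[OF \<gamma>] .
  have fin: "finite (msupp \<gamma>)" using \<gamma> by (simp add: conv_forms_def)
  \<comment> \<open>a product of three monomials of degree at most \<open>K\<close> has degree at most \<open>3 * K\<close>\<close>
  define N where "N = max n (3 * K)"
  have N: "K \<le> N" "2 * K \<le> N" "3 * K \<le> N" "n \<le> N" by (auto simp: N_def)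
  have "(\<Sum>n\<le>N. scl W (t ^ n) (mc_forms_value \<gamma> (n, False) w)) = 0" for t
  proof -
    have "(\<Sum>n\<le>N. scl W (t ^ n) (mc_forms_value \<gamma> (n, False) w)) = mc_value (conv_eval W t \<gamma>) w"
      unfolding mc_forms_value_def mc_value_def eval_bracket_1[OF K fin N(1), symmetric]
        eval_bracket_2[OF K N(2), symmetric] eval_bracket_3[OF K N(3) len, symmetric]
      by (simp add: W.vs.scale_right_diff_distrib sum_subtractf W.vs.scale_sum_right W.vs.scale_left_commute
          mult.commute)
    then show ?thesis using path[of t] mc_of_MC[OF _ w True] by auto
  qed
  from polynomial_coeffs_zero[where c = "\<lambda>n. mc_forms_value \<gamma> (n, False) w", OF this N(4)] show ?thesis .
qed

end

section \<open>The differential equation of a path\<close>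

context leibniz2_pair
begin

lemma mc_forms_value_dt_letter:
  assumes \<gamma>: "\<gamma> \<in> conv_forms V W (- 1)" and v: "[v] \<in> hwords V"
  shows "mc_forms_value \<gamma> (n, True) [v] = br1 W (\<gamma> (n, True) [v]) + \<gamma> (n, True) [br1 V v]
    - scl W (of_nat (Suc n)) (\<gamma> (Suc n, False) [v])"
proof -
  have fin: "finite (msupp \<gamma>)" using \<gamma> by (simp add: conv_forms_def)
  show ?thesis
    using conv_hom_zin_D_short(1)[OF conv_forms_hom(3)[OF \<gamma>] _ v]
    by (simp add: mc_forms_value_def forms_bracket_1[OF fin] forms_bracket_2 forms_bracket_3 conv_bracket_1
        conv_bracket_2
        conv_bracket_3 zin_delta_short fextW del: of_nat_Suc)
qed

text \<open>The coefficient at \<open>t\<^sup>n dt\<close> of \<open>\<beta>(l\<^sub>2(x, y)) - \<alpha>\<^sup>2'(x, y) - m\<^sub>2(\<alpha>\<^sup>1 x, \<beta> y) - m\<^sub>2(\<beta> x, \<alpha>\<^sup>1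
  y)\<close>. The double sum is the product of polynomials; the factor \<open>1/2\<close> of the equation is used up by
  the two places where \<open>dt\<close> can stand.\<close>

lemma mc_forms_value_dt_pair:
  assumes \<gamma>: "\<gamma> \<in> conv_forms V W (- 1)" and K: "msupp \<gamma> \<subseteq> {..K} \<times> UNIV"
    and x: "x \<in> gr V 0" and y: "y \<in> gr V 0"
  shows "mc_forms_value \<gamma> (n, True) [x, y] = \<gamma> (n, True) [br2 V x y]
    - scl W (of_nat (Suc n)) (\<gamma> (Suc n, False) [x, y])
    - (\<Sum>i\<le>K. \<Sum>j\<le>K. if i + j = n then
        br2 W (\<gamma> (i, False) [x]) (\<gamma> (j, True) [y]) + br2 W (\<gamma> (j, True) [x]) (\<gamma> (i, False) [y]) else 0)"
proof -
  let ?P = "\<lambda>i j. br2 W (\<gamma> (i, False) [x]) (\<gamma> (j, True) [y]) + br2 W (\<gamma> (j, True) [x]) (\<gamma> (i, False) [y])"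
  have fin: "finite (msupp \<gamma>)" using \<gamma> by (simp add: conv_forms_def)
  have w: "[x, y] \<in> hwords V" using x y by (simp add: hwords_def)
  have "\<gamma> (n, True) [x, y] = 0"
    by (rule conv_hom_long[OF conv_forms_hom(3)[OF \<gamma>] w]) (simp add: wdeg_simps ldeg_simps(1) x y)
  moreover have "\<gamma> (n, True) [0, y] = 0" "\<gamma> (n, True) [x, 0] = 0"
    using linear_ops(3)[OF conv_hom_lin(2)[OF conv_forms_hom(3)[OF \<gamma>]]] linear_ops(3)[OF conv_hom_lin(3)[OF
        conv_forms_hom(3)[OF \<gamma>]]]
    by simp_all
  ultimately have 1: "forms_bracket V W [- 1] [\<gamma>] (n, True) [x, y]
      = \<gamma> (n, True) [br2 V x y] - scl W (of_nat (Suc n)) (\<gamma> (Suc n, False) [x, y])"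
    using conv_hom_zin_D_short(2)[OF conv_forms_hom(3)[OF \<gamma>] _ w]
    by (simp add: forms_bracket_1[OF fin] conv_bracket_1 W.br_ops x y V.br_gr_low(1) ldeg_simps(1) del:
        of_nat_Suc)
  have "forms_bracket V W [- 1, - 1] [\<gamma>, \<gamma>] (n, True) [x, y]
     = (\<Sum>i\<le>K. \<Sum>j\<le>K. (if i + j = n then ?P i j else 0) + (if j + i = n then ?P j i else 0))"
  proof -
    let ?F = "\<lambda>a b. scl W (psgn (mono_deg a * (- 1 - mono_deg b)) * mono_coeff (form_mult (mono_form a)
        (mono_form b)) (n, True))
       (conv_bracket V W [- 1 - mono_deg a, - 1 - mono_deg b] [\<gamma> a, \<gamma> b] [x, y])"
    have F: "?F (i, b) (j, c) = (if b \<noteq> c \<and> i + j = n then if b then ?P j i else ?P i j else 0)" for i j b c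
      by (cases b; cases c) (simp_all only: mono_coeff_mult_dt conv_bracket_2 zin_delta_short fextW,
        simp_all add: mono_deg_def wdeg_simps ldeg_simps(1) x psgn_simps add.commute)
    have "forms_bracket V W [- 1, - 1] [\<gamma>, \<gamma>] (n, True) [x, y] = (\<Sum>a\<in>msupp \<gamma>. \<Sum>b\<in>msupp \<gamma>. ?F a b)"
      by (rule forms_bracket_2)
    also have "\<dots> = (\<Sum>a\<in>msupp \<gamma>. \<Sum>j\<le>K. ?F a (j, False) + ?F a (j, True))"
      by (intro sum.cong refl sum_msupp[OF K]) (simp add: conv_bracket_2 zin_delta_short fextW W.br_ops)
    also have "\<dots> = (\<Sum>i\<le>K. (\<Sum>j\<le>K. ?F (i, False) (j, False) + ?F (i, False) (j, True))
        + (\<Sum>j\<le>K. ?F (i, True) (j, False) + ?F (i, True) (j, True)))"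
      by (rule sum_msupp[OF K]) (simp add: conv_bracket_2 zin_delta_short fextW W.br_ops)
    also have "\<dots> = (\<Sum>i\<le>K. \<Sum>j\<le>K. (if i + j = n then ?P i j else 0) + (if j + i = n then ?P j i else 0))"
      unfolding sum.distrib[symmetric] F by (intro sum.cong refl) (simp add: add.commute)
    finally show ?thesis .
  qed
  also have "\<dots> = (\<Sum>i\<le>K. \<Sum>j\<le>K. if i + j = n then ?P i j else 0) + (\<Sum>i\<le>K. \<Sum>j\<le>K. if i + j = n then ?P i j else 0)"
    unfolding sum.distrib by (rule arg_cong2[where f = "(+)", OF refl sum.swap])
  finally have 2: "scl W (1 / 2) (forms_bracket V W [- 1, - 1] [\<gamma>, \<gamma>] (n, True) [x, y])
    = (\<Sum>i\<le>K. \<Sum>j\<le>K. if i + j = n then ?P i j else 0)"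
    by (simp only: scale_fractions(2))
  show ?thesis
    unfolding mc_forms_value_def 1 2 by (simp add: forms_bracket_3 conv_bracket_3)
qed

end

section \<open>Integrating an infinity-homotopy\<close>

text \<open>The \<open>dt\<close>-part integrated over the interval and restricted to single letters: \<open>\<integral>\<^sub>0\<^sup>1 t\<^sup>n dt =
  1/(n+1)\<close>.\<close>

definition dt_integral :: "('k::field_char_0, 'w::ab_group_add) leib2 \<Rightarrow> (mono \<Rightarrow> 'v list \<Rightarrow> 'w) \<Rightarrow> 'v \<Rightarrow> 'w" where
  "dt_integral W \<gamma> u = (\<Sum>e\<in>msupp \<gamma>. scl W (if snd e then 1 / of_nat (Suc (fst e)) else 0) (\<gamma> e [u]))"

context leibniz2_pair
begin

lemma dt_integral_sum:
  assumes "msupp \<gamma> \<subseteq> {..K} \<times> UNIV"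
  shows "dt_integral W \<gamma> u = (\<Sum>n\<le>K. scl W (1 / of_nat (Suc n)) (\<gamma> (n, True) [u]))"
  unfolding dt_integral_def using assms by (subst sum_msupp) simp_all

text \<open>Write \<open>a\<^sub>n\<close>, \<open>b\<^sub>n\<close> for the coefficients of \<open>\<alpha>\<close>, \<open>\<beta>\<close> and \<open>c\<^sub>n = 1/(n+1)\<close>. The differential
  equation reads \<open>a\<^bsub>n+1\<^esub> = c\<^sub>n (m\<^sub>1 b\<^sub>n + b\<^sub>n l\<^sub>1)\<close> on letters, and summing over \<open>n\<close> gives the
  endpoint minus the starting point. For pairs, inserting this equation into the terms \<open>c\<^bsub>i+j\<^esub>
  m\<^sub>2(a\<^sub>i x, b\<^sub>j y)\<close> and \<open>c\<^bsub>i+j\<^esub> m\<^sub>2(b\<^sub>j x, a\<^sub>i y)\<close> with \<open>i > 0\<close> leaves multiples of \<open>m\<^sub>2(b\<^sub>i x, m\<^sub>1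
  b\<^sub>j y)\<close>, and \<open>c\<^bsub>i+j+1\<^esub> (c\<^sub>i + c\<^sub>j) = c\<^sub>i c\<^sub>j\<close> makes their sum factor into \<open>m\<^sub>2(\<theta> x, m\<^sub>1 \<theta> y)\<close>.
  This identity is integration by parts for monomials.\<close>

theorem homotopy_2term_dt_integral:
  assumes h: "infinity_homotopy V W f g \<gamma>"
  shows "homotopy_2term V W f g (dt_integral W \<gamma>)"
proof -
  have mc: "mc_forms V W \<gamma>" and e0: "conv_eval W 0 \<gamma> = mc_of f" and e1: "conv_eval W 1 \<gamma> = mc_of g"
    using h by (simp_all add: infinity_homotopy_def)
  have \<gamma>: "\<gamma> \<in> conv_forms V W (- 1)" and mc0: "w \<in> hwords V \<Longrightarrow> mc_forms_value \<gamma> e w = 0" for e w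
    using mc unfolding mc_forms_iff by blast+
  obtain K where K: "msupp \<gamma> \<subseteq> {..K} \<times> UNIV" using msupp_bound[OF \<gamma>] .
  define A where "A n = \<gamma> (n, False)" for n
  define B where "B n u = \<gamma> (n, True) [u]" for n u
  define c :: "nat \<Rightarrow> 'k" where "c n = 1 / of_nat (Suc n)" for n
  define \<theta> where "\<theta> = dt_integral W \<gamma>"
  have \<theta>: "\<theta> u = (\<Sum>n\<le>K. scl W (c n) (B n u))" for u
    using dt_integral_sum[OF K, of u] by (simp add: \<theta>_def c_def B_def)
  have hom: "\<gamma> (n, True) \<in> conv_hom V W 0" for n by (rule conv_forms_hom(3)[OF \<gamma>])
  have B_lin: "lin (B n)" for n unfolding B_def[abs_def] by (rule conv_hom_lin(1)[OF hom])
  have lin: "lin \<theta>"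
    unfolding lin_iff \<theta> using linear_ops(1)[OF B_lin] linear_scale[OF B_lin]
    by (simp add: W.vs.scale_right_distrib sum.distrib W.vs.scale_sum_right W.vs.scale_left_commute
        mult.commute)
  have B_gr: "B n u \<in> gr W (i + 1)" if u: "u \<in> gr V i" for n u i
  proof (cases "u = 0")
    case True
    then show ?thesis using linear_ops(3)[OF B_lin] W.gr_ops by simp
  next
    case False
    then have "i = 0 \<or> i = 1" using V.gr_outside[OF u] by blast
    moreover from this have "ldeg V u = i" using u False gr_int[OF V.leibniz, of u] by (auto simp: ldeg_def)
    moreover from calculation have "[u] \<in> hwords V" using u by (auto simp: hwords_def)
    ultimately show ?thesis using conv_hom_gr[OF hom, of "[u]" n] by (simp add: B_def wdeg_simps)
  qed
  have deg: "\<theta> u \<in> gr W (i + 1)" if "u \<in> gr V i" for u i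
    unfolding \<theta> using that by (intro gr_sum W.gr_ops(4) B_gr)
  have inv: "scl W (c n) (scl W (of_nat (Suc n)) u) = u" for n u
    by (simp add: c_def del: of_nat_Suc)
  have A1: "A (Suc n) [v] = scl W (c n) (br1 W (B n v) + B n (br1 V v))" if "[v] \<in> hwords V" for n v
  proof -
    have "scl W (of_nat (Suc n)) (A (Suc n) [v]) = br1 W (B n v) + B n (br1 V v)"
      using mc_forms_value_dt_letter[OF \<gamma> that, of n] mc0[OF that, of "(n, True)"]
      by (simp add: A_def B_def del: of_nat_Suc)
    then show ?thesis using inv[of n "A (Suc n) [v]"] by simp
  qed
  have A_high: "A n w = 0" if "K < n" for n w
    using that K not_msupp[of "(n, False)" \<gamma>] by (fastforce simp: A_def)
  have ends: "mc_of f w = A 0 w" "K \<le> N \<Longrightarrow> mc_of g w - mc_of f w = (\<Sum>n\<le>N. A (Suc n) w)" for w N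
  proof -
    have KN: "msupp \<gamma> \<subseteq> {..max K N} \<times> UNIV" using K by fastforce
    have "mc_of f w = (\<Sum>n\<le>K. if n = 0 then A n w else 0)"
      unfolding e0[symmetric] conv_eval_sum[OF K] by (intro sum.cong refl) (simp add: A_def power_0_left)
    then show f: "mc_of f w = A 0 w" by (simp add: sum.delta)
    assume N: "K \<le> N"
    have "mc_of g w = (\<Sum>n\<le>Suc N. A n w)"
      unfolding e1[symmetric] conv_eval_sum[OF KN] using N A_high[of "Suc N" w] by (simp add: A_def max_absorb2)
    then show "mc_of g w - mc_of f w = (\<Sum>n\<le>N. A (Suc n) w)"
      unfolding f by (simp only: sum.atMost_Suc_shift) simp
  qed
  have fst_f: "fst f v = A 0 [v]" for v using ends(1)[of "[v]"] by simp
  have diff1: "fst g v - fst f v = br1 W (\<theta> v) + \<theta> (br1 V v)" if "[v] \<in> hwords V" for v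
  proof -
    have "fst g v - fst f v = (\<Sum>n\<le>K. A (Suc n) [v])" using ends(2)[of K "[v]"] by simp
    also have "\<dots> = br1 W (\<theta> v) + \<theta> (br1 V v)"
      unfolding \<theta> by (simp add: A1[OF that] linear_sum[OF W.br1_linear] W.br_scale W.vs.scale_right_distrib
          sum.distrib)
    finally show ?thesis .
  qed
  have snd_diff: "snd g x y - snd f x y = \<theta> (br2 V x y) - br2 W (fst f x) (\<theta> y) - br2 W (\<theta> x) (fst g y)"
    if x: "x \<in> gr V 0" and y: "y \<in> gr V 0" for x y
  proof -
    have hx: "[x] \<in> hwords V" "[y] \<in> hwords V" and hxy: "[x, y]
        \<in> hwords V" using x y by (simp_all add: hwords_def)
    have B1: "B n x \<in> gr W 1" "B n y \<in> gr W 1" for n using B_gr[OF x] B_gr[OF y] by simp_all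
    have A0: "A (Suc n) [x] = scl W (c n) (br1 W (B n x))" "A (Suc n) [y] = scl W (c n) (br1 W (B n y))" for n
      using A1[OF hx(1)] A1[OF hx(2)] x y by (simp_all add: V.br_gr_low(1) linear_ops(3)[OF B_lin])
    define P where "P i j = br2 W (A i [x]) (B j y) + br2 W (B j x) (A i [y])" for i j
    define Q where "Q i j = br2 W (B i x) (br1 W (B j y))" for i j
    have A2: "A (Suc n) [x, y] = scl W (c n) (B n (br2 V x y)) - scl W (c n) (\<Sum>i\<le>K. \<Sum>j\<le>K. if i + j
        = n then P i j else 0)" for n
    proof -
      have "scl W (of_nat (Suc n)) (A (Suc n) [x, y]) = B n (br2 V x y) - (\<Sum>i\<le>K. \<Sum>j\<le>K. if i + j
          = n then P i j else 0)"
        using mc_forms_value_dt_pair[OF \<gamma> K x y, of n] mc0[OF hxy, of "(n, True)"]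
        unfolding A_def B_def P_def by (simp add: algebra_simps)
      then show ?thesis using inv[of n "A (Suc n) [x, y]"] by (simp add: W.vs.scale_right_diff_distrib)
    qed
    have "snd g x y - snd f x y = (\<Sum>n\<le>2 * K. A (Suc n) [x, y])" using ends(2)[of "2 * K" "[x, y]"] by simp
    also have "\<dots> = (\<Sum>n\<le>2 * K. scl W (c n) (B n (br2 V x y)))
        - (\<Sum>n\<le>2 * K. scl W (c n) (\<Sum>i\<le>K. \<Sum>j\<le>K. if i + j = n then P i j else 0))"
      by (simp add: A2 sum_subtractf)
    also have "(\<Sum>n\<le>2 * K. scl W (c n) (B n (br2 V x y))) = \<theta> (br2 V x y)"
    proof -
      have "msupp \<gamma> \<subseteq> {..2 * K} \<times> UNIV" using K by fastforce
      from dt_integral_sum[OF this] show ?thesis by (simp add: \<theta>_def c_def B_def)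
    qed
    also have "(\<Sum>n\<le>2 * K. scl W (c n) (\<Sum>i\<le>K. \<Sum>j\<le>K. if i + j = n then P i j else 0))
        = (\<Sum>i\<le>K. \<Sum>j\<le>K. scl W (c (i + j)) (P i j))"
    proof -
      have "(\<Sum>n\<le>2 * K. scl W (c n) (\<Sum>i\<le>K. \<Sum>j\<le>K. if i + j = n then P i j else 0))
        = (\<Sum>i\<le>K. \<Sum>j\<le>K. \<Sum>n\<le>2 * K. scl W (c n) (if i + j = n then P i j else 0))"
        unfolding W.vs.scale_sum_right by (rule trans[OF sum.swap sum.cong[OF refl sum.swap]])
      also have "\<dots> = (\<Sum>i\<le>K. \<Sum>j\<le>K. scl W (c (i + j)) (P i j))"
        by (intro sum.cong refl) (simp add: if_distrib[of "scl W _"] sum.delta cong: if_cong)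
      finally show ?thesis .
    qed
    also have "\<dots> = (\<Sum>i\<le>K. \<Sum>j\<le>K. scl W (c (i + j)) (br2 W (A i [x]) (B j y)))
        + (\<Sum>i\<le>K. \<Sum>j\<le>K. scl W (c (i + j)) (br2 W (B j x) (A i [y])))"
      by (simp add: P_def W.vs.scale_right_distrib sum.distrib)
    also have "(\<Sum>i\<le>K. \<Sum>j\<le>K. scl W (c (i + j)) (br2 W (A i [x]) (B j y)))
        = br2 W (fst f x) (\<theta> y) + (\<Sum>i\<le>K. \<Sum>j\<le>K. scl W (c (Suc (i + j)) * c i) (Q i j))"
    proof -
      let ?F = "\<lambda>i. \<Sum>j\<le>K. scl W (c (i + j)) (br2 W (A i [x]) (B j y))"
      have "(\<Sum>i\<le>K. ?F i) = (\<Sum>i\<le>Suc K. ?F i)" by (simp add: A_high W.br_ops)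
      also have "\<dots> = ?F 0 + (\<Sum>i\<le>K. ?F (Suc i))" by (rule sum.atMost_Suc_shift)
      also have "?F 0 = br2 W (fst f x) (\<theta> y)" by (simp add: fst_f \<theta> br_sum W.br_scale)
      also have "(\<Sum>i\<le>K. ?F (Suc i)) = (\<Sum>i\<le>K. \<Sum>j\<le>K. scl W (c (Suc (i + j)) * c i) (Q i j))"
        using B1 by (simp add: A0 W.br_scale Q_def W.br_identities(3))
      finally show ?thesis .
    qed
    also have "(\<Sum>i\<le>K. \<Sum>j\<le>K. scl W (c (i + j)) (br2 W (B j x) (A i [y])))
        = br2 W (\<theta> x) (fst f y) + (\<Sum>i\<le>K. \<Sum>j\<le>K. scl W (c (Suc (i + j)) * c j) (Q i j))"
    proof -
      let ?F = "\<lambda>i. \<Sum>j\<le>K. scl W (c (i + j)) (br2 W (B j x) (A i [y]))"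
      have "(\<Sum>i\<le>K. ?F i) = (\<Sum>i\<le>Suc K. ?F i)" by (simp add: A_high W.br_ops)
      also have "\<dots> = ?F 0 + (\<Sum>i\<le>K. ?F (Suc i))" by (rule sum.atMost_Suc_shift)
      also have "?F 0 = br2 W (\<theta> x) (fst f y)" by (simp add: fst_f \<theta> br_sum W.br_scale)
      also have "(\<Sum>i\<le>K. ?F (Suc i)) = (\<Sum>i\<le>K. \<Sum>j\<le>K. scl W (c (Suc (j + i)) * c i) (Q j i))"
        by (simp add: A0 W.br_scale Q_def add.commute)
      also have "(\<Sum>i\<le>K. \<Sum>j\<le>K. scl W (c (Suc (j + i)) * c i) (Q j i))
          = (\<Sum>i\<le>K. \<Sum>j\<le>K. scl W (c (Suc (i + j)) * c j) (Q i j))"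
        by (rule sum.swap)
      finally show ?thesis .
    qed
    also have "br2 W (fst f x) (\<theta> y) + (\<Sum>i\<le>K. \<Sum>j\<le>K. scl W (c (Suc (i + j)) * c i) (Q i j))
        + (br2 W (\<theta> x) (fst f y) + (\<Sum>i\<le>K. \<Sum>j\<le>K. scl W (c (Suc (i + j)) * c j) (Q i j)))
      = br2 W (fst f x) (\<theta> y) + br2 W (\<theta> x) (fst f y) + (\<Sum>i\<le>K. \<Sum>j\<le>K. scl W (c i * c j) (Q i j))"
    proof -
      have "c (Suc (i + j)) * c i + c (Suc (i + j)) * c j = c i * c j" for i j
      proof -
        have "of_nat (Suc i) \<noteq> (0::'k)" "of_nat (Suc j) \<noteq> (0::'k)" "of_nat (Suc (Suc (i + j))) \<noteq> (0::'k)"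
          by (simp_all del: of_nat_Suc)
        moreover have "(of_nat (Suc (Suc (i + j))) :: 'k) = of_nat (Suc i) + of_nat (Suc j)" by simp
        ultimately show ?thesis unfolding c_def by (simp add: divide_simps del: of_nat_Suc)
      qed
      then have "(\<Sum>i\<le>K. \<Sum>j\<le>K. scl W (c i * c j) (Q i j)) = (\<Sum>i\<le>K. \<Sum>j\<le>K. scl W (c (Suc (i + j)) * c i) (Q i j))
          + (\<Sum>i\<le>K. \<Sum>j\<le>K. scl W (c (Suc (i + j)) * c j) (Q i j))"
        by (simp only: sum.distrib[symmetric] W.vs.scale_left_distrib[symmetric])
      then show ?thesis by (simp add: algebra_simps)
    qed
    also have "(\<Sum>i\<le>K. \<Sum>j\<le>K. scl W (c i * c j) (Q i j)) = br2 W (\<theta> x) (br1 W (\<theta> y))"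
      unfolding \<theta> linear_sum[OF W.br1_linear] br_sum(1) unfolding br_sum(2) Q_def by (simp add: W.br_scale
          mult.commute)
    finally have "snd g x y - snd f x y = \<theta> (br2 V x y) - (br2 W (fst f x) (\<theta> y) + br2 W (\<theta> x) (fst f y)
        + br2 W (\<theta> x) (br1 W (\<theta> y)))" .
    moreover have "fst g y = fst f y + br1 W (\<theta> y)"
      using diff1[OF hx(2)] y by (simp add: V.br_gr_low(1) linear_ops(3)[OF lin] diff_eq_eq add.commute)
    ultimately show ?thesis by (simp add: W.br_ops algebra_simps)
  qed
  have diff_x: "fst g x - fst f x = br1 W (\<theta> x)" if "x \<in> gr V 0" for x
    using diff1[of x] that by (simp add: hwords_def V.br_gr_low(1) linear_ops(3)[OF lin])
  have diff_h: "fst g h - fst f h = \<theta> (br1 V h)" if "h \<in> gr V 1" for h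
    using diff1[of h] that W.gr_outside[OF deg[OF that]] by (simp add: hwords_def W.br_ops)
  show ?thesis
    unfolding homotopy_2term_def Let_def \<theta>_def[symmetric]
    using lin deg diff_x diff_h snd_diff by (intro conjI ballI allI) simp_all
qed

end

section \<open>The path with constant speed\<close>

context leibniz2_pair
begin

text \<open>The solution of the differential equation with \<open>\<beta> = \<theta>\<close> constant and initial value \<open>f\<close>. The
  coefficient of \<open>t\<^sup>2\<close> comes from \<open>m\<^sub>2(m\<^sub>1 \<theta> u, \<theta> v) + m\<^sub>2(\<theta> u, m\<^sub>1 \<theta> v)\<close>, where both summands agree
  on \<open>V\<^sub>0\<close>.\<close>

definition constant_speed_path :: "('v, 'w) inf_mor \<Rightarrow> ('v \<Rightarrow> 'w) \<Rightarrow> mono \<Rightarrow> 'v list \<Rightarrow> 'w" where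
  "constant_speed_path f \<theta> e =
    (if e = (0, False) then mc_of f
     else if e = (1, False) then mc_of (\<lambda>u. br1 W (\<theta> u) + \<theta> (br1 V u),
       \<lambda>u v. \<theta> (br2 V u v) - br2 W (fst f u) (\<theta> v) - br2 W (\<theta> u) (fst f v))
     else if e = (2, False) then mc_of (\<lambda>u. 0, \<lambda>u v. - br2 W (\<theta> u) (br1 W (\<theta> v)))
     else if e = (0, True) then mc_of (\<theta>, \<lambda>u v. 0)
     else (\<lambda>w. 0))"

lemma constant_speed_path_simps:
  "constant_speed_path f \<theta> (0, False) = mc_of f"
  "constant_speed_path f \<theta> (Suc 0, False) = mc_of (\<lambda>u. br1 W (\<theta> u) + \<theta> (br1 V u),
       \<lambda>u v. \<theta> (br2 V u v) - br2 W (fst f u) (\<theta> v) - br2 W (\<theta> u) (fst f v))"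
  "constant_speed_path f \<theta> (2, False) = mc_of (\<lambda>u. 0, \<lambda>u v. - br2 W (\<theta> u) (br1 W (\<theta> v)))"
  "n > 2 \<Longrightarrow> constant_speed_path f \<theta> (n, False) = (\<lambda>w. 0)"
  "constant_speed_path f \<theta> (0, True) = mc_of (\<theta>, \<lambda>u v. 0)"
  "n > 0 \<Longrightarrow> constant_speed_path f \<theta> (n, True) = (\<lambda>w. 0)"
  by (auto simp: constant_speed_path_def)

lemma msupp_constant_speed_path: "msupp (constant_speed_path f \<theta>) \<subseteq> {..2} \<times> UNIV"
  by (auto simp: msupp_def constant_speed_path_def split: if_splits)

context
  fixes f :: "('v, 'w) inf_mor" and \<theta> :: "'v \<Rightarrow> 'w"
  assumes f: "infinity_morphism V W f"
    and lin_\<theta>: "lin \<theta>" and deg_\<theta>: "\<And>i u. u \<in> gr V i \<Longrightarrow> \<theta> u \<in> gr W (i + 1)"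
begin

lemma constant_speed_path_conv_forms: "constant_speed_path f \<theta> \<in> conv_forms V W (- 1)"
proof -
  note F = infinity_morphism_facts[OF f]
  have Z: "lin (\<lambda>v. 0)" by (simp add: lin_iff)
  have deg2: "br1 W (\<theta> u) \<in> gr W i" "\<theta> (br1 V u) \<in> gr W i" if "u \<in> gr V i" for u i
    using W.br_gr(1)[OF deg_\<theta>[OF that]] deg_\<theta>[OF V.br_gr(1)[OF that]] by simp_all
  have deg3: "\<theta> (br2 V u v) \<in> gr W (1 + (i + j))" "br2 W (fst f u) (\<theta> v) \<in> gr W (1 + (i + j))"
    "br2 W (\<theta> u) (fst f v) \<in> gr W (1 + (i + j))" "br2 W (\<theta> u) (br1 W (\<theta> v)) \<in> gr W (1 + (i + j))"
    if "u \<in> gr V i" "v \<in> gr V j" for u v i j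
    using deg_\<theta>[OF V.br_gr(2)[OF that]] W.br_gr(2)[OF F(4)[OF that(1)] deg_\<theta>[OF that(2)]]
      W.br_gr(2)[OF deg_\<theta>[OF that(1)] F(4)[OF that(2)]] W.br_gr(2)[OF deg_\<theta>[OF that(1)] deg2(1)[OF that(2)]]
    by (simp_all add: ac_simps)
  note lin' = linear_ops[OF lin_\<theta>] linear_ops[OF F(1)] V.br_ops W.br_ops V.br_scale W.br_scale
    linear_scale[OF lin_\<theta>] linear_scale[OF F(1)] W.vs.scale_right_distrib W.vs.scale_right_diff_distrib
  have neg: "u \<in> gr W i \<Longrightarrow> - u \<in> gr W i" for u i using W.gr_ops(3)[OF W.gr_ops(1)] by force
  have "constant_speed_path f \<theta> (0, False) \<in> conv_hom V W (- 1)"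
    unfolding constant_speed_path_simps by (rule mc_of_conv_hom[OF f])
  moreover have "constant_speed_path f \<theta> (Suc 0, False) \<in> conv_hom V W (- 1)"
    unfolding constant_speed_path_simps by (rule mc_of_hom) (auto simp: lin_iff lin' deg2 deg3 W.gr_ops)
  moreover have "constant_speed_path f \<theta> (2, False) \<in> conv_hom V W (- 1)"
    unfolding constant_speed_path_simps by (rule mc_of_hom) (auto simp: lin_iff lin' deg3 W.gr_ops neg)
  moreover have "constant_speed_path f \<theta> (0, True) \<in> conv_hom V W 0"
    unfolding constant_speed_path_simps by (rule mc_of_hom) (auto simp: lin_\<theta> deg_\<theta> W.gr_ops Z)
  moreover have "(\<lambda>w. 0) \<in> conv_hom V W d" for d
    by (simp add: conv_hom_def Z W.gr_ops)
  ultimately have "constant_speed_path f \<theta> e \<in> conv_hom V W (- 1 - mono_deg e)" for e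
    by (simp add: constant_speed_path_def mono_deg_def)
  moreover have "finite (msupp (constant_speed_path f \<theta>))"
    by (rule finite_subset[OF msupp_constant_speed_path]) simp
  ultimately show ?thesis by (simp add: conv_forms_def)
qed

lemma conv_eval_constant_speed_path: "conv_eval W t (constant_speed_path f \<theta>)
    = mc_of (homotopy_target (\<lambda>u. scl W t (\<theta> u)) f)"
proof
  fix w
  have "{..2::nat} = {0, 1, 2}" by auto
  then have "conv_eval W t (constant_speed_path f \<theta>) w = constant_speed_path f \<theta> (0, False) w
      + (scl W t (constant_speed_path f \<theta> (Suc 0, False) w)
          + scl W (t\<^sup>2) (constant_speed_path f \<theta> (2, False) w))"
    by (simp add: conv_eval_sum[OF msupp_constant_speed_path])
  also have "\<dots> = mc_of (homotopy_target (\<lambda>u. scl W t (\<theta> u)) f) w"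
    unfolding constant_speed_path_simps
    by (cases "(f, w)" rule: mc_of.cases)
      (simp_all add: homotopy_target_def W.br_scale W.br_ops W.vs.scale_right_distrib
          W.vs.scale_right_diff_distrib power2_eq_square)
  finally show "conv_eval W t (constant_speed_path f \<theta>) w = mc_of (homotopy_target (\<lambda>u. scl W t (\<theta> u)) f) w" .
qed

lemma homotopy_target_scaled: "infinity_morphism V W (homotopy_target (\<lambda>u. scl W t (\<theta> u)) f)"
  by (rule infinity_morphism_homotopy_target[OF f])
    (auto simp: lin_iff linear_ops[OF lin_\<theta>] linear_scale[OF lin_\<theta>] W.vs.scale_right_distrib mult.commute
        W.gr_ops deg_\<theta>)

lemma mc_forms_constant_speed_path: "mc_forms V W (constant_speed_path f \<theta>)"
  unfolding mc_forms_iff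
proof (intro conjI allI ballI)
  note \<gamma> = constant_speed_path_conv_forms
  note F = infinity_morphism_facts[OF f]
  show "constant_speed_path f \<theta> \<in> conv_forms V W (- 1)" by (rule \<gamma>)
  fix e :: mono and w assume w: "w \<in> hwords V"
  obtain n b where e: "e = (n, b)" by (cases e)
  show "mc_forms_value (constant_speed_path f \<theta>) e w = 0"
  proof (cases b)
    case False
    have "mc_forms_value (constant_speed_path f \<theta>) (n, False) w = 0"
      by (rule mc_forms_value_0_form[OF \<gamma> _ w]) (use conv_eval_constant_speed_path homotopy_target_scaled in
          blast)
    with False show ?thesis by (simp add: e)
  next
    case True
    show ?thesis
    proof (cases "wdeg V w \<in> {1, 2}")
      case False
      then show ?thesis
        using mc_forms_value_gr[OF \<gamma> w, of e] True
        by (intro W.gr_outside[of _ "wdeg V w - 1"]) (auto simp: mono_deg_def e)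
    next
      case d: True
      then consider v where "w = [v]" | x y where "w = [x, y]" "x \<in> gr V 0" "y \<in> gr V 0"
      proof -
        have "length w \<le> 2" "w \<noteq> []" using length_wdeg[OF w] d w by (auto simp: hwords_def)
        then consider v where "w = [v]" | x y where "w = [x, y]"
          by (cases w; cases "tl w"; cases "tl (tl w)") auto
        then show ?thesis
        proof cases
          case (2 x y)
          then have "ldeg V x = 0" "ldeg V y = 0" using d by (auto simp: wdeg_simps ldeg_def split: if_splits)
          then have "x \<in> gr V 0" "y \<in> gr V 0" by (auto simp: ldeg_def split: if_splits)
          with 2 that(2) show ?thesis by blast
        qed (rule that(1))
      qed
      then show ?thesis
      proof cases
        case (1 v)
        have "mc_forms_value (constant_speed_path f \<theta>) (n, True) [v]
            = br1 W (constant_speed_path f \<theta> (n, True) [v]) + constant_speed_path f \<theta> (n, True) [br1 V v]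
            - scl W (of_nat (Suc n)) (constant_speed_path f \<theta> (Suc n, False) [v])"
          using mc_forms_value_dt_letter[OF \<gamma>] w 1 by simp
        also have "\<dots> = 0"
        proof (cases "n = 0")
          case False
          then have "constant_speed_path f \<theta> (Suc n, False) [v] = 0" by (simp add: constant_speed_path_def)
          with False show ?thesis by (simp add: constant_speed_path_simps W.br_ops)
        qed (simp add: constant_speed_path_simps)
        finally show ?thesis by (simp add: e True 1)
      next
        case (2 x y)
        let ?\<gamma> = "constant_speed_path f \<theta>"
        have x1: "br2 W (br1 W (\<theta> x)) (\<theta> y) = br2 W (\<theta> x) (br1 W (\<theta> y))"
          using deg_\<theta>[OF 2(2)] deg_\<theta>[OF 2(3)] by (simp add: W.br_identities(3))
        have l1: "\<theta> (br1 V x) = 0" "\<theta> (br1 V y) = 0" using 2 by (simp_all add: V.br_gr_low(1) linear_ops(3)[OF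
            lin_\<theta>])
        have "(\<Sum>i\<le>2. \<Sum>j\<le>2. if i + j = n then
            br2 W (?\<gamma> (i, False) [x]) (?\<gamma> (j, True) [y]) + br2 W (?\<gamma> (j, True) [x]) (?\<gamma> (i, False) [y]) else 0)
          = (if n \<le> 2 then br2 W (?\<gamma> (n, False) [x]) (\<theta> y) + br2 W (\<theta> x) (?\<gamma> (n, False) [y]) else 0)"
        proof -
          have "(if i + j = n then br2 W (?\<gamma> (i, False) [x]) (?\<gamma> (j, True) [y])
              + br2 W (?\<gamma> (j, True) [x]) (?\<gamma> (i, False) [y]) else 0)
            = (if j = 0 then if i = n then br2 W (?\<gamma> (n, False) [x]) (\<theta> y)
                + br2 W (\<theta> x) (?\<gamma> (n, False) [y]) else 0 else 0)" for i j
            by (cases "j = 0") (simp_all add: constant_speed_path_simps W.br_ops)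
          then show ?thesis by (simp add: sum.delta)
        qed
        then have "mc_forms_value ?\<gamma> (n, True) [x, y] = ?\<gamma> (n, True) [br2 V x y]
            - scl W (of_nat (Suc n)) (?\<gamma> (Suc n, False) [x, y])
            - (if n \<le> 2 then br2 W (?\<gamma> (n, False) [x]) (\<theta> y) + br2 W (\<theta> x) (?\<gamma> (n, False) [y]) else 0)"
          using mc_forms_value_dt_pair[OF \<gamma> msupp_constant_speed_path 2(2,3)] by simp
        also have "\<dots> = 0"
        proof -
          consider "n = 0" | "n = 1" | "n = 2" | "n > 2" by linarith
          then show ?thesis
          proof cases
            case 2
            have "(2::nat) = Suc 1" by simp
            with 2 show ?thesis
              using constant_speed_path_simps(3)[of f \<theta>] scale_fractions(1)[of "br2 W (\<theta> x) (br1 W (\<theta> y))"]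
              by (simp add: constant_speed_path_simps x1 l1 numeral_2_eq_2[symmetric] W.br_ops)
          qed (simp_all add: constant_speed_path_simps W.br_ops)
        qed
        finally show ?thesis by (simp add: e True 2)
      qed
    qed
  qed
qed

end

lemma dt_integral_constant_speed_path: "dt_integral W (constant_speed_path f \<theta>) = \<theta>"
proof
  fix u
  have "{..2::nat} = {0, 1, 2}" by auto
  then show "dt_integral W (constant_speed_path f \<theta>) u = \<theta> u"
    by (simp add: dt_integral_sum[OF msupp_constant_speed_path] constant_speed_path_simps)
qed

theorem infinity_homotopy_constant_speed_path:
  assumes f: "infinity_morphism V W f" and g: "infinity_morphism V W g" and h: "homotopy_2term V W f g \<theta>"
  shows "infinity_homotopy V W f g (constant_speed_path f \<theta>)"
proof -
  have \<theta>: "lin \<theta>" "\<And>i u. u \<in> gr V i \<Longrightarrow> \<theta> u \<in> gr W (i + 1)"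
    and g0: "\<And>x. x \<in> gr V 0 \<Longrightarrow> fst g x - fst f x = br1 W (\<theta> x)"
    and g1: "\<And>h. h \<in> gr V 1 \<Longrightarrow> fst g h - fst f h = \<theta> (br1 V h)"
    and g2: "\<And>x y. x \<in> gr V 0 \<Longrightarrow> y \<in> gr V 0 \<Longrightarrow>
       snd g x y - snd f x y = \<theta> (br2 V x y) - br2 W (fst f x) (\<theta> y) - br2 W (\<theta> x) (fst g y)"
    using h by (simp_all add: homotopy_2term_def Let_def)
  note simps = linear_ops(3)[OF \<theta>(1)] V.br_gr_low(1) W.br_ops(3)
  have "homotopy_target \<theta> f = g"
  proof (rule infinity_morphism_eqI[OF _ g])
    show "infinity_morphism V W (homotopy_target \<theta> f)" by (rule infinity_morphism_homotopy_target[OF f \<theta>(1)])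
        (simp add: \<theta>(2))
    show "fst (homotopy_target \<theta> f) x = fst g x" if "x \<in> gr V 0" for x
      using g0[OF that] that by (simp add: homotopy_target_def simps algebra_simps)
    show "fst (homotopy_target \<theta> f) h = fst g h" if "h \<in> gr V 1" for h
      using g1[OF that] W.gr_outside[OF \<theta>(2)[OF that]] by (simp add: homotopy_target_def simps algebra_simps)
    show "snd (homotopy_target \<theta> f) x y = snd g x y" if "x \<in> gr V 0" "y \<in> gr V 0" for x y
    proof -
      have "fst f y + br1 W (\<theta> y) = fst g y" using g0[OF that(2)] by (simp add: algebra_simps)
      then show ?thesis using g2[OF that] by (simp add: homotopy_target_def algebra_simps)
    qed
  qed
  moreover have "homotopy_target (\<lambda>u. 0) f = f" by (simp add: homotopy_target_def W.br_ops)
  ultimately show ?thesis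
    using mc_forms_constant_speed_path[OF f \<theta>] conv_eval_constant_speed_path[OF f \<theta>, of 0]
        conv_eval_constant_speed_path[OF f \<theta>, of 1]
    by (simp add: infinity_homotopy_def)
qed

end

section \<open>The surjection\<close>

definition integrate_homotopy ::
  "('k::field_char_0, 'v::ab_group_add, 'w::ab_group_add, mono \<Rightarrow> 'v list \<Rightarrow> 'w) htpy \<Rightarrow>
   ('k, 'v, 'w, 'v \<Rightarrow> 'w) htpy" where
  "integrate_homotopy = (\<lambda>(V, W, f, g, \<gamma>). (V, W, f, g, dt_integral W \<gamma>))"

lemma integrate_homotopy_in_class_T:
  assumes "p \<in> class_I"
  shows "integrate_homotopy p \<in> class_T"
proof -
  obtain V W f g \<gamma> where p: "p = (V, W, f, g, \<gamma>)" by (cases p)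
  from assms have V: "leibniz_2term V" "leibniz_2term W" by (simp_all add: p class_I_def)
  interpret leibniz2_pair V W by unfold_locales (rule V)+
  from assms show ?thesis
    using homotopy_2term_dt_integral by (simp add: p class_I_def class_T_def integrate_homotopy_def)
qed

lemma integrate_homotopy_onto_class_T:
  assumes "q \<in> class_T"
  shows "q \<in> integrate_homotopy ` class_I"
proof -
  obtain V W f g \<theta> where q: "q = (V, W, f, g, \<theta>)" by (cases q)
  from assms have V: "leibniz_2term V" "leibniz_2term W" by (simp_all add: q class_T_def)
  interpret leibniz2_pair V W by unfold_locales (rule V)+
  have "(V, W, f, g, constant_speed_path f \<theta>) \<in> class_I"
    using assms infinity_homotopy_constant_speed_path by (simp add: q class_I_def class_T_def)
  moreover have "q = integrate_homotopy (V, W, f, g, constant_speed_path f \<theta>)"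
    by (simp add: q integrate_homotopy_def dt_integral_constant_speed_path)
  ultimately show ?thesis by (rule rev_image_eqI)
qed

theorem theorem3:
  shows "\<exists>S :: nat \<Rightarrow>
      ('k::field_char_0, 'v::ab_group_add, 'w::ab_group_add, mono \<Rightarrow> 'v list \<Rightarrow> 'w) htpy \<Rightarrow>
      ('k, 'v, 'w, 'v \<Rightarrow> 'w) htpy.
    \<forall>i\<in>{0, 1}.
      S i ` class_I = class_T \<and>
      (\<forall>V W f g \<gamma>. (V, W, f, g, \<gamma>) \<in> class_I \<longrightarrow> (\<exists>\<theta>. S i (V, W, f, g, \<gamma>) = (V, W, f, g, \<theta>)))"
proof (intro exI[of _ "\<lambda>_. integrate_homotopy"] ballI conjI)
  show "integrate_homotopy ` class_I = class_T"
    using integrate_homotopy_in_class_T integrate_homotopy_onto_class_T by blast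
qed (simp add: integrate_homotopy_def)

end
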